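(* Let $G$ be adjoint of type $\mathbf{D}_n$, $n\ge6$. (1) Any section given by $\mathcal S(s_i)=t_i\sigma_i$ with $$a_{1,1}a_{1,2}^2=a_{2,2}a_{2,3}^2=\cdots=a_{n-2,n-2}a_{n-2,n-1}^2=a_{n-1,n-1}a_{n-1,n-2}^2=a_{n,n}a_{n,n-2}^2=-1$$ is an optimal section (in fact a homomorphic section), whereas the Tits section $\mathcal N_\circ$ is not. Moreover $\mathcal N_\circ(s_i)^2\ne1$ for all $i=1,\dots,n$. There are two order profiles of sections: the one represented by the optimal section, and the one represented by the Tits section. (2) Two sections are $T$-conjugate if and only if they have the same value of $a_{1,1}a_{1,2}^2$. In particular, two sections are $T$-conjugate if and only if they have the same order profile.
   Context: $F$ is an algebraically closed field, $G$ an almost-simple connected reductive group over $F$, $T$ a maximal torus, $N=N_G(T)$, $W=N/T$, $\pi:N\to W$ the projection. Let $\alpha_1,\dots,\alpha_n$ be the simple roots in Bourbaki numbering ($\alpha_i=e_i-e_{i+1}$ for $i<n$, $\alpha_n=e_{n-1}+e_n$), $s_i$ the corresponding reflections, $\alpha_i^\vee$ the simple coroots, $\omega_i$ the fundamental coweights. Fix a realization of the root system: isomorphisms $u_\alpha:\mathbf G_a\to U_\alpha$ onto the root subgroups with $tu_\alpha(x)t^{-1}=u_\alpha(\alpha(t)x)$, such that $\sigma_\alpha=u_\alpha(1)u_{-\alpha}(-1)u_\alpha(1)\in N$ maps to $s_\alpha$ and $u_\alpha(x)u_{-\alpha}(-x^{-1})u_\alpha(x)=\alpha^\vee(x)\sigma_\alpha$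 for $x\in F^\times$; put $\sigma_i=\sigma_{\alpha_i}$. A section is a map $\mathcal S:W\to N$ with $\pi\circ\mathcal S=\mathrm{id}$ satisfying the braid relations (equivalently $\mathcal S$ is multiplicative along reduced expressions). It is determined by $\mathcal S(s_i)=t_i\sigma_i$, $t_i\in T$. The Tits section $\mathcal N_\circ$ is the one with all $t_i=1$. A section is homomorphic if it is a group homomorphism. The order profile of $\mathcal S$ is the Dynkin diagram with the node of each $\alpha_i$ labeled by the order of $\mathcal S(s_i)$. For two sections write $\mathcal S'<\mathcal S$ if the order of $\mathcal S'(s_i)$ is greater than the order of $\mathcal S(s_i)$ for all $i$; this translates to a partial order on order profiles, and a section is called optimal if it has the unique maximal order profile with respect to this partial order. Two sections $\mathcal S,\mathcal S'$ are $T$-conjugate if there is $t\in T$ with $t\mathcal S(w)t^{-1}=\mathcal S'(w)$ for all $w\in W$. Coordinates: $(x_1,\dots,x_n)$ denotes $\omega_1(x_1)\cdots\omega_n(x_n)\in T$. The sections are exactly those given by $t_i$ of the following form, with all $a_{i,j}\in F^\times$: $t_1=(a_{1,1},a_{1,2},1,\dots,1)$; for $2\le i\le n-3$, $t_i$ has coordinates $a_{i,i}^{-1}a_{i,i+1}^{-1},a_{i,i},a_{i,i+1}$ in positions $i-1,i,i+1$ and $1$ elsewhere; $t_{n-2}=(1,\dots,1,a_{n-2,n-2}^{-1}a_{n-2,n-1}^{-1},a_{n-2,n-2},a_{n-2,n-1},a_{n-2,n-1})$; $t_{n-1}=(1,\dots,1,a_{n-1,n-2},a_{n-1,n-1},a_{n-2,n-2}a_{n-2,n-1}^2)$;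 $t_n=(1,\dots,1,a_{n,n-2},a_{n-2,n-2}a_{n-2,n-1}^2,a_{n,n})$; subject to $a_{1,1}a_{1,2}^2=a_{2,2}a_{2,3}^2=\cdots=a_{n-2,n-2}a_{n-2,n-1}^2=a_{n-1,n-1}^{-1}a_{n-1,n-2}^{-2}=a_{n,n}^{-1}a_{n,n-2}^{-2}$ and $(a_{n-2,n-2}a_{n-2,n-1}^2)^2=1$.
   Formalization: The field F is assumed to have characteristic different from 2; in characteristic 2 the Tits section satisfies N_∘(s_i)^2 = α_i^∨(-1) = 1, so the claims that it is not optimal and that there are two order profiles fail. *)

theory Defs
  imports
    "HOL-Analysis.Determinants"
    "HOL-Computational_Algebra.Polynomial"
    "HOL-Library.Extended_Nat"
    "HOL-Algebra.Group_Action"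
    "HOL-Algebra.Multiplicative_Group"
    "HOL-Algebra.Generated_Groups"
begin

section \<open>Linear algebraic groups\<close>

text \<open>An affine algebraic group over the algebraically closed field \<^typ>\<open>'a\<close> is identified with its
  group of \<^typ>\<open>'a\<close>-points, a Zariski-closed subgroup of some general linear group.  The size of
  the matrices is an arbitrary finite index type.\<close>

definition GL :: "('a::field^'m^'m) monoid" where
  "GL = \<lparr>carrier = {A. invertible A}, mult = (**), one = mat 1\<rparr>"

abbreviation gp :: "('a::field^'m^'m) set \<Rightarrow> ('a^'m^'m) monoid" where
  "gp H \<equiv> GL\<lparr>carrier := H\<rparr>"

inductive_set poly_fun :: "('a::field^'m^'m \<Rightarrow> 'a) set" where
  const: "(\<lambda>A. c) \<in> poly_fun"
| entry: "(\<lambda>A. A $ i $ j) \<in> poly_fun"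
| add: "f \<in> poly_fun \<Longrightarrow> g \<in> poly_fun \<Longrightarrow> (\<lambda>A. f A + g A) \<in> poly_fun"
| mult: "f \<in> poly_fun \<Longrightarrow> g \<in> poly_fun \<Longrightarrow> (\<lambda>A. f A * g A) \<in> poly_fun"

definition zclosed :: "('a::field^'m^'m) set \<Rightarrow> bool" where
  "zclosed Z \<longleftrightarrow> (\<exists>P\<subseteq>poly_fun. Z = {A \<in> carrier GL. \<forall>f\<in>P. f A = 0})"

definition alg_group :: "('a::field^'m^'m) set \<Rightarrow> bool" where
  "alg_group H \<longleftrightarrow> subgroup H GL \<and> zclosed H"

definition zconnected :: "('a::field^'m^'m) set \<Rightarrow> bool" where
  "zconnected H \<longleftrightarrow>
     \<not> (\<exists>A B. zclosed A \<and> zclosed B \<and> A \<union> B = H \<and> A \<inter> B = {} \<and> A \<noteq> {} \<and> B \<noteq> {})"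

definition unipotent :: "'a::field^'m^'m \<Rightarrow> bool" where
  "unipotent A \<longleftrightarrow> (\<exists>k. (((**) (A - mat 1)) ^^ k) (mat 1) = 0)"

text \<open>The unipotent radical is the largest closed connected normal unipotent subgroup.\<close>

definition connected_reductive :: "('a::field^'m^'m) set \<Rightarrow> bool" where
  "connected_reductive G \<longleftrightarrow> alg_group G \<and> zconnected G \<and>
     (\<forall>U. alg_group U \<and> zconnected U \<and> U \<lhd> gp G \<and> (\<forall>g\<in>U. unipotent g) \<longrightarrow> U = {mat 1})"

definition almost_simple :: "('a::field^'m^'m) set \<Rightarrow> bool" where
  "almost_simple G \<longleftrightarrow> (\<exists>g\<in>G. \<exists>h\<in>G. g ** h \<noteq> h ** g) \<and>
     (\<forall>H. alg_group H \<and> H \<lhd> gp G \<longrightarrow> H = G \<or> finite H)"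

text \<open>A torus is a connected diagonalizable algebraic group.\<close>

definition torus :: "('a::field^'m^'m) set \<Rightarrow> bool" where
  "torus T \<longleftrightarrow> alg_group T \<and> zconnected T \<and>
     (\<exists>P\<in>carrier GL. \<forall>t\<in>T. \<forall>i j. i \<noteq> j \<longrightarrow> (P ** t ** inv\<^bsub>GL\<^esub> P) $ i $ j = 0)"

definition maximal_torus :: "('a::field^'m^'m) set \<Rightarrow> ('a^'m^'m) set \<Rightarrow> bool" where
  "maximal_torus G T \<longleftrightarrow> torus T \<and> T \<subseteq> G \<and> (\<forall>T'. torus T' \<and> T \<subseteq> T' \<and> T' \<subseteq> G \<longrightarrow> T' = T)"

section \<open>Characters, cocharacters, roots and root subgroups\<close>

text \<open>The regular functions on a closed subset of the general linear group are the restrictions of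
  the quotients of polynomial functions by powers of the determinant.\<close>

definition characters :: "('a::field^'m^'m) set \<Rightarrow> ('a^'m^'m \<Rightarrow> 'a) set" where
  "characters T = {c \<in> extensional T.
     (\<forall>t\<in>T. c t \<noteq> 0) \<and> (\<forall>s\<in>T. \<forall>t\<in>T. c (s ** t) = c s * c t) \<and>
     (\<exists>f\<in>poly_fun. \<exists>k. \<forall>t\<in>T. c t = f t / det t ^ k)}"

definition char_group :: "('a::field^'m^'m) set \<Rightarrow> ('a^'m^'m \<Rightarrow> 'a) monoid" where
  "char_group T = \<lparr>carrier = characters T, mult = (\<lambda>c d. \<lambda>t\<in>T. c t * d t), one = (\<lambda>t\<in>T. 1)\<rparr>"

definition cocharacter :: "('a::field^'m^'m) set \<Rightarrow> ('a \<Rightarrow> 'a^'m^'m) \<Rightarrow> bool" where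
  "cocharacter T l \<longleftrightarrow>
     (\<forall>x. x \<noteq> 0 \<longrightarrow> l x \<in> T) \<and> (\<forall>x y. x \<noteq> 0 \<and> y \<noteq> 0 \<longrightarrow> l (x * y) = l x ** l y) \<and>
     (\<forall>i j. \<exists>p k. \<forall>x. x \<noteq> 0 \<longrightarrow> l x $ i $ j = poly p x / x ^ k)"

text \<open>The tangent space at the identity: all matrices \<open>X\<close> such that for every polynomial function
  \<open>f\<close> vanishing on \<open>G\<close> the derivative at \<open>0\<close> of the polynomial \<open>x \<mapsto> f (1 + x X)\<close> vanishes.\<close>

definition lie_algebra :: "('a::field^'m^'m) set \<Rightarrow> ('a^'m^'m) set" where
  "lie_algebra G = {X. \<forall>f\<in>poly_fun. (\<forall>g\<in>G. f g = 0) \<longrightarrow>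
     (\<forall>p. (\<forall>x. poly p x = f (\<chi> i j. mat 1 $ i $ j + x * X $ i $ j)) \<longrightarrow> poly (pderiv p) 0 = 0)}"

definition roots :: "('a::field^'m^'m) set \<Rightarrow> ('a^'m^'m) set \<Rightarrow> ('a^'m^'m \<Rightarrow> 'a) set" where
  "roots G T = {c \<in> characters T. c \<noteq> \<one>\<^bsub>char_group T\<^esub> \<and>
     (\<exists>X\<in>lie_algebra G. X \<noteq> 0 \<and>
        (\<forall>t\<in>T. t ** X ** inv\<^bsub>GL\<^esub> t = (\<chi> i j. c t * X $ i $ j)))}"

definition adjoint_group :: "('a::field^'m^'m) set \<Rightarrow> ('a^'m^'m) set \<Rightarrow> bool" where
  "adjoint_group G T \<longleftrightarrow> generate (char_group T) (roots G T) = characters T"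

text \<open>\<open>root_hom G T c u\<close>: the map \<open>u\<close> is an isomorphism of the additive group onto a closed subgroup
  of \<open>G\<close> and \<open>t u(x) t\<^sup>-\<^sup>1 = u(c(t) x)\<close>.  Closedness of the image follows from the existence of the
  polynomial left inverse \<open>f\<close>.\<close>

definition root_hom ::
  "('a::field^'m^'m) set \<Rightarrow> ('a^'m^'m) set \<Rightarrow> ('a^'m^'m \<Rightarrow> 'a) \<Rightarrow> ('a \<Rightarrow> 'a^'m^'m) \<Rightarrow> bool" where
  "root_hom G T c u \<longleftrightarrow>
     range u \<subseteq> G \<and> (\<forall>x y. u (x + y) = u x ** u y) \<and>
     (\<forall>i j. \<exists>p. \<forall>x. u x $ i $ j = poly p x) \<and> (\<exists>f\<in>poly_fun. \<forall>x. f (u x) = x) \<and>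
     (\<forall>t\<in>T. \<forall>x. t ** u x ** inv\<^bsub>GL\<^esub> t = u (c t * x))"

text \<open>The root subgroup of a root \<open>c\<close> is the unique subgroup arising as the image of such a map.\<close>

definition is_root_subgroup ::
  "('a::field^'m^'m) set \<Rightarrow> ('a^'m^'m) set \<Rightarrow> ('a^'m^'m \<Rightarrow> 'a) \<Rightarrow> ('a^'m^'m) set \<Rightarrow> bool" where
  "is_root_subgroup G T c U \<longleftrightarrow> {range u |u. root_hom G T c u} = {U}"

section \<open>Type \<open>D\<^sub>n\<close>\<close>

text \<open>The root system of type \<open>D\<^sub>n\<close>: a vector \<open>v\<close> in the span of \<open>e\<^sub>1, \<dots>, e\<^sub>n\<close> is the function
  \<open>k \<mapsto> v\<^sub>k\<close>, which vanishes outside \<open>{1..n}\<close>.\<close>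

definition D_roots :: "nat \<Rightarrow> (nat \<Rightarrow> int) set" where
  "D_roots n = {(\<lambda>k. if k = i then a else if k = j then b else 0) |i j a b.
     1 \<le> i \<and> i < j \<and> j \<le> n \<and> a \<in> {1, -1} \<and> b \<in> {1, -1}}"

definition D_simple :: "nat \<Rightarrow> nat \<Rightarrow> nat \<Rightarrow> int" where
  "D_simple n i = (if i < n then (\<lambda>k. if k = i then 1 else if k = i + 1 then -1 else 0)
     else (\<lambda>k. if k = n - 1 \<or> k = n then 1 else 0))"

definition D_lattice :: "nat \<Rightarrow> (nat \<Rightarrow> int) monoid" where
  "D_lattice n =
     \<lparr>carrier = {\<lambda>k. \<Sum>r\<in>D_roots n. c r * r k |c. True}, mult = (\<lambda>v w k. v k + w k), one = (\<lambda>k. 0)\<rparr>"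

text \<open>The pairing of \<open>v\<close> with the coroot of the root \<open>r\<close>, \<open>2 (v, r) / (r, r)\<close>; here \<open>(r, r) = 2\<close>.\<close>

definition pairing :: "nat \<Rightarrow> (nat \<Rightarrow> int) \<Rightarrow> (nat \<Rightarrow> int) \<Rightarrow> int" where
  "pairing n v r = (\<Sum>k=1..n. v k * r k)"

definition reflection :: "nat \<Rightarrow> (nat \<Rightarrow> int) \<Rightarrow> (nat \<Rightarrow> int) \<Rightarrow> nat \<Rightarrow> int" where
  "reflection n r v = (\<lambda>k. v k - pairing n v r * r k)"

text \<open>\<open>psi\<close> identifies the root system of type \<open>D\<^sub>n\<close> with the roots of \<open>G\<close> with respect to \<open>T\<close>.\<close>

definition type_D ::
  "nat \<Rightarrow> ('a::field^'m^'m) set \<Rightarrow> ('a^'m^'m) set \<Rightarrow> ((nat \<Rightarrow> int) \<Rightarrow> 'a^'m^'m \<Rightarrow> 'a) \<Rightarrow> bool" where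
  "type_D n G T psi \<longleftrightarrow>
     psi \<in> hom (D_lattice n) (char_group T) \<and> inj_on psi (carrier (D_lattice n)) \<and>
     psi ` D_roots n = roots G T"

definition coroots ::
  "nat \<Rightarrow> ('a::field^'m^'m) set \<Rightarrow> ((nat \<Rightarrow> int) \<Rightarrow> 'a^'m^'m \<Rightarrow> 'a) \<Rightarrow>
   ((nat \<Rightarrow> int) \<Rightarrow> 'a \<Rightarrow> 'a^'m^'m) \<Rightarrow> bool" where
  "coroots n T psi cr \<longleftrightarrow> (\<forall>r\<in>D_roots n. cocharacter T (cr r) \<and>
     (\<forall>v\<in>carrier (D_lattice n). \<forall>x. x \<noteq> 0 \<longrightarrow> psi v (cr r x) = x powi pairing n v r))"

definition fundamental_coweights ::
  "nat \<Rightarrow> ('a::field^'m^'m) set \<Rightarrow> ((nat \<Rightarrow> int) \<Rightarrow> 'a^'m^'m \<Rightarrow> 'a) \<Rightarrow>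
   (nat \<Rightarrow> 'a \<Rightarrow> 'a^'m^'m) \<Rightarrow> bool" where
  "fundamental_coweights n T psi om \<longleftrightarrow> (\<forall>i\<in>{1..n}. cocharacter T (om i) \<and>
     (\<forall>j\<in>{1..n}. \<forall>x. x \<noteq> 0 \<longrightarrow> psi (D_simple n j) (om i x) = (if i = j then x else 1)))"

section \<open>Weyl group and realization\<close>

definition torus_normalizer :: "('a::field^'m^'m) set \<Rightarrow> ('a^'m^'m) set \<Rightarrow> ('a^'m^'m) monoid" where
  "torus_normalizer G T = gp (normalizer (gp G) T)"

definition weyl :: "('a::field^'m^'m) set \<Rightarrow> ('a^'m^'m) set \<Rightarrow> ('a^'m^'m) set monoid" where
  "weyl G T = torus_normalizer G T Mod T"

definition weyl_proj ::
  "('a::field^'m^'m) set \<Rightarrow> ('a^'m^'m) set \<Rightarrow> 'a^'m^'m \<Rightarrow> ('a^'m^'m) set" where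
  "weyl_proj G T g = T #>\<^bsub>torus_normalizer G T\<^esub> g"

definition sigma :: "((nat \<Rightarrow> int) \<Rightarrow> 'a::field \<Rightarrow> 'a^'m^'m) \<Rightarrow> (nat \<Rightarrow> int) \<Rightarrow> 'a^'m^'m" where
  "sigma u r = u r 1 ** u (\<lambda>k. - r k) (-1) ** u r 1"

text \<open>That \<open>\<sigma>\<^sub>r\<close> maps to the reflection \<open>s\<^sub>r\<close> is expressed by the action on the characters of \<open>T\<close>.\<close>

definition realization ::
  "nat \<Rightarrow> ('a::field^'m^'m) set \<Rightarrow> ('a^'m^'m) set \<Rightarrow> ((nat \<Rightarrow> int) \<Rightarrow> 'a^'m^'m \<Rightarrow> 'a) \<Rightarrow>
   ((nat \<Rightarrow> int) \<Rightarrow> 'a \<Rightarrow> 'a^'m^'m) \<Rightarrow> ((nat \<Rightarrow> int) \<Rightarrow> 'a \<Rightarrow> 'a^'m^'m) \<Rightarrow> bool" where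
  "realization n G T psi cr u \<longleftrightarrow> (\<forall>r\<in>D_roots n.
     root_hom G T (psi r) (u r) \<and> is_root_subgroup G T (psi r) (range (u r)) \<and>
     sigma u r \<in> carrier (torus_normalizer G T) \<and>
     (\<forall>v\<in>carrier (D_lattice n). \<forall>t\<in>T.
        psi v (inv\<^bsub>GL\<^esub> (sigma u r) ** t ** sigma u r) = psi (reflection n r v) t) \<and>
     (\<forall>x. x \<noteq> 0 \<longrightarrow>
        u r x ** u (\<lambda>k. - r k) (- inverse x) ** u r x = cr r x ** sigma u r))"

text \<open>\<open>N/T\<close> is the Weyl group of the root system, that is, it is generated by the reflections.  This
  holds for every connected reductive group; it is what makes reduced expressions in \<open>N/T\<close>
  meaningful.\<close>

definition generated_by_reflections ::
  "nat \<Rightarrow> ('a::field^'m^'m) set \<Rightarrow> ('a^'m^'m) set \<Rightarrow>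
   ((nat \<Rightarrow> int) \<Rightarrow> 'a \<Rightarrow> 'a^'m^'m) \<Rightarrow> bool" where
  "generated_by_reflections n G T u \<longleftrightarrow>
     carrier (weyl G T) = generate (weyl G T) ((\<lambda>r. weyl_proj G T (sigma u r)) ` D_roots n)"

section \<open>Sections\<close>

definition simple_refl ::
  "nat \<Rightarrow> ('a::field^'m^'m) set \<Rightarrow> ('a^'m^'m) set \<Rightarrow> ((nat \<Rightarrow> int) \<Rightarrow> 'a \<Rightarrow> 'a^'m^'m) \<Rightarrow>
   nat \<Rightarrow> ('a^'m^'m) set" where
  "simple_refl n G T u i = weyl_proj G T (sigma u (D_simple n i))"

definition weyl_word ::
  "nat \<Rightarrow> ('a::field^'m^'m) set \<Rightarrow> ('a^'m^'m) set \<Rightarrow> ((nat \<Rightarrow> int) \<Rightarrow> 'a \<Rightarrow> 'a^'m^'m) \<Rightarrow>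
   nat list \<Rightarrow> ('a^'m^'m) set" where
  "weyl_word n G T u is =
     foldr (\<lambda>i w. simple_refl n G T u i \<otimes>\<^bsub>weyl G T\<^esub> w) is \<one>\<^bsub>weyl G T\<^esub>"

definition reduced ::
  "nat \<Rightarrow> ('a::field^'m^'m) set \<Rightarrow> ('a^'m^'m) set \<Rightarrow> ((nat \<Rightarrow> int) \<Rightarrow> 'a \<Rightarrow> 'a^'m^'m) \<Rightarrow>
   nat list \<Rightarrow> bool" where
  "reduced n G T u is \<longleftrightarrow> set is \<subseteq> {1..n} \<and>
     (\<forall>js. set js \<subseteq> {1..n} \<and> weyl_word n G T u js = weyl_word n G T u is \<longrightarrow> length is \<le> length js)"

text \<open>A set-theoretic section of \<open>N \<rightarrow> N/T\<close> that is multiplicative along reduced expressions.  Only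
  its values on the Weyl group matter.\<close>

definition is_section ::
  "nat \<Rightarrow> ('a::field^'m^'m) set \<Rightarrow> ('a^'m^'m) set \<Rightarrow> ((nat \<Rightarrow> int) \<Rightarrow> 'a \<Rightarrow> 'a^'m^'m) \<Rightarrow>
   (('a^'m^'m) set \<Rightarrow> 'a^'m^'m) \<Rightarrow> bool" where
  "is_section n G T u S \<longleftrightarrow>
     S \<in> carrier (weyl G T) \<rightarrow> carrier (torus_normalizer G T) \<and>
     (\<forall>w\<in>carrier (weyl G T). weyl_proj G T (S w) = w) \<and>
     (\<forall>is. reduced n G T u is \<longrightarrow>
        S (weyl_word n G T u is) = foldr (\<lambda>i g. S (simple_refl n G T u i) ** g) is (mat 1))"

definition is_tits_section ::
  "nat \<Rightarrow> ('a::field^'m^'m) set \<Rightarrow> ('a^'m^'m) set \<Rightarrow> ((nat \<Rightarrow> int) \<Rightarrow> 'a \<Rightarrow> 'a^'m^'m) \<Rightarrow>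
   (('a^'m^'m) set \<Rightarrow> 'a^'m^'m) \<Rightarrow> bool" where
  "is_tits_section n G T u S \<longleftrightarrow> is_section n G T u S \<and>
     (\<forall>i\<in>{1..n}. S (simple_refl n G T u i) = sigma u (D_simple n i))"

definition homomorphic ::
  "('a::field^'m^'m) set \<Rightarrow> ('a^'m^'m) set \<Rightarrow> (('a^'m^'m) set \<Rightarrow> 'a^'m^'m) \<Rightarrow> bool" where
  "homomorphic G T S \<longleftrightarrow> S \<in> hom (weyl G T) (torus_normalizer G T)"

definition T_conjugate ::
  "('a::field^'m^'m) set \<Rightarrow> ('a^'m^'m) set \<Rightarrow> (('a^'m^'m) set \<Rightarrow> 'a^'m^'m) \<Rightarrow>
   (('a^'m^'m) set \<Rightarrow> 'a^'m^'m) \<Rightarrow> bool" where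
  "T_conjugate G T S S' \<longleftrightarrow> (\<exists>t\<in>T. \<forall>w\<in>carrier (weyl G T). t ** S w ** inv\<^bsub>GL\<^esub> t = S' w)"

text \<open>\<^const>\<open>group.ord\<close> is \<open>0\<close> on elements of infinite order.\<close>

definition elt_order :: "'a::field^'m^'m \<Rightarrow> enat" where
  "elt_order g = (if group.ord GL g = 0 then \<infinity> else enat (group.ord GL g))"

definition profile ::
  "nat \<Rightarrow> ('a::field^'m^'m) set \<Rightarrow> ('a^'m^'m) set \<Rightarrow> ((nat \<Rightarrow> int) \<Rightarrow> 'a \<Rightarrow> 'a^'m^'m) \<Rightarrow>
   (('a^'m^'m) set \<Rightarrow> 'a^'m^'m) \<Rightarrow> nat \<Rightarrow> enat" where
  "profile n G T u S = (\<lambda>i\<in>{1..n}. elt_order (S (simple_refl n G T u i)))"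

definition profiles ::
  "nat \<Rightarrow> ('a::field^'m^'m) set \<Rightarrow> ('a^'m^'m) set \<Rightarrow> ((nat \<Rightarrow> int) \<Rightarrow> 'a \<Rightarrow> 'a^'m^'m) \<Rightarrow>
   (nat \<Rightarrow> enat) set" where
  "profiles n G T u = {profile n G T u S |S. is_section n G T u S}"

text \<open>Larger profiles have smaller orders.\<close>

definition profile_less :: "nat \<Rightarrow> (nat \<Rightarrow> enat) \<Rightarrow> (nat \<Rightarrow> enat) \<Rightarrow> bool" where
  "profile_less n p q \<longleftrightarrow> (\<forall>i\<in>{1..n}. p i > q i)"

definition optimal ::
  "nat \<Rightarrow> ('a::field^'m^'m) set \<Rightarrow> ('a^'m^'m) set \<Rightarrow> ((nat \<Rightarrow> int) \<Rightarrow> 'a \<Rightarrow> 'a^'m^'m) \<Rightarrow>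
   (('a^'m^'m) set \<Rightarrow> 'a^'m^'m) \<Rightarrow> bool" where
  "optimal n G T u S \<longleftrightarrow> is_section n G T u S \<and>
     {p \<in> profiles n G T u. \<not> (\<exists>q\<in>profiles n G T u. profile_less n p q)} = {profile n G T u S}"

section \<open>The parametrization of sections\<close>

text \<open>The element \<open>(x\<^sub>1, \<dots>, x\<^sub>n) = \<omega>\<^sub>1(x\<^sub>1) \<dots> \<omega>\<^sub>n(x\<^sub>n)\<close> of the torus.\<close>

definition coords :: "nat \<Rightarrow> (nat \<Rightarrow> 'a::field \<Rightarrow> 'a^'m^'m) \<Rightarrow> (nat \<Rightarrow> 'a) \<Rightarrow> 'a^'m^'m" where
  "coords n om x = foldr (\<lambda>i g. om i (x i) ** g) [1..<Suc n] (mat 1)"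

text \<open>\<open>t_coord n a i j\<close> is the coordinate of \<open>t\<^sub>i\<close> in position \<open>j\<close>.\<close>

definition t_coord :: "nat \<Rightarrow> (nat \<Rightarrow> nat \<Rightarrow> 'a::field) \<Rightarrow> nat \<Rightarrow> nat \<Rightarrow> 'a" where
  "t_coord n a i =
    (if i = 1 then (\<lambda>j. 1)(1 := a 1 1, 2 := a 1 2)
     else if i \<le> n - 3 then
       (\<lambda>j. 1)(i - 1 := inverse (a i i) * inverse (a i (i + 1)), i := a i i, i + 1 := a i (i + 1))
     else if i = n - 2 then
       (\<lambda>j. 1)(n - 3 := inverse (a (n - 2) (n - 2)) * inverse (a (n - 2) (n - 1)),
         n - 2 := a (n - 2) (n - 2), n - 1 := a (n - 2) (n - 1), n := a (n - 2) (n - 1))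
     else if i = n - 1 then
       (\<lambda>j. 1)(n - 2 := a (n - 1) (n - 2), n - 1 := a (n - 1) (n - 1),
         n := a (n - 2) (n - 2) * a (n - 2) (n - 1) ^ 2)
     else
       (\<lambda>j. 1)(n - 2 := a n (n - 2), n - 1 := a (n - 2) (n - 2) * a (n - 2) (n - 1) ^ 2,
         n := a n n))"

definition admissible :: "nat \<Rightarrow> (nat \<Rightarrow> nat \<Rightarrow> 'a::field) \<Rightarrow> bool" where
  "admissible n a \<longleftrightarrow>
     (\<forall>i\<in>{1..n}. \<forall>j\<in>{1..n}. a i j \<noteq> 0) \<and>
     (\<forall>i\<in>{1..n-2}. a i i * a i (i + 1) ^ 2 = a 1 1 * a 1 2 ^ 2) \<and>
     inverse (a (n - 1) (n - 1)) * inverse (a (n - 1) (n - 2)) ^ 2 = a 1 1 * a 1 2 ^ 2 \<and>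
     inverse (a n n) * inverse (a n (n - 2)) ^ 2 = a 1 1 * a 1 2 ^ 2 \<and>
     (a (n - 2) (n - 2) * a (n - 2) (n - 1) ^ 2) ^ 2 = 1"

definition section_with ::
  "nat \<Rightarrow> ('a::field^'m^'m) set \<Rightarrow> ('a^'m^'m) set \<Rightarrow> ((nat \<Rightarrow> int) \<Rightarrow> 'a \<Rightarrow> 'a^'m^'m) \<Rightarrow>
   (nat \<Rightarrow> 'a \<Rightarrow> 'a^'m^'m) \<Rightarrow> (nat \<Rightarrow> nat \<Rightarrow> 'a) \<Rightarrow> (('a^'m^'m) set \<Rightarrow> 'a^'m^'m) \<Rightarrow> bool" where
  "section_with n G T u om a S \<longleftrightarrow> is_section n G T u S \<and> admissible n a \<and>
     (\<forall>i\<in>{1..n}. S (simple_refl n G T u i) =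
        coords n om (t_coord n a i) ** sigma u (D_simple n i))"

end

theory Submission
  imports Defs "HOL-Algebra.Zassenhaus"
begin

text \<open>Everything rests on three facts about the representatives \<open>\<sigma>\<^sub>r\<close>.  First, conjugation by an element
  of \<open>N\<close> that maps the root \<open>r\<close> to \<open>r'\<close> carries \<open>\<sigma>\<^sub>r\<close> into \<open>T \<sigma>\<^sub>r\<^sub>'\<close>; hence \<open>N/T\<close> satisfies the exchange
  condition with respect to the action on the roots, and Matsumoto's theorem reduces sections to
  lifts of the simple reflections that satisfy the braid relations.  Secondly, the \<open>\<sigma>\<^sub>i\<close> satisfy these
  relations: for adjacent nodes by the first fact up to a factor in \<open>T\<close>, which a third node of the
  diagram shows to be trivial as \<open>G\<close> is adjoint; for orthogonal nodes because \<open>\<sigma>\<^sub>b\<close> fixes the root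
  vector of \<open>a\<close> in the Lie algebra.  Thirdly, \<open>T\<close> is identified with \<open>n\<close>-tuples by the simple roots,
  so that for \<open>t\<^sub>i = (x\<^sub>i\<^sub>1, \<dots>, x\<^sub>i\<^sub>n)\<close> the braid relations become equations between the \<open>x\<^sub>i\<^sub>j\<close>.

  These equations imply that \<open>x\<^sub>i\<^sub>i x\<^sub>i\<^sub>j\<^sup>2\<close> is the same sign \<open>\<epsilon>\<close> for all adjacent \<open>i\<close>, \<open>j\<close>, that
  \<open>(t\<^sub>i \<sigma>\<^sub>i)\<^sup>2 = \<alpha>\<^sub>i\<^sup>\<vee>(-\<epsilon>)\<close>, and that two solutions with the same \<open>\<epsilon>\<close> differ by a coboundary.  So the
  orders are all \<open>2\<close> for \<open>\<epsilon> = -1\<close> and all \<open>4\<close> for \<open>\<epsilon> = 1\<close>, the case of the Tits section.\<close>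

section \<open>Groups generated by reflections\<close>

text \<open>A root subgroup is known here only through its uniqueness and the action of
  \<open>T\<close> on it, so the group theory rests on rigidity. A parameter change equivariant
  under a root that takes all nonzero values is linear, and a family that is polynomial in a
  parameter over an infinite field is settled by comparing coefficients. This determines conjugates
  of root subgroups up to scalars, and with them conjugates of the representatives up to elements of
  \<open>T\<close>. Showing that these ambiguities vanish is the real work: they are tested on
  further simple roots, or on tangent vectors when the two roots are orthogonal.

  In the equations for the coordinates the two ends of the fork are exceptional. They have the same
  single neighbour, so commutation leaves a sign undetermined there, and this sign turns out to be
  the invariant itself.

  The hypothesis \<open>(2::'a) \<noteq> 0\<close> keeps the two signs apart: in characteristic 2
  the value of a coroot at -1 is trivial, and so are the squares of the Tits lifts.\<close>

locale reflection_system = group W for W :: "'w monoid" (structure) +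
  fixes I :: "'i set" and Phi :: "'r set" and pos :: "'r \<Rightarrow> bool" and neg :: "'r \<Rightarrow> 'r"
    and simple :: "'i \<Rightarrow> 'r" and rho :: "'i \<Rightarrow> 'r \<Rightarrow> 'r" and refl :: "'r \<Rightarrow> 'w" and s :: "'i \<Rightarrow> 'w"
  assumes refl_closed: "r \<in> Phi \<Longrightarrow> refl r \<in> carrier W"
    and refl_simple: "i \<in> I \<Longrightarrow> refl (simple i) = s i"
    and simple_root: "i \<in> I \<Longrightarrow> simple i \<in> Phi"
    and simple_pos: "i \<in> I \<Longrightarrow> pos (simple i)"
    and simple_inj: "inj_on simple I"
    and neg_pos: "r \<in> Phi \<Longrightarrow> pos (neg r) \<longleftrightarrow> \<not> pos r"
    and rho_closed: "i \<in> I \<Longrightarrow> r \<in> Phi \<Longrightarrow> rho i r \<in> Phi"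
    and rho_rho: "i \<in> I \<Longrightarrow> r \<in> Phi \<Longrightarrow> rho i (rho i r) = r"
    and rho_neg: "i \<in> I \<Longrightarrow> r \<in> Phi \<Longrightarrow> rho i (neg r) = neg (rho i r)"
    and rho_simple: "i \<in> I \<Longrightarrow> rho i (simple i) = neg (simple i)"
    and rho_pos: "i \<in> I \<Longrightarrow> r \<in> Phi \<Longrightarrow> pos r \<Longrightarrow> r \<noteq> simple i \<Longrightarrow> pos (rho i r)"
    and s_square: "i \<in> I \<Longrightarrow> s i \<otimes> s i = \<one>"
    and refl_rho: "i \<in> I \<Longrightarrow> r \<in> Phi \<Longrightarrow> refl (rho i r) = s i \<otimes> refl r \<otimes> s i"
    and foldr_rho_cong: "set is \<subseteq> I \<Longrightarrow> set js \<subseteq> I \<Longrightarrow>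
      foldr (\<lambda>i w. s i \<otimes> w) is \<one> = foldr (\<lambda>i w. s i \<otimes> w) js \<one> \<Longrightarrow> r \<in> Phi \<Longrightarrow>
      foldr rho is r = foldr rho js r"
begin

definition word :: "'i list \<Rightarrow> 'w" where
  "word is = foldr (\<lambda>i w. s i \<otimes> w) is \<one>"

definition red :: "'i list \<Rightarrow> bool" where
  "red is \<longleftrightarrow> set is \<subseteq> I \<and>
     (\<forall>js. set js \<subseteq> I \<and> word js = word is \<longrightarrow> length is \<le> length js)"

lemma s_closed [simp]: "i \<in> I \<Longrightarrow> s i \<in> carrier W"
  using refl_closed refl_simple simple_root by metis

lemma word_Nil [simp]: "word [] = \<one>"
  by (simp add: word_def)

lemma word_Cons [simp]: "word (i # is) = s i \<otimes> word is"
  by (simp add: word_def)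

lemma word_closed [simp]: "set is \<subseteq> I \<Longrightarrow> word is \<in> carrier W"
  by (induction "is") auto

lemma s_s_cancel: "i \<in> I \<Longrightarrow> w \<in> carrier W \<Longrightarrow> s i \<otimes> (s i \<otimes> w) = w"
  by (metis l_one m_assoc s_closed s_square)

lemma s_cancel_left:
  assumes "i \<in> I" "v \<in> carrier W" "w \<in> carrier W" "s i \<otimes> v = w"
  shows "v = s i \<otimes> w"
  using assms s_s_cancel by metis

lemma foldr_rho_closed: "set is \<subseteq> I \<Longrightarrow> r \<in> Phi \<Longrightarrow> foldr rho is r \<in> Phi"
  by (induction "is") (auto intro: rho_closed)

lemma fold_rho_closed: "set is \<subseteq> I \<Longrightarrow> r \<in> Phi \<Longrightarrow> fold rho is r \<in> Phi"
  by (induction "is" arbitrary: r) (auto intro: rho_closed)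

lemma fold_foldr_rho: "set is \<subseteq> I \<Longrightarrow> r \<in> Phi \<Longrightarrow> fold rho is (foldr rho is r) = r"
  by (induction "is") (auto simp: rho_rho foldr_rho_closed)

lemma foldr_fold_rho: "set is \<subseteq> I \<Longrightarrow> r \<in> Phi \<Longrightarrow> foldr rho is (fold rho is r) = r"
  by (induction "is" arbitrary: r) (auto simp: rho_rho rho_closed)

lemma fold_rho_neg: "set is \<subseteq> I \<Longrightarrow> r \<in> Phi \<Longrightarrow> fold rho is (neg r) = neg (fold rho is r)"
  by (induction "is" arbitrary: r) (auto simp: rho_neg rho_closed)

text \<open>\<open>foldr rho is\<close> is the action of the element \<open>word is\<close>, and
  \<open>fold rho is\<close> that of its inverse, which decides whether a left factor shortens the
  word. The locale assumes of the former that it depends on the element alone; the latter inherits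
  this because the two are mutually inverse.\<close>

lemma fold_rho_cong:
  assumes "set is \<subseteq> I" "set js \<subseteq> I" "word is = word js" "r \<in> Phi"
  shows "fold rho is r = fold rho js r"
proof -
  have "fold rho js r = fold rho js (foldr rho is (fold rho is r))"
    by (simp add: assms foldr_fold_rho)
  also have "\<dots> = fold rho js (foldr rho js (fold rho is r))"
    using foldr_rho_cong[of "is" js "fold rho is r"] assms fold_rho_closed
    by (simp add: word_def)
  also have "\<dots> = fold rho is r"
    by (simp add: assms fold_foldr_rho fold_rho_closed)
  finally show ?thesis by simp
qed

text \<open>Let \<open>v\<close> be the part of the word before the letter at which the image of
  \<open>r\<close> first turns negative. Just before that letter the image is positive, so by
  \<open>rho_pos\<close> it is the simple root of the letter. Hence \<open>refl r\<close> is the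
  conjugate of the letter by \<open>v\<close>, and multiplying by it deletes the letter.\<close>

lemma exchange_root:
  assumes "set is \<subseteq> I" "r \<in> Phi" "pos r" "\<not> pos (fold rho is r)"
  shows "\<exists>p<length is. refl r \<otimes> word is = word (take p is @ drop (Suc p) is)"
  using assms
proof (induction "is" arbitrary: r)
  case (Cons i "is")
  then have i: "i \<in> I" and is_sub: "set is \<subseteq> I" by auto
  show ?case
  proof (cases "pos (rho i r)")
    case True
    then obtain p where p: "p < length is"
      "refl (rho i r) \<otimes> word is = word (take p is @ drop (Suc p) is)"
      using Cons.IH[of "rho i r"] Cons.prems is_sub i rho_closed by auto
    have "refl r \<otimes> word (i # is) = s i \<otimes> (refl (rho i r) \<otimes> word is)"
      using i is_sub Cons.prems
      by (simp add: refl_rho m_assoc refl_closed s_s_cancel)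
    with p show ?thesis
      by (intro exI[of _ "Suc p"]) simp
  next
    case False
    then have "r = simple i" using rho_pos i Cons.prems by blast
    then show ?thesis
      using i is_sub by (intro exI[of _ 0]) (simp add: refl_simple s_s_cancel)
  qed
qed simp

text \<open>It suffices that the inverse of \<open>word is\<close> makes \<open>simple i\<close>
  negative. If not, a word \<open>js\<close> for \<open>s i \<otimes> word is\<close> that is no
  longer than \<open>is\<close> makes it negative, and \<open>exchange_root\<close> deletes a letter
  of \<open>js\<close>, leaving a word for \<open>word is\<close> shorter than
  \<open>is\<close>.\<close>

lemma exchange:
  assumes "red is" "i \<in> I" "\<not> red (i # is)"
  shows "\<exists>p<length is. s i \<otimes> word is = word (take p is @ drop (Suc p) is)"
proof -
  have is_sub: "set is \<subseteq> I" using assms by (simp add: red_def)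
  have root: "simple i \<in> Phi" "pos (simple i)" using assms simple_root simple_pos by auto
  have "\<not> pos (fold rho is (simple i))"
  proof
    assume up: "pos (fold rho is (simple i))"
    from assms is_sub obtain js where js: "set js \<subseteq> I" "word js = word (i # is)"
      "length js \<le> length is"
      unfolding red_def by fastforce
    have "fold rho js (simple i) = fold rho (i # is) (simple i)"
      using fold_rho_cong[of js "i # is"] js assms is_sub root by auto
    also have "\<dots> = neg (fold rho is (simple i))"
      using assms is_sub root by (simp add: rho_simple fold_rho_neg)
    finally have "\<not> pos (fold rho js (simple i))"
      using up neg_pos fold_rho_closed is_sub root by metis
    then obtain p where p: "p < length js"
      "refl (simple i) \<otimes> word js = word (take p js @ drop (Suc p) js)"
      using exchange_root js root by blast
    let ?ks = "take p js @ drop (Suc p) js"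
    have "word ?ks = word is"
      using p js assms is_sub by (simp add: refl_simple s_s_cancel)
    moreover have "set ?ks \<subseteq> I"
      using js(1) set_take_subset[of p js] set_drop_subset[of "Suc p" js] by auto
    moreover have "length ?ks < length is" using p js by simp
    ultimately show False using assms(1) unfolding red_def by (metis not_le)
  qed
  then show ?thesis
    using exchange_root[OF is_sub root] assms by (simp add: refl_simple)
qed

lemma red_Nil [simp]: "red []"
  by (simp add: red_def)

lemma red_ConsD: "red (i # is) \<Longrightarrow> red is"
  unfolding red_def
proof (intro conjI allI impI)
  fix js
  assume r: "set (i # is) \<subseteq> I \<and> (\<forall>js. set js \<subseteq> I \<and> word js = word (i # is) \<longrightarrow> length (i # is) \<le> length js)"
    and js: "set js \<subseteq> I \<and> word js = word is"
  then have "length (i # is) \<le> length (i # js)" by (intro r[THEN conjunct2, rule_format]) auto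
  then show "length is \<le> length js" by simp
qed auto

lemma red_cong:
  "red is \<Longrightarrow> set js \<subseteq> I \<Longrightarrow> word js = word is \<Longrightarrow> length js \<le> length is \<Longrightarrow> red js"
  unfolding red_def by (metis le_trans)

lemma red_length: "red is \<Longrightarrow> red js \<Longrightarrow> word is = word js \<Longrightarrow> length is = length js"
  unfolding red_def by (metis le_antisym)

lemma s_neq_one: "i \<in> I \<Longrightarrow> s i \<noteq> \<one>"
  using fold_rho_cong[of "[i]" "[]" "simple i"] simple_root simple_pos neg_pos rho_simple
  by fastforce

lemma s_inj: "i \<in> I \<Longrightarrow> j \<in> I \<Longrightarrow> s i = s j \<Longrightarrow> i = j"
proof (rule ccontr)
  assume ij: "i \<in> I" "j \<in> I" "s i = s j" "i \<noteq> j"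
  then have "rho i (simple i) = rho j (simple i)"
    using fold_rho_cong[of "[i]" "[j]" "simple i"] simple_root by simp
  moreover have "simple i \<noteq> simple j" using ij simple_inj by (metis inj_onD)
  ultimately show False
    using ij rho_pos[of j "simple i"] simple_root simple_pos neg_pos rho_simple by metis
qed

lemma red_single: "i \<in> I \<Longrightarrow> red [i]"
  using s_neq_one[of i] s_neq_one[of i, symmetric] unfolding red_def by (auto simp: Suc_le_eq)

lemma red_pair: "i \<in> I \<Longrightarrow> j \<in> I \<Longrightarrow> i \<noteq> j \<Longrightarrow> red [i, j]"
proof (rule ccontr)
  assume ij: "i \<in> I" "j \<in> I" "i \<noteq> j" "\<not> red [i, j]"
  then have "s i \<otimes> s j = \<one>" using exchange[of "[j]" i] red_single by auto
  then have "s j = s i" using s_cancel_left[of i "s j" \<one>] ij by simp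
  with ij s_inj show False by auto
qed

lemma red_triple:
  assumes "i \<in> I" "j \<in> I" "i \<noteq> j" "s i \<otimes> s j \<noteq> s j \<otimes> s i"
  shows "red [i, j, i]"
proof (rule ccontr)
  assume "\<not> red [i, j, i]"
  then obtain p where p: "p < length [j, i]"
    "s i \<otimes> word [j, i] = word (take p [j, i] @ drop (Suc p) [j, i])"
    using exchange[of "[j, i]" i] red_pair[of j i] assms by blast
  then consider "s i \<otimes> (s j \<otimes> s i) = s i" | "s i \<otimes> (s j \<otimes> s i) = s j"
    using assms by (cases p) auto
  then show False
  proof cases
    case 1
    then have "s j \<otimes> s i = \<one>" using assms by (metis m_closed s_closed s_cancel_left s_square)
    then have "s i = s j" using s_cancel_left[of j "s i" \<one>] assms by simp
    then show False using s_inj assms by auto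
  next
    case 2
    then show False using assms s_cancel_left[of i "s j \<otimes> s i" "s j"] by auto
  qed
qed

lemma word_append:
  "set is \<subseteq> I \<Longrightarrow> set js \<subseteq> I \<Longrightarrow> word (is @ js) = word is \<otimes> word js"
  by (induction "is") (auto simp: m_assoc)

lemma red_exists:
  assumes "set is \<subseteq> I"
  shows "\<exists>js. red js \<and> word js = word is"
proof -
  obtain js where js: "set js \<subseteq> I \<and> word js = word is"
    "\<And>ks. set ks \<subseteq> I \<and> word ks = word is \<Longrightarrow> length js \<le> length ks"
    using ex_has_least_nat[of "\<lambda>js. set js \<subseteq> I \<and> word js = word is" "is" length] assms by blast
  then have "red js" unfolding red_def by simp
  then show ?thesis using js(1) by blast
qed

text \<open>Multiplying by \<open>s j\<close> shortens the element, so \<open>exchange\<close>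
  deletes a letter of \<open>i # is\<close>. Deleting \<open>i\<close> itself would give
  \<open>s i = s j\<close>; hence \<open>i\<close> survives and the new word begins with
  \<open>j\<close>, \<open>i\<close>.\<close>

lemma red_exchange_first:
  assumes "red (i # is)" "red (j # js)" "word (i # is) = word (j # js)" "i \<noteq> j"
  shows "\<exists>ks. red (j # i # ks) \<and> word (j # i # ks) = word (i # is)"
proof -
  have mem: "i \<in> I" "j \<in> I" "set is \<subseteq> I" "set js \<subseteq> I" using assms by (auto simp: red_def)
  have len: "length is = length js" using red_length assms by fastforce
  have eq: "s j \<otimes> word (i # is) = word js"
    using assms mem by (metis s_s_cancel word_Cons word_closed)
  have "\<not> red (j # i # is)"
    using eq len mem unfolding red_def by (auto intro!: exI[of _ js])
  then obtain p where p: "p < length (i # is)"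
    "s j \<otimes> word (i # is) = word (take p (i # is) @ drop (Suc p) (i # is))"
    using exchange assms mem by blast
  show ?thesis
  proof (cases p)
    case 0
    then have "s j \<otimes> (s i \<otimes> word is) = word is" using p by simp
    then have "s i \<otimes> word is = s j \<otimes> word is" using mem s_cancel_left by simp
    then have "s i = s j" using mem by (simp add: right_cancel)
    then show ?thesis using s_inj mem assms by auto
  next
    case (Suc q)
    let ?ks = "take q is @ drop (Suc q) is"
    have ks: "set ?ks \<subseteq> I"
      using mem(3) set_take_subset[of q "is"] set_drop_subset[of "Suc q" "is"] by auto
    have w: "word (j # i # ?ks) = word (i # is)"
      using p Suc ks mem s_cancel_left[of j "word (i # is)" "s i \<otimes> word ?ks"] by simp
    moreover have "length (j # i # ?ks) \<le> length (i # is)" using p Suc by simp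
    moreover have "set (j # i # ?ks) \<subseteq> I" using ks mem by simp
    ultimately show ?thesis using red_cong assms by blast
  qed
qed

section \<open>Braid relations and Matsumoto's theorem\<close>

definition simply_laced :: bool where
  "simply_laced \<longleftrightarrow> (\<forall>i\<in>I. \<forall>j\<in>I. i \<noteq> j \<longrightarrow>
     s i \<otimes> s j = s j \<otimes> s i \<or> s i \<otimes> (s j \<otimes> s i) = s j \<otimes> (s i \<otimes> s j))"

definition braided :: "('b, 'c) monoid_scheme \<Rightarrow> ('i \<Rightarrow> 'b) \<Rightarrow> bool" where
  "braided H f \<longleftrightarrow> (\<forall>i\<in>I. \<forall>j\<in>I. i \<noteq> j \<longrightarrow>
     (s i \<otimes> s j = s j \<otimes> s i \<longrightarrow> f i \<otimes>\<^bsub>H\<^esub> f j = f j \<otimes>\<^bsub>H\<^esub> f i) \<and>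
     (s i \<otimes> s j \<noteq> s j \<otimes> s i \<longrightarrow>
        f i \<otimes>\<^bsub>H\<^esub> (f j \<otimes>\<^bsub>H\<^esub> f i) = f j \<otimes>\<^bsub>H\<^esub> (f i \<otimes>\<^bsub>H\<^esub> f j)))"

text \<open>Induction on the length. For different first letters a chain of reduced words is built
  in which neighbours share their first letter or differ by one relation at the front. As
  \<open>H\<close> is just a monoid, cancellation takes place in \<open>W\<close> only.\<close>

theorem matsumoto:
  fixes H :: "('b, 'c) monoid_scheme" (structure)
  assumes "simply_laced" "monoid H" "f \<in> I \<rightarrow> carrier H" "braided H f"
    and "red is" "red js" "word is = word js"
  shows "foldr (\<lambda>i g. f i \<otimes>\<^bsub>H\<^esub> g) is \<one>\<^bsub>H\<^esub> = foldr (\<lambda>i g. f i \<otimes>\<^bsub>H\<^esub> g) js \<one>\<^bsub>H\<^esub>"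
  using assms(5-7)
proof (induction "length is" arbitrary: "is" js)
  case 0
  then show ?case using red_length[of "is" js] by auto
next
  case (Suc k)
  interpret H: monoid H by fact
  let ?p = "\<lambda>is. foldr (\<lambda>i g. f i \<otimes>\<^bsub>H\<^esub> g) is \<one>\<^bsub>H\<^esub>"
  have pc: "?p ks \<in> carrier H" if "set ks \<subseteq> I" for ks
    using that assms(3) by (induction ks) auto
  have fc: "f i \<in> carrier H" if "i \<in> I" for i using that assms(3) by auto
  have step: "?p (i # us) = ?p (i # vs)"
    if "red (i # us)" "red (i # vs)" "word (i # us) = word (i # vs)" "length (i # us) = Suc k" for i us vs
  proof -
    have "word us = word vs"
      using that by (metis s_s_cancel word_Cons word_closed red_def insert_subset list.set(2))
    then have "?p us = ?p vs" using Suc.hyps(1)[of us vs] that red_ConsD by simp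
    then show ?thesis by simp
  qed
  have len: "length js = Suc k" using red_length Suc.prems Suc.hyps(2) by metis
  then obtain i us j vs where decomp: "is = i # us" "js = j # vs"
    using Suc.hyps(2) by (metis length_Suc_conv)
  show ?case
  proof (cases "i = j")
    case True
    show ?thesis
      unfolding decomp by (subst True, rule step) (use True decomp Suc.prems Suc.hyps(2) in auto)
  next
    case False
    have mem: "i \<in> I" "j \<in> I" using Suc.prems decomp by (auto simp: red_def)
    obtain ks where ks: "red (j # i # ks)" "word (j # i # ks) = word is"
      using red_exchange_first[of i us j vs] Suc.prems decomp False by auto
    have ksl: "length (j # i # ks) = Suc k" using red_length ks Suc.prems(1) Suc.hyps(2) by metis
    have ks_sub: "set ks \<subseteq> I" using ks by (auto simp: red_def)
    have js_eq: "?p js = ?p (j # i # ks)"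
      unfolding decomp(2)
      by (rule step) (use Suc.prems(2,3) decomp(2) ks len in metis)+
    have is_eq: "?p is = ?p (i # ms)" if "red (i # ms)" "word (i # ms) = word is" for ms
      unfolding decomp(1)
      by (rule step) (use Suc.prems(1) Suc.hyps(2) decomp(1) that in metis)+
    show ?thesis
    proof (cases "s i \<otimes>\<^bsub>W\<^esub> s j = s j \<otimes>\<^bsub>W\<^esub> s i")
      case True
      have w: "word (i # j # ks) = word is"
        using True ks mem ks_sub by (metis m_assoc s_closed word_Cons word_closed)
      have "red (i # j # ks)" using red_cong[of "j # i # ks"] ks w mem ks_sub by auto
      then have "?p is = ?p (i # j # ks)" using is_eq w by blast
      also have "\<dots> = ?p (j # i # ks)"
        using assms(4) True False mem fc pc[OF ks_sub] unfolding braided_def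
        by (simp flip: H.m_assoc)
      finally show ?thesis using js_eq by simp
    next
      case nc: False
      then have br: "s i \<otimes>\<^bsub>W\<^esub> (s j \<otimes>\<^bsub>W\<^esub> s i) = s j \<otimes>\<^bsub>W\<^esub> (s i \<otimes>\<^bsub>W\<^esub> s j)"
        using assms(1) mem False unfolding simply_laced_def by blast
      obtain ls where ls: "red (i # j # ls)" "word (i # j # ls) = word is"
        using red_exchange_first[of j "i # ks" i us] Suc.prems decomp False ks by auto
      have ls_sub: "set ls \<subseteq> I" using ls by (auto simp: red_def)
      have w2: "word (j # ls) = s i \<otimes>\<^bsub>W\<^esub> word is"
        using ls mem s_cancel_left[of i "word (j # ls)" "word is"] ls_sub Suc.prems(1)
        by (simp add: red_def)
      \<comment> \<open>\<open>s i\<close> shortens \<open>word is\<close> to length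
        \<open>k\<close>, whereas \<open>i # j # i # ks\<close> has \<open>k + 2\<close>
        letters.\<close>
      have "\<not> red (i # j # i # ks)"
      proof -
        have "word (i # j # i # ks) = word (j # ls)" using ks w2 by simp
        moreover have "length (j # ls) = k" using red_length[OF ls(1) Suc.prems(1)] ls(2) Suc.hyps(2) by simp
        ultimately show ?thesis
          using mem ls_sub ksl unfolding red_def by (auto intro!: exI[of _ "j # ls"])
      qed
      then obtain p where p: "p < length (j # i # ks)"
        "s i \<otimes>\<^bsub>W\<^esub> word (j # i # ks) = word (take p (j # i # ks) @ drop (Suc p) (j # i # ks))"
        using exchange[OF ks(1) mem(1)] by blast
      \<comment> \<open>The deleted letter lies in \<open>ks\<close>: deleting the initial
        \<open>j\<close> leaves a word for \<open>word is\<close> that is too short, and deleting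
        the \<open>i\<close> after it makes \<open>s i\<close> and \<open>s j\<close>
        commute.\<close>
      have p0: "p \<noteq> 0"
      proof
        assume "p = 0"
        then have "s i \<otimes>\<^bsub>W\<^esub> word (j # i # ks) = s i \<otimes>\<^bsub>W\<^esub> word ks" using p by simp
        then have "s i \<otimes>\<^bsub>W\<^esub> word is = s i \<otimes>\<^bsub>W\<^esub> word ks" using ks(2) by metis
        then have "word ks = word is" using mem ks_sub Suc.prems(1) by (simp add: red_def)
        then show False using Suc.prems(1) ks_sub ksl Suc.hyps(2) unfolding red_def by fastforce
      qed
      have p1: "p \<noteq> 1"
      proof
        assume "p = 1"
        then have "s i \<otimes>\<^bsub>W\<^esub> (s j \<otimes>\<^bsub>W\<^esub> (s i \<otimes>\<^bsub>W\<^esub> word ks)) = s j \<otimes>\<^bsub>W\<^esub> word ks" using p by simp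
        then have "(s i \<otimes>\<^bsub>W\<^esub> (s j \<otimes>\<^bsub>W\<^esub> s i)) \<otimes>\<^bsub>W\<^esub> word ks = s j \<otimes>\<^bsub>W\<^esub> word ks"
          using mem ks_sub by (simp add: m_assoc)
        then have "s i \<otimes>\<^bsub>W\<^esub> (s j \<otimes>\<^bsub>W\<^esub> s i) = s j" using mem ks_sub by (simp add: right_cancel)
        then show False using nc mem s_cancel_left[of i "s j \<otimes>\<^bsub>W\<^esub> s i" "s j"] by simp
      qed
      then obtain q where q: "p = Suc (Suc q)" using p0 by (metis One_nat_def not0_implies_Suc)
      let ?ms = "take q ks @ drop (Suc q) ks"
      have ms: "set ?ms \<subseteq> I"
        using ks_sub set_take_subset[of q ks] set_drop_subset[of "Suc q" ks] by auto
      have msl: "length (i # j # i # ?ms) = Suc k" using p q ksl by simp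
      have ms_w: "word (i # j # i # ?ms) = word is"
      proof -
        have "s i \<otimes>\<^bsub>W\<^esub> word is = word (j # i # ?ms)" using p(2) q ks by simp
        then show ?thesis
          using s_cancel_left[of i "word is" "word (j # i # ?ms)"] mem ms Suc.prems(1)
          by (simp add: red_def)
      qed
      have ms_w': "word (j # i # j # ?ms) = word is"
      proof -
        have "word (j # i # j # ?ms) = (s j \<otimes>\<^bsub>W\<^esub> (s i \<otimes>\<^bsub>W\<^esub> s j)) \<otimes>\<^bsub>W\<^esub> word ?ms"
          using mem ms by (simp add: m_assoc)
        also have "\<dots> = word (i # j # i # ?ms)"
          unfolding br[symmetric] using mem ms by (simp add: m_assoc)
        finally show ?thesis using ms_w by simp
      qed
      have r1: "red (i # j # i # ?ms)" and r2: "red (j # i # j # ?ms)"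
        using red_cong[OF Suc.prems(1)] ms_w ms_w' msl mem ms Suc.hyps(2) by auto
      have "?p is = ?p (i # j # i # ?ms)"
        using is_eq[OF r1 ms_w] .
      also have "\<dots> = ?p (j # i # j # ?ms)"
      proof -
        have "f i \<otimes>\<^bsub>H\<^esub> (f j \<otimes>\<^bsub>H\<^esub> f i) \<otimes>\<^bsub>H\<^esub> ?p ?ms = f j \<otimes>\<^bsub>H\<^esub> (f i \<otimes>\<^bsub>H\<^esub> f j) \<otimes>\<^bsub>H\<^esub> ?p ?ms"
          using assms(4) nc False mem unfolding braided_def by simp
        then show ?thesis using mem fc pc[OF ms] by (simp add: H.m_assoc)
      qed
      also have "\<dots> = ?p js"
        unfolding decomp(2)
        by (rule step) (use Suc.prems(2,3) decomp(2) r2 ms_w' msl in auto)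
      finally show ?thesis .
    qed
  qed
qed

text \<open>Multiplicativity along reduced words only misses the case where \<open>s i\<close>
  shortens \<open>w\<close>. There \<open>w\<close> has a reduced word starting with
  \<open>i\<close>, so \<open>S w\<close> has the factor \<open>f i\<close> in front, and
  \<open>square\<close> cancels it.\<close>

theorem involutive_lift_hom:
  fixes H :: "('b, 'c) monoid_scheme" (structure)
  assumes "monoid H" "f \<in> I \<rightarrow> carrier H" and generated: "carrier W = word ` {is. set is \<subseteq> I}"
    and square: "\<And>i. i \<in> I \<Longrightarrow> f i \<otimes>\<^bsub>H\<^esub> f i = \<one>\<^bsub>H\<^esub>"
    and S: "\<And>is. red is \<Longrightarrow> S (word is) = foldr (\<lambda>i g. f i \<otimes>\<^bsub>H\<^esub> g) is \<one>\<^bsub>H\<^esub>"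
  shows "S \<in> hom W H"
proof -
  interpret H: monoid H by fact
  let ?p = "\<lambda>is. foldr (\<lambda>i g. f i \<otimes>\<^bsub>H\<^esub> g) is \<one>\<^bsub>H\<^esub>"
  have pc: "?p ks \<in> carrier H" if "set ks \<subseteq> I" for ks
    using that assms(2) by (induction ks) auto
  have fc: "f i \<in> carrier H" if "i \<in> I" for i using that assms(2) by auto
  have ff: "f i \<otimes>\<^bsub>H\<^esub> (f i \<otimes>\<^bsub>H\<^esub> g) = g" if "i \<in> I" "g \<in> carrier H" for i g
    using that square fc by (metis H.l_one H.m_assoc)
  have rep: "\<exists>is. red is \<and> w = word is" if "w \<in> carrier W" for w
    using that generated red_exists by (metis (mono_tags, lifting) imageE mem_Collect_eq)
  have step: "S (s i \<otimes>\<^bsub>W\<^esub> w) = f i \<otimes>\<^bsub>H\<^esub> S w" if i: "i \<in> I" and w: "w \<in> carrier W" for i w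
  proof -
    obtain "is" where is_red: "red is" "w = word is" using rep w by blast
    show ?thesis
    proof (cases "red (i # is)")
      case True
      then show ?thesis using S[of "i # is"] S[of "is"] is_red by simp
    next
      case False
      then obtain p where p: "p < length is" "s i \<otimes>\<^bsub>W\<^esub> word is = word (take p is @ drop (Suc p) is)"
        using exchange is_red i by blast
      let ?ks = "take p is @ drop (Suc p) is"
      have ks: "set ?ks \<subseteq> I"
        using is_red set_take_subset[of p "is"] set_drop_subset[of "Suc p" "is"]
        by (auto simp: red_def)
      have w': "word (i # ?ks) = word is"
        using p ks i is_red s_cancel_left[of i "word is" "word ?ks"] by (simp add: red_def)
      have r: "red (i # ?ks)"
        using red_cong[OF is_red(1) _ w'] p ks i by simp
      have "S w = f i \<otimes>\<^bsub>H\<^esub> S (word ?ks)"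
        using S[OF r] S[OF red_ConsD[OF r]] w' is_red by simp
      moreover have "S (word ?ks) \<in> carrier H" using S[OF red_ConsD[OF r]] pc[OF ks] by metis
      ultimately show ?thesis using ff i p is_red by simp
    qed
  qed
  have Sc: "S w \<in> carrier H" if "w \<in> carrier W" for w
    using rep[OF that] S pc by (auto simp: red_def)
  have "S (word is \<otimes>\<^bsub>W\<^esub> w) = S (word is) \<otimes>\<^bsub>H\<^esub> S w" if "set is \<subseteq> I" "w \<in> carrier W" for "is" w
    using that(1)
  proof (induction "is")
    case Nil
    then show ?case using S[of "[]"] that Sc by simp
  next
    case (Cons i "is")
    then show ?case using that Sc step fc by (simp add: m_assoc H.m_assoc)
  qed
  then show ?thesis using Sc generated by (auto simp: hom_def)
qed

end

section \<open>The root system of type \<open>D\<^sub>n\<close>\<close>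

lemma pairing_commute: "pairing n v w = pairing n w v"
  by (simp add: pairing_def mult.commute)

lemma pairing_add: "pairing n (\<lambda>k. v k + w k) z = pairing n v z + pairing n w z"
  by (simp add: pairing_def distrib_right sum.distrib)

lemma pairing_diff: "pairing n (\<lambda>k. v k - w k) z = pairing n v z - pairing n w z"
  by (simp add: pairing_def left_diff_distrib sum_subtractf)

lemma pairing_scale: "pairing n (\<lambda>k. c * v k) z = c * pairing n v z"
  by (simp add: pairing_def sum_distrib_left mult.assoc)

lemma pairing_neg: "pairing n (\<lambda>k. - v k) z = - pairing n v z"
  by (simp add: pairing_def sum_negf)

lemma pairing_reflection_left:
  "pairing n (reflection n r v) w = pairing n v w - pairing n v r * pairing n r w"
  by (simp add: reflection_def pairing_diff pairing_scale)

lemma D_rootsE: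
  assumes "r \<in> D_roots n"
  obtains i j a b where "1 \<le> i" "i < j" "j \<le> n" "a = 1 \<or> a = -1" "b = 1 \<or> b = -1"
    "r = (\<lambda>k. if k = i then a else if k = j then b else 0)"
  using assms unfolding D_roots_def by blast

lemma pairing_two_terms:
  assumes "1 \<le> i" "i < j" "j \<le> n"
  shows "pairing n (\<lambda>k. if k = i then a else if k = j then b else 0) w = a * w i + b * w j"
proof -
  have "pairing n (\<lambda>k. if k = i then a else if k = j then b else 0) w =
      (\<Sum>k=1..n. (if k = i then a * w i else 0) + (if k = j then b * w j else 0))"
    unfolding pairing_def using assms by (intro sum.cong) auto
  also have "\<dots> = a * w i + b * w j"
    using assms by (simp add: sum.distrib)
  finally show ?thesis .
qed

text \<open>A sum of integral squares equals 2 only if two entries are signs and the others vanish.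
  Describing the roots by their norm turns closure under reflections into the fact that reflections
  are isometries.\<close>

lemma D_roots_iff:
  "r \<in> D_roots n \<longleftrightarrow> (\<forall>k. k \<notin> {1..n} \<longrightarrow> r k = 0) \<and> pairing n r r = 2"
proof
  assume "r \<in> D_roots n"
  then show "(\<forall>k. k \<notin> {1..n} \<longrightarrow> r k = 0) \<and> pairing n r r = 2"
    by (elim D_rootsE) (auto simp: pairing_two_terms)
next
  assume r: "(\<forall>k. k \<notin> {1..n} \<longrightarrow> r k = 0) \<and> pairing n r r = 2"
  have unit: "x = 1 \<or> x = -1" if "x * x \<le> 2" "x \<noteq> 0" for x :: int
  proof -
    have "\<bar>x\<bar> < 2"
    proof (rule ccontr)
      assume "\<not> \<bar>x\<bar> < 2"
      then have "2 * 2 \<le> \<bar>x\<bar> * \<bar>x\<bar>" by (intro mult_mono) auto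
      with that show False by (simp flip: abs_mult)
    qed
    with that show ?thesis by auto
  qed
  have s: "(\<Sum>k\<in>{1..n}. r k * r k) = 2" using r by (simp add: pairing_def)
  obtain i where i: "i \<in> {1..n}" "r i \<noteq> 0"
    using s by (metis (no_types, lifting) mult_zero_left sum.neutral zero_neq_numeral)
  have si: "r i * r i + (\<Sum>k\<in>{1..n} - {i}. r k * r k) = 2"
    using s i by (simp add: sum.remove)
  have nn: "(\<Sum>k\<in>A. r k * r k) \<ge> 0" for A by (intro sum_nonneg) simp
  have ri: "r i = 1 \<or> r i = -1" using unit[of "r i"] si nn[of "{1..n} - {i}"] i by linarith
  then have s1: "(\<Sum>k\<in>{1..n} - {i}. r k * r k) = 1" using si by auto
  obtain j where j: "j \<in> {1..n} - {i}" "r j \<noteq> 0"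
    using s1 by (metis (no_types, lifting) mult_zero_left sum.neutral zero_neq_one)
  have sj: "r j * r j + (\<Sum>k\<in>{1..n} - {i} - {j}. r k * r k) = 1"
    using s1 j by (metis (no_types, lifting) finite_Diff finite_atLeastAtMost sum.remove)
  have rj: "r j = 1 \<or> r j = -1" using unit[of "r j"] sj nn[of "{1..n} - {i} - {j}"] j by linarith
  then have "(\<Sum>k\<in>{1..n} - {i} - {j}. r k * r k) = 0" using sj by auto
  then have z: "r k = 0" if "k \<in> {1..n} - {i} - {j}" for k
    using that by (subst (asm) sum_nonneg_eq_0_iff) auto
  define p q where "p = min i j" and "q = max i j"
  have pq: "p < q" "1 \<le> p" "q \<le> n" "r p \<in> {1, -1}" "r q \<in> {1, -1}"
    using i j ri rj by (auto simp: p_def q_def min_def max_def)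
  have "r = (\<lambda>k. if k = p then r p else if k = q then r q else 0)"
  proof
    fix k
    show "r k = (if k = p then r p else if k = q then r q else 0)"
      using z[of k] r by (cases "k \<in> {1..n}") (auto simp: p_def q_def min_def max_def)
  qed
  with pq show "r \<in> D_roots n"
    unfolding D_roots_def by blast
qed

lemma finite_D_roots: "finite (D_roots n)"
proof -
  let ?f = "\<lambda>(i, j, a, b) k. if k = i then a else if k = j then b else (0::int)"
  have "D_roots n \<subseteq> ?f ` ({1..n} \<times> {1..n} \<times> {1, -1} \<times> {1, -1})"
  proof
    fix r assume "r \<in> D_roots n"
    then obtain i j a b where "1 \<le> i" "i < j" "j \<le> n" "a = 1 \<or> a = -1" "b = 1 \<or> b = -1"
      and "r = ?f (i, j, a, b)"
      by (elim D_rootsE) simp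
    then show "r \<in> ?f ` ({1..n} \<times> {1..n} \<times> {1, -1} \<times> {1, -1})"
      by (intro image_eqI[of _ _ "(i, j, a, b)"]) auto
  qed
  then show ?thesis by (rule finite_subset) simp
qed

lemma D_roots_norm: "r \<in> D_roots n \<Longrightarrow> pairing n r r = 2"
  by (simp add: D_roots_iff)

lemma D_roots_neg: "r \<in> D_roots n \<Longrightarrow> (\<lambda>k. - r k) \<in> D_roots n"
  by (simp add: D_roots_iff pairing_def)

lemma pairing_reflection:
  assumes "r \<in> D_roots n"
  shows "pairing n (reflection n r v) (reflection n r w) = pairing n v w"
proof -
  have "pairing n (reflection n r v) (reflection n r w) =
      pairing n v (reflection n r w) - pairing n v r * pairing n r (reflection n r w)"
    by (rule pairing_reflection_left)
  also have "pairing n v (reflection n r w) = pairing n v w - pairing n w r * pairing n v r"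
    by (metis pairing_commute pairing_reflection_left)
  also have "pairing n r (reflection n r w) = - pairing n w r"
    unfolding pairing_commute[of n r "reflection n r w"] pairing_reflection_left
    by (simp add: D_roots_norm[OF assms])
  finally show ?thesis by (simp add: algebra_simps)
qed

lemma reflection_D_roots: "r \<in> D_roots n \<Longrightarrow> v \<in> D_roots n \<Longrightarrow> reflection n r v \<in> D_roots n"
  using pairing_reflection[of r n v v] by (auto simp: D_roots_iff reflection_def)

lemma reflection_reflection: "r \<in> D_roots n \<Longrightarrow> reflection n r (reflection n r v) = v"
  using pairing_reflection_left[of n r v r] D_roots_norm[of r n]
  by (auto simp: reflection_def fun_eq_iff)

lemma reflection_self: "r \<in> D_roots n \<Longrightarrow> reflection n r r = (\<lambda>k. - r k)"
  by (simp add: reflection_def D_roots_norm fun_eq_iff)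

lemma reflection_neg: "reflection n r (\<lambda>k. - v k) = (\<lambda>k. - reflection n r v k)"
  by (simp add: reflection_def pairing_neg fun_eq_iff)

text \<open>Distinct roots have positive squared distance
  \<open>4 - 2 * pairing n r r'\<close>.\<close>

lemma pairing_le_1:
  assumes "r \<in> D_roots n" "r' \<in> D_roots n" "r \<noteq> r'"
  shows "pairing n r r' \<le> 1"
proof -
  have "(\<Sum>k=1..n. (r k - r' k) * (r k - r' k)) \<noteq> 0"
  proof
    assume "(\<Sum>k=1..n. (r k - r' k) * (r k - r' k)) = 0"
    then have "\<forall>k\<in>{1..n}. r k = r' k"
      by (subst (asm) sum_nonneg_eq_0_iff) auto
    then have "r k = r' k" for k using assms by (cases "k \<in> {1..n}") (auto simp: D_roots_iff)
    with assms show False by blast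
  qed
  moreover have "(\<Sum>k=1..n. (r k - r' k) * (r k - r' k)) \<ge> 0" by (intro sum_nonneg) simp
  moreover have "(\<Sum>k=1..n. (r k - r' k) * (r k - r' k)) = 4 - 2 * pairing n r r'"
  proof -
    have "pairing n (\<lambda>k. r k - r' k) (\<lambda>k. r k - r' k) = pairing n r r + pairing n r' r' - 2 * pairing n r r'"
      by (simp add: pairing_diff pairing_commute[of n _ "\<lambda>k. r k - r' k"] pairing_commute[of n r' r])
    then show ?thesis using assms by (simp add: pairing_def D_roots_iff)
  qed
  ultimately show ?thesis by linarith
qed

lemma D_simple_root: "2 \<le> n \<Longrightarrow> i \<in> {1..n} \<Longrightarrow> D_simple n i \<in> D_roots n"
proof -
  assume i: "2 \<le> n" "i \<in> {1..n}"
  show ?thesis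
  proof (cases "i < n")
    case True
    then show ?thesis using i unfolding D_roots_def D_simple_def
      by (intro CollectI exI[of _ i] exI[of _ "Suc i"] exI[of _ 1] exI[of _ "-1"]) (auto simp: fun_eq_iff)
  next
    case False
    then show ?thesis using i unfolding D_roots_def D_simple_def
      by (intro CollectI exI[of _ "n - 1"] exI[of _ n] exI[of _ 1] exI[of _ "1"]) (auto simp: fun_eq_iff)
  qed
qed

lemma pairing_D_simple:
  assumes "2 \<le> n" "i \<in> {1..n}"
  shows "pairing n v (D_simple n i) = (if i < n then v i - v (Suc i) else v (n - 1) + v n)"
proof (cases "i < n")
  case True
  then have "D_simple n i = (\<lambda>k. if k = i then 1 else if k = Suc i then -1 else 0)"
    by (simp add: D_simple_def fun_eq_iff)
  then show ?thesis using True assms by (subst pairing_commute) (simp add: pairing_two_terms)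
next
  case False
  then have "D_simple n i = (\<lambda>k. if k = n - 1 then 1 else if k = n then 1 else 0)"
    by (simp add: D_simple_def fun_eq_iff)
  then show ?thesis using False assms by (subst pairing_commute) (simp add: pairing_two_terms)
qed

text \<open>The coefficients \<open>n - k\<close> are those of the half sum of the positive coroots.\<close>

definition height :: "nat \<Rightarrow> (nat \<Rightarrow> int) \<Rightarrow> int" where
  "height n v = pairing n v (\<lambda>k. int n - int k)"

lemma height_neg: "height n (\<lambda>k. - v k) = - height n v"
  by (simp add: height_def pairing_neg)

lemma height_D_simple: "2 \<le> n \<Longrightarrow> i \<in> {1..n} \<Longrightarrow> height n (D_simple n i) = 1"
  unfolding height_def by (subst pairing_commute) (auto simp: pairing_D_simple)

lemma height_nonzero: "r \<in> D_roots n \<Longrightarrow> height n r \<noteq> 0"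
  by (elim D_rootsE) (auto simp: height_def pairing_two_terms)

lemma height_reflection:
  "2 \<le> n \<Longrightarrow> i \<in> {1..n} \<Longrightarrow>
    height n (reflection n (D_simple n i) v) = height n v - pairing n v (D_simple n i)"
  using height_D_simple by (simp add: height_def pairing_reflection_left)

text \<open>The reflection lowers the height by at most 1, by \<open>pairing_le_1\<close>. From a
  height of at least 1 the result is nonnegative, and no root has height 0.\<close>

lemma reflection_positive:
  assumes "2 \<le> n" "i \<in> {1..n}" "r \<in> D_roots n" "height n r > 0" "r \<noteq> D_simple n i"
  shows "height n (reflection n (D_simple n i) r) > 0"
proof -
  have "pairing n r (D_simple n i) \<le> 1" using assms D_simple_root by (intro pairing_le_1) auto
  moreover have "height n (reflection n (D_simple n i) r) \<noteq> 0"
    using assms D_simple_root reflection_D_roots height_nonzero by metis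
  ultimately show ?thesis using height_reflection[OF assms(1,2), of r] assms by linarith
qed

lemma positive_root_descent:
  assumes "2 \<le> n" "r \<in> D_roots n" "height n r > 0" "r \<notin> D_simple n ` {1..n}"
  shows "\<exists>i\<in>{1..n}. pairing n r (D_simple n i) > 0"
proof -
  obtain i j a b where ij: "1 \<le> i" "i < j" "j \<le> n" and ab: "a = 1 \<or> a = -1" "b = 1 \<or> b = -1"
    and r: "r = (\<lambda>k. if k = i then a else if k = j then b else 0)"
    using D_rootsE[OF assms(2)] .
  \<comment> \<open>The smaller index has the larger weight \<open>n - i\<close> in the height, so
    its coefficient decides the sign.\<close>
  have a: "a = 1" using assms(3) ij ab by (auto simp: height_def r pairing_two_terms)
  have ns: "r \<noteq> D_simple n k" if "k \<in> {1..n}" for k using that assms(4) by blast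
  have p: "pairing n r (D_simple n k) = (if k < n then r k - r (Suc k) else r (n - 1) + r n)"
    if "k \<in> {1..n}" for k using pairing_D_simple[OF assms(1) that] .
  \<comment> \<open>With \<open>e\<close> the unit vectors: \<open>e i - e j\<close> with a gap
    pairs positively with the simple root \<open>j - 1\<close>, \<open>e i + e j\<close> for
    \<open>j < n\<close> with the simple root \<open>j\<close>, and \<open>e i + e n\<close> with
    the simple root \<open>n\<close>; the remaining two cases are themselves simple.\<close>
  consider "b = -1" "j = Suc i" | "b = -1" "j > Suc i" | "b = 1" "j < n" | "b = 1" "j = n" "Suc i = n"
    | "b = 1" "j = n" "Suc i < n"
    using ab ij by linarith
  then show ?thesis
  proof cases
    case 1
    then have "r = D_simple n i" using a ij by (auto simp: r D_simple_def fun_eq_iff)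
    then show ?thesis using ns ij by auto
  next
    case 2
    then have mem: "j - 1 \<in> {1..n}" and "r (j - 1) - r (Suc (j - 1)) > 0" using ij by (auto simp: r)
    then have "pairing n r (D_simple n (j - 1)) > 0" unfolding p[OF mem] using 2 ij by auto
    with mem show ?thesis by blast
  next
    case 3
    then have mem: "j \<in> {1..n}" and "r j - r (Suc j) > 0" using ij by (auto simp: r)
    then have "pairing n r (D_simple n j) > 0" unfolding p[OF mem] using 3 by auto
    with mem show ?thesis by blast
  next
    case 4
    then have "r = D_simple n n" using a ij by (auto simp: r D_simple_def fun_eq_iff)
    then show ?thesis using ns ij by auto
  next
    case 5
    then have mem: "n \<in> {1..n}" and "r (n - 1) + r n > 0" using ij by (auto simp: r)
    then have "pairing n r (D_simple n n) > 0" unfolding p[OF mem] by auto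
    with mem show ?thesis by blast
  qed
qed

text \<open>Simple reflections lower the height of a positive root until it is simple. Negative
  roots are covered by carrying \<open>- r\<close> along with \<open>r\<close>, starting from the
  fact that a simple reflection negates its own root.\<close>

lemma D_roots_induct [consumes 2, case_names simple reflection]:
  assumes n: "2 \<le> n" and "r \<in> D_roots n"
    and simple: "\<And>i. i \<in> {1..n} \<Longrightarrow> P (D_simple n i)"
    and reflection: "\<And>i r. i \<in> {1..n} \<Longrightarrow> r \<in> D_roots n \<Longrightarrow> P r \<Longrightarrow> P (reflection n (D_simple n i) r)"
  shows "P r"
proof -
  have pos: "P r \<and> P (\<lambda>k. - r k)" if "r \<in> D_roots n" "height n r > 0" for r
    using that
  proof (induction "nat (height n r)" arbitrary: r rule: less_induct)
    case less
    show ?case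
    proof (cases "r \<in> D_simple n ` {1..n}")
      case True
      then obtain i where i: "i \<in> {1..n}" "r = D_simple n i" by blast
      then have "reflection n (D_simple n i) r = (\<lambda>k. - r k)"
        using reflection_self less.prems(1) by blast
      then show ?thesis using simple[OF i(1)] reflection[OF i(1) less.prems(1)] i by metis
    next
      case False
      then obtain i where i: "i \<in> {1..n}" "pairing n r (D_simple n i) > 0"
        using positive_root_descent n less.prems by blast
      let ?r = "reflection n (D_simple n i) r"
      have root: "?r \<in> D_roots n" using i less.prems D_simple_root n reflection_D_roots by metis
      have ht: "height n ?r > 0"
        using reflection_positive[OF n i(1) less.prems] False i by blast
      moreover have "height n ?r < height n r" using height_reflection[OF n i(1), of r] i by simp
      ultimately have ih: "P ?r" "P (\<lambda>k. - ?r k)" using less.hyps[of ?r] root by auto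
      have inv: "reflection n (D_simple n i) ?r = r"
        using reflection_reflection D_simple_root n i by metis
      show ?thesis
        using reflection[OF i(1) root ih(1)] reflection[OF i(1) D_roots_neg[OF root] ih(2)]
        by (simp add: inv reflection_neg)
    qed
  qed
  show ?thesis
  proof (cases "height n r > 0")
    case True
    then show ?thesis using pos assms(2) by blast
  next
    case False
    then have "height n (\<lambda>k. - r k) > 0"
      using height_nonzero[OF assms(2)] by (simp add: height_neg)
    then have "P (\<lambda>k. - (- r k))" using pos D_roots_neg[OF assms(2)] by blast
    then show ?thesis by simp
  qed
qed

section \<open>The root lattice and the Dynkin diagram\<close>

lemma D_lattice_zero: "(\<lambda>k. 0) \<in> carrier (D_lattice n)"
  by (auto simp: D_lattice_def intro: exI[of _ "\<lambda>r. 0"])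

lemma D_lattice_add:
  assumes "v \<in> carrier (D_lattice n)" "w \<in> carrier (D_lattice n)"
  shows "(\<lambda>k. v k + w k) \<in> carrier (D_lattice n)"
proof -
  obtain c d where "v = (\<lambda>k. \<Sum>r\<in>D_roots n. c r * r k)" "w = (\<lambda>k. \<Sum>r\<in>D_roots n. d r * r k)"
    using assms by (auto simp: D_lattice_def)
  then show ?thesis
    by (auto simp: D_lattice_def sum.distrib distrib_right fun_eq_iff intro!: exI[of _ "\<lambda>r. c r + d r"])
qed

lemma D_lattice_scale:
  assumes "v \<in> carrier (D_lattice n)"
  shows "(\<lambda>k. c * v k) \<in> carrier (D_lattice n)"
proof -
  obtain d where "v = (\<lambda>k. \<Sum>r\<in>D_roots n. d r * r k)"
    using assms by (auto simp: D_lattice_def)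
  then show ?thesis
    by (auto simp: D_lattice_def sum_distrib_left mult.assoc fun_eq_iff intro!: exI[of _ "\<lambda>r. c * d r"])
qed

lemma D_roots_lattice:
  assumes "r \<in> D_roots n"
  shows "r \<in> carrier (D_lattice n)"
proof -
  have "(\<Sum>r'\<in>D_roots n. (if r' = r then 1 else 0) * r' k) = r k" for k
    using finite_D_roots assms by (simp add: if_distrib[of "\<lambda>x. x * _"] cong: if_cong)
  then have "r = (\<lambda>k. \<Sum>r'\<in>D_roots n. (if r' = r then 1 else 0) * r' k)" by simp
  then show ?thesis unfolding D_lattice_def by (auto intro!: exI[of _ "\<lambda>r'. if r' = r then 1 else 0"])
qed

lemma reflection_lattice:
  assumes "r \<in> D_roots n" "v \<in> carrier (D_lattice n)"
  shows "reflection n r v \<in> carrier (D_lattice n)"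
  using D_lattice_add[OF assms(2) D_lattice_scale[OF D_roots_lattice[OF assms(1)], of "- pairing n v r"]]
  by (simp add: reflection_def)

definition adjacent :: "nat \<Rightarrow> nat \<Rightarrow> nat \<Rightarrow> bool" where
  "adjacent n i j \<longleftrightarrow> (j = Suc i \<and> j < n) \<or> (i = Suc j \<and> i < n) \<or>
     (i + 2 = n \<and> j = n) \<or> (j + 2 = n \<and> i = n)"

lemma adjacent_sym: "adjacent n i j \<longleftrightarrow> adjacent n j i"
  by (auto simp: adjacent_def)

lemma pairing_simple_simple:
  assumes "4 \<le> n" "i \<in> {1..n}" "j \<in> {1..n}"
  shows "pairing n (D_simple n i) (D_simple n j) = (if i = j then 2 else if adjacent n i j then -1 else 0)"
  using assms by (subst pairing_D_simple) (auto simp: D_simple_def adjacent_def)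

lemma D_simple_inj:
  assumes "4 \<le> n"
  shows "inj_on (D_simple n) {1..n}"
proof (rule inj_onI, rule ccontr)
  fix i j assume *: "i \<in> {1..n}" "j \<in> {1..n}" "D_simple n i = D_simple n j" "i \<noteq> j"
  have "pairing n (D_simple n i) (D_simple n j) = 2"
    using pairing_simple_simple[OF assms *(1,1)] *(3) by simp
  then show False
    using pairing_simple_simple[OF assms *(1,2)] *(4) by (simp split: if_splits)
qed

section \<open>Matrix groups and polynomial curves\<close>

hide_const (open) up_ring.coeff up_ring.monom module.smult

lemma GL_simps [simp]:
  "carrier GL = {A. invertible A}" "A \<otimes>\<^bsub>GL\<^esub> B = A ** B" "\<one>\<^bsub>GL\<^esub> = mat 1"
  by (simp_all add: GL_def)

lemma GL_group: "group (GL :: ('a::field^'m^'m) monoid)"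
proof (rule groupI)
  fix A :: "'a^'m^'m" assume "A \<in> carrier GL"
  then obtain B where "A ** B = mat 1" "B ** A = mat 1" by (auto simp: invertible_def)
  then show "\<exists>B\<in>carrier GL. B \<otimes>\<^bsub>GL\<^esub> A = \<one>\<^bsub>GL\<^esub>"
    by (intro bexI[of _ B]) (auto simp: invertible_def)
qed (auto simp: matrix_mul_assoc invertible_mult, auto simp: invertible_def intro: exI[of _ "mat 1"])

interpretation GL: group "GL :: ('a::field^'m^'m) monoid"
  by (rule GL_group)

abbreviation ginv :: "'a::field^'m^'m \<Rightarrow> 'a^'m^'m" where
  "ginv g \<equiv> inv\<^bsub>GL\<^esub> g"

lemma ginv_left [simp]: "invertible g \<Longrightarrow> ginv g ** g = mat 1"
  using GL.l_inv[of g] by simp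

lemma ginv_right [simp]: "invertible g \<Longrightarrow> g ** ginv g = mat 1"
  using GL.r_inv[of g] by simp

lemma ginv_cancel_left [simp]: "invertible g \<Longrightarrow> A ** ginv g ** g = A"
  by (simp flip: matrix_mul_assoc)

lemma ginv_cancel_right [simp]: "invertible g \<Longrightarrow> A ** g ** ginv g = A"
  by (simp flip: matrix_mul_assoc)

lemma ginv_mult [simp]: "invertible g \<Longrightarrow> invertible h \<Longrightarrow> ginv (g ** h) = ginv h ** ginv g"
  using GL.inv_mult_group[of g h] by simp

lemma ginv_ginv [simp]: "invertible g \<Longrightarrow> ginv (ginv g) = g"
  using GL.inv_inv[of g] by simp

lemma ginv_unique: "g ** h = mat 1 \<Longrightarrow> ginv g = (h :: 'a::field^'m^'m)"
  by (metis GL.inv_equality GL_simps invertible_left_inverse invertible_right_inverse mem_Collect_eq ginv_ginv)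

lemma mult_left_eq_iff:
  "invertible g \<Longrightarrow> g ** A = B \<longleftrightarrow> A = ginv g ** (B :: 'a::field^'m^'m)"
  by (metis ginv_left ginv_right matrix_mul_assoc matrix_mul_lid)

lemma mult_right_eq_iff:
  "invertible g \<Longrightarrow> A ** g = B \<longleftrightarrow> A = (B :: 'a::field^'m^'m) ** ginv g"
  by (metis ginv_left ginv_right matrix_mul_assoc matrix_mul_rid)

text \<open>Otherwise the product of all \<open>x - a\<close>, increased by 1, would be a
  nonconstant polynomial without a root.\<close>

lemma infinite_alg_closed: "infinite (UNIV :: 'a::alg_closed_field set)"
proof
  assume fin: "finite (UNIV :: 'a set)"
  define p :: "'a poly" where "p = (\<Prod>a\<in>UNIV. [:- a, 1:])"
  have deg: "degree p = card (UNIV :: 'a set)"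
    unfolding p_def by (subst degree_prod_eq_sum_degree) auto
  then have "degree (p + 1) > 0"
    using fin by (subst degree_add_eq_left) (auto simp: card_gt_0_iff)
  then obtain x where "poly (p + 1) x = 0" using alg_closed_imp_poly_has_root by blast
  moreover have "poly p x = 0" using fin by (auto simp: p_def poly_prod)
  ultimately show False by simp
qed

lemma poly_eqI_nonzero:
  fixes p q :: "'a::alg_closed_field poly"
  assumes "\<And>x. x \<noteq> 0 \<Longrightarrow> poly p x = poly q x"
  shows "p = q"
proof (rule ccontr)
  assume "p \<noteq> q"
  then have "finite {x. poly (p - q) x = 0}" by (intro poly_roots_finite) auto
  moreover have "UNIV - {0} \<subseteq> {x. poly (p - q) x = 0}" using assms by auto
  ultimately show False using infinite_alg_closed by (metis finite_Diff2 finite_subset finite.emptyI finite_insert)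
qed

lemma poly_fun_sum: "(\<And>k. k \<in> K \<Longrightarrow> f k \<in> poly_fun) \<Longrightarrow> (\<lambda>A. \<Sum>k\<in>K. f k A) \<in> poly_fun"
  by (induction K rule: infinite_finite_induct) (auto intro: poly_fun.intros)

lemma poly_fun_conj_entry: "(\<lambda>A. (P ** A ** Q) $ i $ j) \<in> poly_fun"
  by (simp add: matrix_matrix_mult_def) (intro poly_fun_sum poly_fun.intros)

lemma poly_fun_conj: "f \<in> poly_fun \<Longrightarrow> (\<lambda>A. f (P ** A ** Q)) \<in> poly_fun"
  by (induction rule: poly_fun.induct) (auto intro: poly_fun.intros poly_fun_conj_entry)

section \<open>Morphisms from the affine line to matrices and their Taylor coefficients\<close>

definition poly_curve :: "('a::field \<Rightarrow> 'a^'m^'m) \<Rightarrow> bool" where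
  "poly_curve \<gamma> \<longleftrightarrow> (\<forall>i j. \<exists>p. \<forall>x. \<gamma> x $ i $ j = poly p x)"

lemma poly_curve_const: "poly_curve (\<lambda>x. A)"
  unfolding poly_curve_def by (auto intro: exI[of _ "[:A $ _ $ _:]"])

lemma poly_curve_mult:
  assumes "poly_curve \<gamma>" "poly_curve \<delta>"
  shows "poly_curve (\<lambda>x. \<gamma> x ** \<delta> x)"
proof -
  obtain p q where "\<And>i j x. \<gamma> x $ i $ j = poly (p i j) x" "\<And>i j x. \<delta> x $ i $ j = poly (q i j) x"
    using assms unfolding poly_curve_def by metis
  then have "(\<gamma> x ** \<delta> x) $ i $ j = poly (\<Sum>k\<in>UNIV. p i k * q k j) x" for i j x
    by (simp add: matrix_matrix_mult_def poly_sum)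
  then show ?thesis unfolding poly_curve_def by blast
qed

lemma poly_curve_scale:
  assumes "poly_curve \<gamma>"
  shows "poly_curve (\<lambda>x. \<gamma> (c * x))"
proof -
  obtain p where p: "\<And>i j x. \<gamma> x $ i $ j = poly (p i j) x"
    using assms unfolding poly_curve_def by metis
  have "\<gamma> (c * x) $ i $ j = poly (pcompose (p i j) [:0, c:]) x" for i j x
    by (simp add: p poly_pcompose mult.commute)
  then show ?thesis unfolding poly_curve_def by blast
qed

lemma poly_fun_curve: "f \<in> poly_fun \<Longrightarrow> poly_curve \<gamma> \<Longrightarrow> \<exists>p. \<forall>x. f (\<gamma> x) = poly p x"
proof (induction rule: poly_fun.induct)
  case (const c)
  show ?case by (intro exI[of _ "[:c:]"]) simp
next
  case (entry i j)
  then show ?case unfolding poly_curve_def by blast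
next
  case (add f g)
  then obtain p q where "\<forall>x. f (\<gamma> x) = poly p x" "\<forall>x. g (\<gamma> x) = poly q x" by blast
  then show ?case by (intro exI[of _ "p + q"]) simp
next
  case (mult f g)
  then obtain p q where "\<forall>x. f (\<gamma> x) = poly p x" "\<forall>x. g (\<gamma> x) = poly q x" by blast
  then show ?case by (intro exI[of _ "p * q"]) simp
qed

text \<open>The matrix of Taylor coefficients at 0. The choice of \<open>p\<close> is harmless: over
  an infinite field the values determine the polynomial (\<open>poly_eqI_nonzero\<close>).\<close>

definition curve_coeff :: "('a::field \<Rightarrow> 'a^'m^'m) \<Rightarrow> nat \<Rightarrow> 'a^'m^'m" where
  "curve_coeff \<gamma> k = (\<chi> i j. coeff (SOME p. \<forall>x. \<gamma> x $ i $ j = poly p x) k)"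

lemma curve_coeff_eqI:
  fixes \<gamma> :: "'a::alg_closed_field \<Rightarrow> 'a^'m^'m"
  assumes "\<And>x. x \<noteq> 0 \<Longrightarrow> \<gamma> x $ i $ j = poly p x" "poly_curve \<gamma>"
  shows "curve_coeff \<gamma> k $ i $ j = coeff p k"
proof -
  define q where "q = (SOME p. \<forall>x. \<gamma> x $ i $ j = poly p x)"
  have "\<forall>x. \<gamma> x $ i $ j = poly q x"
    using assms(2) unfolding poly_curve_def q_def
    by (intro someI_ex[of "\<lambda>p. \<forall>x. \<gamma> x $ i $ j = poly p x"]) blast
  then have "q = p" using assms(1) by (intro poly_eqI_nonzero) auto
  then show ?thesis by (simp add: curve_coeff_def q_def)
qed

lemma curve_eq_sum:
  fixes \<gamma> :: "'a::alg_closed_field \<Rightarrow> 'a^'m^'m"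
  assumes "poly_curve \<gamma>"
  shows "\<exists>K. \<forall>x i j. \<gamma> x $ i $ j = (\<Sum>k\<le>K. x ^ k * curve_coeff \<gamma> k $ i $ j)"
proof -
  obtain p where p: "\<And>i j x. \<gamma> x $ i $ j = poly (p i j) x"
    using assms unfolding poly_curve_def by metis
  define K where "K = Max (range (\<lambda>(i, j). degree (p i j)))"
  have deg: "degree (p i j) \<le> K" for i j
    unfolding K_def by (rule Max_ge) (auto intro: image_eqI[of _ _ "(i, j)"])
  have "poly (p i j) x = (\<Sum>k\<le>K. coeff (p i j) k * x ^ k)" for i j x
    unfolding poly_altdef using deg[of i j]
    by (intro sum.mono_neutral_left) (auto simp: coeff_eq_0)
  moreover have "curve_coeff \<gamma> k $ i $ j = coeff (p i j) k" for i j k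
    using curve_coeff_eqI p assms by blast
  ultimately show ?thesis using p by (auto simp: mult.commute)
qed

lemma curve_coeff_mult:
  fixes \<gamma> :: "'a::alg_closed_field \<Rightarrow> 'a^'m^'m" and A B :: "'a^'m^'m"
  assumes "poly_curve \<gamma>"
  shows "curve_coeff (\<lambda>x. A ** \<gamma> x ** B) k = A ** curve_coeff \<gamma> k ** B"
proof -
  obtain p where p: "\<And>i j x. \<gamma> x $ i $ j = poly (p i j) x"
    using assms unfolding poly_curve_def by metis
  have c: "curve_coeff \<gamma> k $ i $ j = coeff (p i j) k" for i j
    using curve_coeff_eqI p assms by blast
  have pc: "poly_curve (\<lambda>x. A ** \<gamma> x ** B)"
    by (intro poly_curve_mult poly_curve_const assms)
  have "curve_coeff (\<lambda>x. A ** \<gamma> x ** B) k $ i $ j =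
      coeff (\<Sum>l\<in>UNIV. smult (B $ l $ j) (\<Sum>m\<in>UNIV. smult (A $ i $ m) (p m l))) k" for i j
    by (rule curve_coeff_eqI[OF _ pc]) (simp add: matrix_matrix_mult_def p poly_sum mult.commute)
  then show ?thesis
    by (simp add: vec_eq_iff matrix_matrix_mult_def c coeff_sum mult.commute)
qed

lemma curve_coeff_scale:
  fixes \<gamma> :: "'a::alg_closed_field \<Rightarrow> 'a^'m^'m"
  assumes "poly_curve \<gamma>"
  shows "curve_coeff (\<lambda>x. (\<chi> i j. a * \<gamma> (c * x) $ i $ j)) k = (\<chi> i j. a * c ^ k * curve_coeff \<gamma> k $ i $ j)"
proof -
  obtain p where p: "\<And>i j x. \<gamma> x $ i $ j = poly (p i j) x"
    using assms unfolding poly_curve_def by metis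
  have c: "curve_coeff \<gamma> k $ i $ j = coeff (p i j) k" for i j
    using curve_coeff_eqI p assms by blast
  have pc: "poly_curve (\<lambda>x. (\<chi> i j. a * \<gamma> (c * x) $ i $ j))"
    unfolding poly_curve_def
  proof (intro allI)
    fix i j
    have "a * \<gamma> (c * x) $ i $ j = poly (smult a (pcompose (p i j) [:0, c:])) x" for x
      by (simp add: p poly_pcompose mult.commute)
    then show "\<exists>p. \<forall>x. (\<chi> i j. a * \<gamma> (c * x) $ i $ j) $ i $ j = poly p x"
      by (intro exI[of _ "smult a (pcompose (p i j) [:0, c:])"]) simp
  qed
  have "curve_coeff (\<lambda>x. (\<chi> i j. a * \<gamma> (c * x) $ i $ j)) k $ i $ j =
      coeff (smult a (pcompose (p i j) [:0, c:])) k" for i j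
    by (rule curve_coeff_eqI[OF _ pc]) (simp add: p poly_pcompose mult.commute)
  then show ?thesis
    by (simp add: vec_eq_iff c coeff_pcompose_linear mult.assoc)
qed

text \<open>\<open>D\<close> is the differential of \<open>f\<close> at the identity, and the last
  clause is the chain rule. It is built along the generation of \<open>f\<close>, with the Leibniz
  rule for products.\<close>

lemma poly_fun_derivative:
  fixes f :: "'a::alg_closed_field^'m^'m \<Rightarrow> 'a"
  assumes "f \<in> poly_fun"
  shows "\<exists>D :: 'a^'m^'m \<Rightarrow> 'a. (\<forall>X Y. D (X + Y) = D X + D Y) \<and> (\<forall>c X. D (\<chi> i j. c * X $ i $ j) = c * D X) \<and>
    (\<forall>\<gamma> p. poly_curve \<gamma> \<and> \<gamma> 0 = mat 1 \<and> (\<forall>x. poly p x = f (\<gamma> x)) \<longrightarrow> coeff p 1 = D (curve_coeff \<gamma> 1))"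
  using assms
proof (induction rule: poly_fun.induct)
  case (const c)
  have "coeff p 1 = 0" if "\<forall>x. poly p x = c" for p
  proof -
    have "p = [:c:]" using that by (intro poly_eqI_nonzero) auto
    then show ?thesis by simp
  qed
  then show ?case by (intro exI[of _ "\<lambda>X. 0"]) auto
next
  case (entry i j)
  have "coeff p 1 = curve_coeff \<gamma> 1 $ i $ j" if "poly_curve \<gamma>" "\<forall>x. poly p x = \<gamma> x $ i $ j"
    for \<gamma> :: "'a \<Rightarrow> 'a^'m^'m" and p
    using curve_coeff_eqI[of \<gamma> i j p 1] that by simp
  then show ?case by (intro exI[of _ "\<lambda>X. X $ i $ j"]) simp
next
  case (add f g)
  then obtain D E where
    D: "\<forall>X Y. D (X + Y) = D X + D Y" "\<forall>c X. D (\<chi> i j. c * X $ i $ j) = c * D X"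
      "\<forall>\<gamma> p. poly_curve \<gamma> \<and> \<gamma> 0 = mat 1 \<and> (\<forall>x. poly p x = f (\<gamma> x)) \<longrightarrow> coeff p 1 = D (curve_coeff \<gamma> 1)"
    and E: "\<forall>X Y. E (X + Y) = E X + E Y" "\<forall>c X. E (\<chi> i j. c * X $ i $ j) = c * E X"
      "\<forall>\<gamma> p. poly_curve \<gamma> \<and> \<gamma> 0 = mat 1 \<and> (\<forall>x. poly p x = g (\<gamma> x)) \<longrightarrow> coeff p 1 = E (curve_coeff \<gamma> 1)"
    by blast
  have "coeff p 1 = D (curve_coeff \<gamma> 1) + E (curve_coeff \<gamma> 1)"
    if \<gamma>: "poly_curve \<gamma>" "\<gamma> 0 = mat 1" and p: "\<forall>x. poly p x = f (\<gamma> x) + g (\<gamma> x)" for \<gamma> p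
  proof -
    obtain q r where q: "\<forall>x. f (\<gamma> x) = poly q x" and r: "\<forall>x. g (\<gamma> x) = poly r x"
      using poly_fun_curve[OF add.hyps(1) \<gamma>(1)] poly_fun_curve[OF add.hyps(2) \<gamma>(1)] by blast
    have "p = q + r"
      by (rule poly_eqI_nonzero) (simp only: poly_add p[rule_format] q[rule_format] r[rule_format])
    moreover have "coeff q 1 = D (curve_coeff \<gamma> 1)" "coeff r 1 = E (curve_coeff \<gamma> 1)"
      using D(3)[rule_format, of \<gamma> q] E(3)[rule_format, of \<gamma> r] \<gamma> q r by auto
    ultimately show ?thesis by simp
  qed
  then show ?case using D E
    by (intro exI[of _ "\<lambda>X. D X + E X"]) (auto simp: algebra_simps)
next
  case (mult f g)
  then obtain D E where
    D: "\<forall>X Y. D (X + Y) = D X + D Y" "\<forall>c X. D (\<chi> i j. c * X $ i $ j) = c * D X"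
      "\<forall>\<gamma> p. poly_curve \<gamma> \<and> \<gamma> 0 = mat 1 \<and> (\<forall>x. poly p x = f (\<gamma> x)) \<longrightarrow> coeff p 1 = D (curve_coeff \<gamma> 1)"
    and E: "\<forall>X Y. E (X + Y) = E X + E Y" "\<forall>c X. E (\<chi> i j. c * X $ i $ j) = c * E X"
      "\<forall>\<gamma> p. poly_curve \<gamma> \<and> \<gamma> 0 = mat 1 \<and> (\<forall>x. poly p x = g (\<gamma> x)) \<longrightarrow> coeff p 1 = E (curve_coeff \<gamma> 1)"
    by blast
  have "coeff p 1 = D (curve_coeff \<gamma> 1) * g (mat 1) + f (mat 1) * E (curve_coeff \<gamma> 1)"
    if \<gamma>: "poly_curve \<gamma>" "\<gamma> 0 = mat 1" and p: "\<forall>x. poly p x = f (\<gamma> x) * g (\<gamma> x)" for \<gamma> p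
  proof -
    obtain q r where q: "\<forall>x. f (\<gamma> x) = poly q x" and r: "\<forall>x. g (\<gamma> x) = poly r x"
      using poly_fun_curve[OF mult.hyps(1) \<gamma>(1)] poly_fun_curve[OF mult.hyps(2) \<gamma>(1)] by blast
    have "p = q * r"
      by (rule poly_eqI_nonzero) (simp only: poly_mult p[rule_format] q[rule_format] r[rule_format])
    moreover have "coeff q 0 = f (mat 1)" "coeff r 0 = g (mat 1)"
      using q[rule_format, of 0] r[rule_format, of 0] \<gamma>(2) by (simp_all add: poly_0_coeff_0)
    moreover have "coeff q 1 = D (curve_coeff \<gamma> 1)" "coeff r 1 = E (curve_coeff \<gamma> 1)"
      using D(3)[rule_format, of \<gamma> q] E(3)[rule_format, of \<gamma> r] \<gamma> q r by auto
    ultimately show ?thesis by (simp add: coeff_mult)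
  qed
  then show ?case using D E
    by (intro exI[of _ "\<lambda>X. D X * g (mat 1) + f (mat 1) * E X"]) (auto simp: algebra_simps)
qed

text \<open>The differential \<open>D\<close> of an equation of \<open>G\<close> kills every
  velocity \<open>\<delta> x\<close>. Since \<open>D (\<delta> x)\<close> is a polynomial in
  \<open>x\<close> whose coefficients are the values of \<open>D\<close> on the coefficients of
  \<open>\<delta>\<close>, these vanish too. This is how weight vectors are extracted from a family
  of tangent vectors.\<close>

lemma curve_derivative_in_lie_algebra:
  fixes G :: "('a::alg_closed_field^'m^'m) set"
  assumes "\<And>x. poly_curve (\<gamma> x)" "\<And>x. \<gamma> x 0 = mat 1" "\<And>x y. \<gamma> x y \<in> G"
    and "\<And>x. curve_coeff (\<gamma> x) 1 = \<delta> x" "poly_curve \<delta>"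
  shows "curve_coeff \<delta> k \<in> lie_algebra G"
  unfolding lie_algebra_def
proof (intro CollectI ballI impI allI)
  fix f p
  assume f: "f \<in> poly_fun" "\<forall>g\<in>G. f g = 0"
    and p: "\<forall>x. poly p x = f (\<chi> i j. mat 1 $ i $ j + x * curve_coeff \<delta> k $ i $ j)"
  obtain D where D_add: "\<And>X Y. D (X + Y) = D X + D Y"
    and D_scale: "\<And>c X. D (\<chi> i j. c * X $ i $ j) = c * D X"
    and D: "\<And>\<gamma> p. poly_curve \<gamma> \<Longrightarrow> \<gamma> 0 = mat 1 \<Longrightarrow> \<forall>x. poly p x = f (\<gamma> x) \<Longrightarrow> coeff p 1 = D (curve_coeff \<gamma> 1)"
    using poly_fun_derivative[OF f(1)] by blast
  have D0: "D 0 = 0" using D_scale[of 0 0] by (simp flip: zero_vec_def)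
  have D_sum: "D (\<Sum>k\<in>K. X k) = (\<Sum>k\<in>K. D (X k))" if "finite K" for K :: "nat set" and X
    using that by (induction K) (auto simp: D0 D_add)
  have D_\<delta>: "D (\<delta> x) = 0" for x
    using D[of "\<gamma> x" 0] assms f by simp
  obtain K where K: "\<And>x i j. \<delta> x $ i $ j = (\<Sum>k\<le>K. x ^ k * curve_coeff \<delta> k $ i $ j)"
    using curve_eq_sum[OF assms(5)] by blast
  have "D (\<delta> x) = (\<Sum>k\<le>K. D (curve_coeff \<delta> k) * x ^ k)" for x
  proof -
    have "\<delta> x = (\<Sum>k\<le>K. \<chi> i j. x ^ k * curve_coeff \<delta> k $ i $ j)"
      by (simp add: vec_eq_iff K)
    then show ?thesis by (simp add: D_sum D_scale mult.commute)
  qed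
  then have "(\<Sum>k\<le>K. monom (D (curve_coeff \<delta> k)) k) = 0"
    using D_\<delta> by (intro poly_eqI_nonzero) (simp add: poly_sum poly_monom)
  then have "coeff (\<Sum>k\<le>K. monom (D (curve_coeff \<delta> k)) k) k = 0" by simp
  then have small: "D (curve_coeff \<delta> k) = 0" if "k \<le> K"
    using that by (simp add: coeff_sum)
  have large: "curve_coeff \<delta> k = 0" if "k > K"
  proof -
    have "curve_coeff \<delta> k $ i $ j = coeff (\<Sum>l\<le>K. monom (curve_coeff \<delta> l $ i $ j) l) k" for i j
      by (rule curve_coeff_eqI) (simp_all add: K poly_sum poly_monom mult.commute assms)
    then show ?thesis using that by (simp add: vec_eq_iff coeff_sum)
  qed
  have Dk: "D (curve_coeff \<delta> k) = 0" using small large D0 by (metis not_le)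
  \<comment> \<open>The definition of \<open>lie_algebra\<close> tests along the straight line
    through the identity, whose velocity is the given matrix, so \<open>D\<close> computes this test
    too.\<close>
  let ?\<epsilon> = "\<lambda>x. \<chi> i j. mat 1 $ i $ j + x * curve_coeff \<delta> k $ i $ j"
  have entry: "?\<epsilon> x $ i $ j = poly [:mat 1 $ i $ j, curve_coeff \<delta> k $ i $ j:] x" for x i j
    by simp
  have pc: "poly_curve ?\<epsilon>" unfolding poly_curve_def using entry by blast
  have "curve_coeff ?\<epsilon> 1 = curve_coeff \<delta> k"
    using curve_coeff_eqI[OF entry pc] by (simp add: vec_eq_iff)
  moreover have "?\<epsilon> 0 = mat 1" by (simp add: vec_eq_iff)
  ultimately have "coeff p 1 = 0" using D[OF pc _ p] Dk by simp
  then show "poly (pderiv p) 0 = 0" by (simp add: poly_0_coeff_0 coeff_pderiv)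
qed

section \<open>Adjoint groups of type \<open>D\<^sub>n\<close>\<close>

locale adjoint_type_D =
  fixes n :: nat
    and G T :: "('a::alg_closed_field^'m^'m) set"
    and psi :: "(nat \<Rightarrow> int) \<Rightarrow> 'a^'m^'m \<Rightarrow> 'a"
    and cr u :: "(nat \<Rightarrow> int) \<Rightarrow> 'a \<Rightarrow> 'a^'m^'m"
    and om :: "nat \<Rightarrow> 'a \<Rightarrow> 'a^'m^'m"
  assumes n6: "n \<ge> 6" and char: "(2::'a) \<noteq> 0"
    and alg: "alg_group G" and torus: "torus T" and T_sub_G: "T \<subseteq> G"
    and adjoint: "adjoint_group G T" and type_D: "type_D n G T psi"
    and coroots: "coroots n T psi cr" and coweights: "fundamental_coweights n T psi om"
    and realization: "realization n G T psi cr u"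
    and generated: "generated_by_reflections n G T u"
begin

abbreviation "L \<equiv> carrier (D_lattice n)"
abbreviation "al \<equiv> D_simple n"
abbreviation "N \<equiv> carrier (torus_normalizer G T)"
abbreviation "sg \<equiv> sigma u"
abbreviation chi :: "nat \<Rightarrow> 'a^'m^'m \<Rightarrow> 'a" where "chi i t \<equiv> psi (al i) t"

section \<open>The torus, its normalizer and their quotient\<close>

lemma G_subgroup: "subgroup G GL"
  using alg by (simp add: alg_group_def)

lemma T_subgroup: "subgroup T GL"
  using torus by (simp add: torus_def alg_group_def)

lemma G_invertible [simp]: "g \<in> G \<Longrightarrow> invertible g"
  using subgroup.mem_carrier[OF G_subgroup] by simp

lemma G_mult [simp]: "g \<in> G \<Longrightarrow> h \<in> G \<Longrightarrow> g ** h \<in> G"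
  using subgroup.m_closed[OF G_subgroup] by simp

lemma G_inv [simp]: "g \<in> G \<Longrightarrow> ginv g \<in> G"
  using subgroup.m_inv_closed[OF G_subgroup] by simp

lemma T_G [simp]: "t \<in> T \<Longrightarrow> t \<in> G"
  using T_sub_G by blast

lemma T_mult [simp]: "g \<in> T \<Longrightarrow> h \<in> T \<Longrightarrow> g ** h \<in> T"
  using subgroup.m_closed[OF T_subgroup] by simp

lemma T_inv [simp]: "g \<in> T \<Longrightarrow> ginv g \<in> T"
  using subgroup.m_inv_closed[OF T_subgroup] by simp

lemma T_one [simp]: "mat 1 \<in> T"
  using subgroup.one_closed[OF T_subgroup] by simp

lemma gp_G_group: "group (gp G)"
  using GL.subgroup_imp_group[OF G_subgroup] .

lemma T_subgroup_gp: "subgroup T (gp G)"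
  by (rule GL.subgroup_incl[OF T_subgroup G_subgroup T_sub_G])

lemma N_subgroup: "subgroup N GL"
proof -
  have "subgroup (normalizer (gp G) T) (gp G)"
    by (rule group.normalizer_imp_subgroup[OF gp_G_group]) (simp add: T_sub_G)
  then show ?thesis
    using GL.incl_subgroup[OF G_subgroup] by (simp add: torus_normalizer_def)
qed

lemma N_sub_G: "N \<subseteq> G"
  by (auto simp: torus_normalizer_def normalizer_def stabilizer_def)

lemma N_G [simp]: "g \<in> N \<Longrightarrow> g \<in> G"
  using N_sub_G by blast

lemma N_mult [simp]: "g \<in> N \<Longrightarrow> h \<in> N \<Longrightarrow> g ** h \<in> N"
  using subgroup.m_closed[OF N_subgroup] by simp

lemma N_inv [simp]: "g \<in> N \<Longrightarrow> ginv g \<in> N"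
  using subgroup.m_inv_closed[OF N_subgroup] by simp

lemma N_one [simp]: "mat 1 \<in> N"
  using subgroup.one_closed[OF N_subgroup] by simp

lemma torus_normalizer_simps [simp]:
  "g \<otimes>\<^bsub>torus_normalizer G T\<^esub> h = g ** h" "\<one>\<^bsub>torus_normalizer G T\<^esub> = mat 1"
  by (simp_all add: torus_normalizer_def)

lemma T_normal: "T \<lhd> torus_normalizer G T"
  using group.subgroup_in_normalizer[OF gp_G_group T_subgroup_gp]
  by (simp add: torus_normalizer_def)

lemma T_N [simp]: "t \<in> T \<Longrightarrow> t \<in> N"
  using subgroup.subset[OF normal_imp_subgroup[OF T_normal]] by blast

lemma torus_normalizer_inv: "g \<in> N \<Longrightarrow> inv\<^bsub>torus_normalizer G T\<^esub> g = ginv g"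
  using GL.m_inv_consistent[OF N_subgroup] by (simp add: torus_normalizer_def)

lemma conj_T [simp]: "g \<in> N \<Longrightarrow> t \<in> T \<Longrightarrow> g ** t ** ginv g \<in> T"
  using normal.inv_op_closed2[OF T_normal, of g t] by (simp add: torus_normalizer_inv)

lemma conj_T' [simp]: "g \<in> N \<Longrightarrow> t \<in> T \<Longrightarrow> ginv g ** t ** g \<in> T"
  using normal.inv_op_closed1[OF T_normal, of g t] by (simp add: torus_normalizer_inv)

abbreviation "W \<equiv> weyl G T"
abbreviation "pr \<equiv> weyl_proj G T"

lemma W_group: "group W"
  unfolding weyl_def by (rule normal.factorgroup_is_group[OF T_normal])

lemma weyl_proj_eq: "pr g = {t ** g |t. t \<in> T}"
  by (auto simp: weyl_proj_def r_coset_def)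

lemma carrier_W: "carrier W = pr ` N"
  by (auto simp: weyl_def FactGroup_def RCOSETS_def weyl_proj_def)

lemma pr_mult: "g \<in> N \<Longrightarrow> h \<in> N \<Longrightarrow> pr g \<otimes>\<^bsub>W\<^esub> pr h = pr (g ** h)"
  using normal.rcos_sum[OF T_normal, of g h] by (simp add: weyl_def weyl_proj_def)

lemma pr_eq_iff:
  assumes "g \<in> N" "h \<in> N"
  shows "pr g = pr h \<longleftrightarrow> (\<exists>t\<in>T. g = t ** h)"
proof
  assume "pr g = pr h"
  moreover have "mat 1 ** g \<in> pr g" unfolding weyl_proj_eq using T_one by blast
  ultimately show "\<exists>t\<in>T. g = t ** h" by (auto simp: weyl_proj_eq)
next
  assume "\<exists>t\<in>T. g = t ** h"
  then obtain t where t: "t \<in> T" "g = t ** h" by blast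
  show "pr g = pr h"
  proof (intro subset_antisym subsetI)
    fix x assume "x \<in> pr g"
    then obtain s where "s \<in> T" "x = s ** t ** h" using t by (auto simp: weyl_proj_eq matrix_mul_assoc)
    then show "x \<in> pr h" using t unfolding weyl_proj_eq by (auto intro!: exI[of _ "s ** t"])
  next
    fix x assume "x \<in> pr h"
    then obtain s where "s \<in> T" "x = s ** h" by (auto simp: weyl_proj_eq)
    then show "x \<in> pr g"
      using t unfolding weyl_proj_eq by (auto simp: matrix_mul_assoc intro!: exI[of _ "s ** ginv t"])
  qed
qed

lemma pr_one: "pr (mat 1) = \<one>\<^bsub>W\<^esub>"
  by (simp add: weyl_def FactGroup_def weyl_proj_eq)

lemma pr_T: "t \<in> T \<Longrightarrow> pr t = \<one>\<^bsub>W\<^esub>"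
  using pr_eq_iff[of t "mat 1"] pr_one by auto

section \<open>Characters and coordinates on the torus\<close>

lemma psi_character: "v \<in> L \<Longrightarrow> psi v \<in> characters T"
  using type_D by (auto simp: type_D_def hom_def char_group_def)

lemma psi_nonzero [simp]: "v \<in> L \<Longrightarrow> t \<in> T \<Longrightarrow> psi v t \<noteq> 0"
  using psi_character by (simp add: characters_def)

lemma psi_mult [simp]: "v \<in> L \<Longrightarrow> s \<in> T \<Longrightarrow> t \<in> T \<Longrightarrow> psi v (s ** t) = psi v s * psi v t"
  using psi_character by (simp add: characters_def)

lemma psi_one [simp]: "v \<in> L \<Longrightarrow> psi v (mat 1) = 1"
  using psi_mult[of v "mat 1" "mat 1"] psi_nonzero[of v "mat 1"] by simp

lemma psi_ginv [simp]: "v \<in> L \<Longrightarrow> t \<in> T \<Longrightarrow> psi v (ginv t) = inverse (psi v t)"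
  using psi_mult[of v t "ginv t"] by (simp add: inverse_unique)

lemma psi_add:
  assumes "v \<in> L" "w \<in> L" "t \<in> T"
  shows "psi (\<lambda>k. v k + w k) t = psi v t * psi w t"
proof -
  have "psi (v \<otimes>\<^bsub>D_lattice n\<^esub> w) = psi v \<otimes>\<^bsub>char_group T\<^esub> psi w"
    using type_D assms by (auto simp: type_D_def hom_def)
  then show ?thesis using assms by (simp add: D_lattice_def char_group_def)
qed

lemma psi_zero: "t \<in> T \<Longrightarrow> psi (\<lambda>k. 0) t = 1"
  using psi_add[of "\<lambda>k. 0" "\<lambda>k. 0" t] psi_nonzero[of "\<lambda>k. 0" t] D_lattice_zero[of n] by simp

lemma L_neg: "v \<in> L \<Longrightarrow> (\<lambda>k. - v k) \<in> L"
  using D_lattice_scale[of v n "-1"] by simp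

lemma psi_neg:
  assumes "v \<in> L" "t \<in> T"
  shows "psi (\<lambda>k. - v k) t = inverse (psi v t)"
proof -
  have "psi v t * psi (\<lambda>k. - v k) t = 1"
    using psi_add[OF assms(1) L_neg[OF assms(1)] assms(2)] psi_zero[OF assms(2)] by simp
  then show ?thesis by (metis inverse_unique)
qed

lemma psi_scale:
  assumes "v \<in> L" "t \<in> T"
  shows "psi (\<lambda>k. c * v k) t = psi v t powi c"
proof -
  have nat: "psi (\<lambda>k. int m * v k) t = psi v t ^ m" for m
  proof (induction m)
    case 0
    then show ?case using psi_zero assms by simp
  next
    case (Suc m)
    have "psi (\<lambda>k. v k + int m * v k) t = psi v t * psi (\<lambda>k. int m * v k) t"
      using assms by (intro psi_add D_lattice_scale)
    with Suc show ?case by (simp add: distrib_right)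
  qed
  show ?thesis
  proof (cases "c \<ge> 0")
    case True
    then show ?thesis using nat[of "nat c"] by (simp add: power_int_def)
  next
    case False
    then have "(\<lambda>k. c * v k) = (\<lambda>k. - (int (nat (- c)) * v k))" by simp
    then have "psi (\<lambda>k. c * v k) t = inverse (psi v t ^ nat (- c))"
      by (simp only: psi_neg[OF D_lattice_scale[OF assms(1)] assms(2)] nat)
    with False show ?thesis by (simp add: power_int_def power_inverse)
  qed
qed

lemma psi_reflection:
  assumes "r \<in> D_roots n" "v \<in> L" "t \<in> T"
  shows "psi (reflection n r v) t = psi v t * psi r t powi (- pairing n v r)"
proof -
  have r: "r \<in> L" using D_roots_lattice assms by blast
  have "psi (\<lambda>k. v k + (- pairing n v r) * r k) t = psi v t * psi (\<lambda>k. (- pairing n v r) * r k) t"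
    using assms r by (intro psi_add D_lattice_scale)
  then show ?thesis using psi_scale[OF r assms(3), of "- pairing n v r"] by (simp add: reflection_def)
qed

lemma al_root [simp]: "i \<in> {1..n} \<Longrightarrow> al i \<in> D_roots n"
  using D_simple_root n6 by simp

lemma al_L [simp]: "i \<in> {1..n} \<Longrightarrow> al i \<in> L"
  using D_roots_lattice al_root by blast

lemma psi_root_trivial:
  assumes "t \<in> T" "\<And>i. i \<in> {1..n} \<Longrightarrow> chi i t = 1" "r \<in> D_roots n"
  shows "psi r t = 1"
proof -
  have "2 \<le> n" using n6 by simp
  from this assms(3) show ?thesis
  proof (induction rule: D_roots_induct)
    case (simple i)
    then show ?case using assms by simp
  next
    case (reflection i r)
    then show ?case using assms D_roots_lattice by (simp add: psi_reflection)
  qed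
qed

lemma char_group_inv:
  assumes "r \<in> D_roots n"
  shows "inv\<^bsub>char_group T\<^esub> (psi r) = psi (\<lambda>k. - r k)"
proof -
  have r: "r \<in> L" "(\<lambda>k. - r k) \<in> L" using D_roots_lattice D_roots_neg assms by blast+
  have ext: "c \<in> extensional T" if "c \<in> characters T" for c using that by (simp add: characters_def)
  show ?thesis
    unfolding m_inv_def
  proof (rule the_equality)
    show "psi (\<lambda>k. - r k) \<in> carrier (char_group T) \<and>
        psi r \<otimes>\<^bsub>char_group T\<^esub> psi (\<lambda>k. - r k) = \<one>\<^bsub>char_group T\<^esub> \<and>
        psi (\<lambda>k. - r k) \<otimes>\<^bsub>char_group T\<^esub> psi r = \<one>\<^bsub>char_group T\<^esub>"
      using r by (auto simp: char_group_def psi_character psi_neg restrict_def fun_eq_iff)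
  next
    fix y assume y: "y \<in> carrier (char_group T) \<and>
        psi r \<otimes>\<^bsub>char_group T\<^esub> y = \<one>\<^bsub>char_group T\<^esub> \<and> y \<otimes>\<^bsub>char_group T\<^esub> psi r = \<one>\<^bsub>char_group T\<^esub>"
    have "y t = psi (\<lambda>k. - r k) t" if "t \<in> T" for t
    proof -
      have "psi r t * y t = 1"
        using y that by (auto simp: char_group_def restrict_def dest: fun_cong[of _ _ t])
      then show ?thesis using psi_neg[OF r(1) that] by (simp add: inverse_unique)
    qed
    moreover have "y \<in> extensional T" using y ext by (simp add: char_group_def)
    ultimately show "y = psi (\<lambda>k. - r k)"
      using ext[OF psi_character[OF r(2)]] by (intro extensionalityI[of _ T]) auto
  qed
qed

lemma character_trivial:
  assumes "t \<in> T" "\<And>i. i \<in> {1..n} \<Longrightarrow> chi i t = 1" "c \<in> characters T"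
  shows "c t = 1"
proof -
  have "c \<in> generate (char_group T) (roots G T)"
    using adjoint assms(3) by (simp add: adjoint_group_def)
  then show ?thesis
  proof (induction rule: generate.induct)
    case one
    then show ?case using assms(1) by (simp add: char_group_def)
  next
    case (incl h)
    then obtain r where "r \<in> D_roots n" "h = psi r" using type_D by (auto simp: type_D_def)
    then show ?case using psi_root_trivial[OF assms(1,2)] by simp
  next
    case (inv h)
    then obtain r where "r \<in> D_roots n" "h = psi r" using type_D by (auto simp: type_D_def)
    then show ?case
      using psi_root_trivial[OF assms(1,2)] D_roots_neg by (simp add: char_group_inv)
  next
    case (eng h1 h2)
    then show ?case using assms(1) by (simp add: char_group_def)
  qed
qed

text \<open>In a basis that diagonalizes \<open>T\<close> the diagonal entries are characters. For
  an adjoint group these are generated by the roots, so all diagonal entries of \<open>t\<close>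
  equal 1.\<close>

lemma T_trivial:
  assumes "t \<in> T" "\<And>i. i \<in> {1..n} \<Longrightarrow> chi i t = 1"
  shows "t = mat 1"
proof -
  obtain P where P: "invertible P" and diag: "\<And>t i j. t \<in> T \<Longrightarrow> i \<noteq> j \<Longrightarrow> (P ** t ** ginv P) $ i $ j = 0"
    using torus by (auto simp: torus_def)
  have "(P ** t ** ginv P) $ i $ i = 1" for i
  proof -
    define c where "c = (\<lambda>t\<in>T. (P ** t ** ginv P) $ i $ i)"
    have mult: "c (s ** t) = c s * c t" if "s \<in> T" "t \<in> T" for s t
    proof -
      have "P ** (s ** t) ** ginv P = (P ** s ** ginv P) ** (P ** t ** ginv P)"
        using P by (simp add: matrix_mul_assoc)
      then have "(P ** (s ** t) ** ginv P) $ i $ i =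
          (\<Sum>k\<in>UNIV. (P ** s ** ginv P) $ i $ k * (P ** t ** ginv P) $ k $ i)"
        by (simp add: matrix_matrix_mult_def)
      also have "\<dots> = (\<Sum>k\<in>{i}. (P ** s ** ginv P) $ i $ k * (P ** t ** ginv P) $ k $ i)"
        using diag that by (intro sum.mono_neutral_right) auto
      finally show ?thesis using that by (simp add: c_def)
    qed
    have "P ** mat 1 ** ginv P = mat 1" using P by simp
    then have one: "c (mat 1) = 1" by (simp add: c_def) (simp add: mat_def)
    have nz: "c t \<noteq> 0" if "t \<in> T" for t
      using mult[of t "ginv t"] one that by auto
    have "(\<lambda>A. (P ** A ** ginv P) $ i $ i) \<in> poly_fun" by (rule poly_fun_conj_entry)
    then have "\<exists>f\<in>poly_fun. \<exists>k. \<forall>t\<in>T. c t = f t / det t ^ k"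
      by (intro bexI[of _ "\<lambda>A. (P ** A ** ginv P) $ i $ i"] exI[of _ 0]) (auto simp: c_def)
    then have "c \<in> characters T"
      using mult nz by (auto simp: characters_def c_def)
    then have "c t = 1" using assms character_trivial by blast
    then show ?thesis using assms(1) by (simp add: c_def)
  qed
  then have "P ** t ** ginv P = mat 1"
    using diag[OF assms(1)] by (auto simp: vec_eq_iff mat_def)
  then have "ginv P ** (P ** t ** ginv P) ** P = mat 1" using P by simp
  then show ?thesis using P by (simp add: matrix_mul_assoc)
qed

lemma T_eqI:
  assumes "s \<in> T" "t \<in> T" "\<And>i. i \<in> {1..n} \<Longrightarrow> chi i s = chi i t"
  shows "s = t"
proof -
  have "s ** ginv t = mat 1" using assms by (intro T_trivial) auto
  then show ?thesis using assms by (simp add: mult_right_eq_iff)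
qed

lemma T_commute: "s \<in> T \<Longrightarrow> t \<in> T \<Longrightarrow> s ** t = t ** s"
  by (rule T_eqI) (auto simp: mult.commute)

lemma om_T [simp]: "i \<in> {1..n} \<Longrightarrow> x \<noteq> 0 \<Longrightarrow> om i x \<in> T"
  using coweights by (auto simp: fundamental_coweights_def cocharacter_def)

lemma chi_om: "i \<in> {1..n} \<Longrightarrow> j \<in> {1..n} \<Longrightarrow> x \<noteq> 0 \<Longrightarrow> chi j (om i x) = (if i = j then x else 1)"
  using coweights by (auto simp: fundamental_coweights_def)

lemma
  assumes "\<And>i. i \<in> {1..n} \<Longrightarrow> x i \<noteq> 0"
  shows coords_T: "coords n om x \<in> T"
    and chi_coords: "j \<in> {1..n} \<Longrightarrow> chi j (coords n om x) = x j"
proof -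
  have *: "foldr (\<lambda>i g. om i (x i) ** g) is (mat 1) \<in> T \<and>
      (\<forall>j\<in>{1..n}. chi j (foldr (\<lambda>i g. om i (x i) ** g) is (mat 1)) = (if j \<in> set is then x j else 1))"
    if "distinct is" "set is \<subseteq> {1..n}" for "is"
    using that by (induction "is") (auto simp: assms chi_om)
  show "coords n om x \<in> T"
    using *[of "[1..<Suc n]"]
    by (simp add: coords_def atLeastLessThanSuc_atLeastAtMost del: upt_Suc)
  show "chi j (coords n om x) = x j" if "j \<in> {1..n}"
    using *[of "[1..<Suc n]"] that
    by (simp add: coords_def atLeastLessThanSuc_atLeastAtMost del: upt_Suc)
qed

lemma cr_T [simp]: "r \<in> D_roots n \<Longrightarrow> x \<noteq> 0 \<Longrightarrow> cr r x \<in> T"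
  using coroots by (auto simp: coroots_def cocharacter_def)

lemma psi_cr: "r \<in> D_roots n \<Longrightarrow> v \<in> L \<Longrightarrow> x \<noteq> 0 \<Longrightarrow> psi v (cr r x) = x powi pairing n v r"
  using coroots by (auto simp: coroots_def)

lemma chi_cr: "i \<in> {1..n} \<Longrightarrow> j \<in> {1..n} \<Longrightarrow> x \<noteq> 0 \<Longrightarrow>
    chi j (cr (al i) x) = (if i = j then x ^ 2 else if adjacent n i j then inverse x else 1)"
  using n6 by (auto simp: psi_cr pairing_simple_simple adjacent_sym[of n j i] power_int_minus)

lemma cr_mult: "r \<in> D_roots n \<Longrightarrow> x \<noteq> 0 \<Longrightarrow> y \<noteq> 0 \<Longrightarrow> cr r (x * y) = cr r x ** cr r y"
  using coroots by (auto simp: coroots_def cocharacter_def)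

lemma cr_one: "r \<in> D_roots n \<Longrightarrow> cr r 1 = mat 1"
  by (rule T_eqI) (auto simp: psi_cr)

text \<open>A root takes the value \<open>y ^ 2\<close> on its own coroot at \<open>y\<close>, and
  every element of the field is a square.\<close>

lemma psi_root_surj:
  assumes "r \<in> D_roots n" "x \<noteq> 0"
  shows "\<exists>t\<in>T. psi r t = x"
proof -
  obtain y where y: "y ^ 2 = x" using nth_root_exists[of 2 x] by auto
  then have "y \<noteq> 0" using assms by auto
  then have "psi r (cr r y) = x"
    using assms y D_roots_lattice by (simp add: psi_cr D_roots_norm)
  then show ?thesis using assms \<open>y \<noteq> 0\<close> cr_T by blast
qed

section \<open>Root subgroups and the representatives of the reflections\<close>

lemma sg_N [simp]: "r \<in> D_roots n \<Longrightarrow> sg r \<in> N"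
  using realization by (simp add: realization_def)

lemma u_root_hom: "r \<in> D_roots n \<Longrightarrow> root_hom G T (psi r) (u r)"
  using realization by (simp add: realization_def)

lemma u_G [simp]: "r \<in> D_roots n \<Longrightarrow> u r x \<in> G"
  using u_root_hom[of r] by (auto simp: root_hom_def)

lemma u_add: "r \<in> D_roots n \<Longrightarrow> u r (x + y) = u r x ** u r y"
  using u_root_hom by (auto simp: root_hom_def)

lemma u_zero [simp]: "r \<in> D_roots n \<Longrightarrow> u r 0 = mat 1"
  using u_add[of r 0 0] mult_left_eq_iff[of "u r 0" "u r 0" "u r 0"] by simp

lemma u_minus: "r \<in> D_roots n \<Longrightarrow> ginv (u r x) = u r (- x)"
  using u_add[of r x "- x"] by (intro ginv_unique) simp

lemma u_cancel [simp]:
  assumes "r \<in> D_roots n"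
  shows "u r x ** u r (- x) = mat 1" "u r (- x) ** u r x = mat 1"
    "A ** u r x ** u r (- x) = A" "A ** u r (- x) ** u r x = A"
proof -
  show *: "u r x ** u r (- x) = mat 1" "u r (- x) ** u r x = mat 1"
    using u_add[OF assms, of x "- x"] u_add[OF assms, of "- x" x] assms by simp_all
  show "A ** u r x ** u r (- x) = A" "A ** u r (- x) ** u r x = A"
    by (simp_all add: * flip: matrix_mul_assoc)
qed

lemma u_curve: "r \<in> D_roots n \<Longrightarrow> poly_curve (u r)"
  using u_root_hom by (auto simp: root_hom_def poly_curve_def)

lemma u_left_inverse:
  assumes "r \<in> D_roots n"
  obtains f where "f \<in> poly_fun" "\<And>x. f (u r x) = x"
  using u_root_hom[OF assms] by (auto simp: root_hom_def)

lemma u_inj: "r \<in> D_roots n \<Longrightarrow> u r x = u r y \<longleftrightarrow> x = y"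
  using u_left_inverse by metis

lemma u_conj: "r \<in> D_roots n \<Longrightarrow> t \<in> T \<Longrightarrow> t ** u r x ** ginv t = u r (psi r t * x)"
  using u_root_hom by (auto simp: root_hom_def)

lemma psi_sg:
  "r \<in> D_roots n \<Longrightarrow> v \<in> L \<Longrightarrow> t \<in> T \<Longrightarrow> psi v (ginv (sg r) ** t ** sg r) = psi (reflection n r v) t"
  using realization by (simp add: realization_def)

lemma u_triple:
  "r \<in> D_roots n \<Longrightarrow> x \<noteq> 0 \<Longrightarrow>
    u r x ** u (\<lambda>k. - r k) (- inverse x) ** u r x = cr r x ** sg r"
  using realization by (simp add: realization_def)

text \<open>The inverse of \<open>sg r\<close> is the left side of \<open>u_triple\<close> at
  \<open>x = -1\<close>, hence equals \<open>cr r (-1) ** sg r\<close>.\<close>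

lemma sg_square: "r \<in> D_roots n \<Longrightarrow> sg r ** sg r = cr r (-1)"
proof -
  assume r: "r \<in> D_roots n"
  then have nr: "(\<lambda>k. - r k) \<in> D_roots n" by (rule D_roots_neg)
  have "ginv (sg r) = u r (-1) ** u (\<lambda>k. - r k) 1 ** u r (-1)"
    using r nr by (simp add: sigma_def u_minus matrix_mul_assoc)
  then have "ginv (sg r) = cr r (-1) ** sg r" using u_triple[OF r, of "-1"] by simp
  then have "cr r (-1) ** (sg r ** sg r) = mat 1"
    using r by (metis N_G G_invertible ginv_left matrix_mul_assoc sg_N)
  moreover have "cr r (-1) ** cr r (-1) = mat 1"
    using cr_mult[OF r, of "-1" "-1"] cr_one[OF r] by simp
  ultimately show ?thesis
    using r by (metis G_invertible T_G cr_T matrix_mul_assoc matrix_mul_lid neg_equal_0_iff_equal zero_neq_one)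
qed

text \<open>\<open>\<phi>\<close> is the action of \<open>g\<close> on the root lattice; conjugating
  \<open>t\<close> by the inverse of \<open>g\<close> makes it a left action
  (\<open>acts_mult\<close>). The isometry clause carries coroots to coroots in
  \<open>conj_cr\<close>.\<close>

definition acts :: "'a^'m^'m \<Rightarrow> ((nat \<Rightarrow> int) \<Rightarrow> nat \<Rightarrow> int) \<Rightarrow> bool" where
  "acts g \<phi> \<longleftrightarrow> g \<in> N \<and> (\<forall>v\<in>L. \<phi> v \<in> L \<and> (\<forall>t\<in>T. psi v (ginv g ** t ** g) = psi (\<phi> v) t)) \<and>
     (\<forall>v\<in>L. \<forall>w\<in>L. pairing n (\<phi> v) (\<phi> w) = pairing n v w)"

lemma acts_sg: "r \<in> D_roots n \<Longrightarrow> acts (sg r) (reflection n r)"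
  by (simp add: acts_def psi_sg reflection_lattice pairing_reflection)

lemma acts_T: "t \<in> T \<Longrightarrow> acts t (\<lambda>v. v)"
  by (simp add: acts_def)

lemma acts_mult:
  assumes "acts g \<phi>" "acts h \<theta>"
  shows "acts (g ** h) (\<lambda>v. \<phi> (\<theta> v))"
proof -
  have gh: "g \<in> N" "h \<in> N" using assms by (auto simp: acts_def)
  have "ginv (g ** h) ** t ** (g ** h) = ginv h ** (ginv g ** t ** g) ** h" for t
    using gh by (simp add: matrix_mul_assoc)
  then show ?thesis using assms gh by (simp add: acts_def)
qed

lemma neg_root [simp]: "r \<in> D_roots n \<Longrightarrow> (\<lambda>k. - r k) \<in> D_roots n"
  by (rule D_roots_neg)

lemma root_L [simp]: "r \<in> D_roots n \<Longrightarrow> r \<in> L"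
  by (rule D_roots_lattice)

lemma psi_inj: "v \<in> L \<Longrightarrow> w \<in> L \<Longrightarrow> (\<And>t. t \<in> T \<Longrightarrow> psi v t = psi w t) \<Longrightarrow> v = w"
proof -
  assume *: "v \<in> L" "w \<in> L" "\<And>t. t \<in> T \<Longrightarrow> psi v t = psi w t"
  then have "psi v = psi w"
    using psi_character by (intro extensionalityI[of _ T]) (auto simp: characters_def)
  then show ?thesis using * type_D by (auto simp: type_D_def dest: inj_onD)
qed

lemma acts_unique:
  assumes "acts g \<phi>" "acts g \<theta>" "v \<in> L"
  shows "\<phi> v = \<theta> v"
  using assms by (intro psi_inj) (auto simp: acts_def)

text \<open>The conjugated parametrization has weight \<open>psi r'\<close>, so by uniqueness of the
  root subgroup it has the same image as \<open>u r'\<close>. The change of parameter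
  \<open>h\<close> commutes with scaling by the values of \<open>psi r'\<close>, that is, by all
  nonzero scalars, and is therefore linear.\<close>

lemma conj_u:
  assumes g: "g \<in> N" and r: "r \<in> D_roots n" "r' \<in> D_roots n"
    and tr: "\<And>t. t \<in> T \<Longrightarrow> psi r (ginv g ** t ** g) = psi r' t"
  shows "\<exists>c. c \<noteq> 0 \<and> (\<forall>x. g ** u r x ** ginv g = u r' (c * x))"
proof -
  define v where "v x = g ** u r x ** ginv g" for x
  obtain f where f: "f \<in> poly_fun" "\<And>x. f (u r x) = x" using u_left_inverse[OF r(1)] by blast
  have v_hom: "root_hom G T (psi r') v"
    unfolding root_hom_def
  proof (intro conjI ballI allI)
    show "range v \<subseteq> G" using g r by (auto simp: v_def)
    show "v (x + y) = v x ** v y" for x y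
      using g r by (simp add: v_def u_add matrix_mul_assoc)
    show "\<exists>p. \<forall>x. v x $ i $ j = poly p x" for i j
    proof -
      have "poly_curve v"
        unfolding v_def by (intro poly_curve_mult poly_curve_const u_curve r)
      then show ?thesis by (simp add: poly_curve_def)
    qed
    have "f (ginv g ** v x ** g) = x" for x
      using g r f by (simp add: v_def matrix_mul_assoc)
    then show "\<exists>f\<in>poly_fun. \<forall>x. f (v x) = x"
      using poly_fun_conj[OF f(1)] by (intro bexI[of _ "\<lambda>A. f (ginv g ** A ** g)"]) auto
    show "t ** v x ** ginv t = v (psi r' t * x)" if t: "t \<in> T" for t x
    proof -
      have "t ** v x ** ginv t = g ** ((ginv g ** t ** g) ** u r x ** ginv (ginv g ** t ** g)) ** ginv g"
        using g r t by (simp add: v_def matrix_mul_assoc)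
      also have "\<dots> = v (psi r' t * x)"
        by (simp only: u_conj[OF r(1) conj_T'[OF g t]] tr[OF t] v_def)
      finally show ?thesis .
    qed
  qed
  then have "range v \<in> {range w |w. root_hom G T (psi r') w}" by (intro CollectI exI[of _ v]) simp
  moreover have "is_root_subgroup G T (psi r') (range (u r'))"
    using realization r by (simp add: realization_def)
  ultimately have "range v = range (u r')" by (simp only: is_root_subgroup_def singleton_iff)
  then have "\<exists>y. v x = u r' y" for x by (metis rangeE rangeI)
  then obtain h where h: "\<And>x. v x = u r' (h x)" by metis
  have v0: "v 0 = mat 1" using g r by (simp add: v_def)
  have h_scale: "h x = h 1 * x" for x
  proof (cases "x = 0")
    case True
    have "u r' (h 0) = u r' 0" using h[of 0] v0 r by simp
    then have "h 0 = 0" using u_inj[OF r(2)] by blast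
    with True show ?thesis by simp
  next
    case False
    then obtain t where t: "t \<in> T" "psi r' t = x" using psi_root_surj r by blast
    have "u r' (h x) = t ** v 1 ** ginv t"
      using v_hom t h by (simp add: root_hom_def)
    also have "\<dots> = u r' (x * h 1)" using t r by (simp add: h u_conj)
    finally show ?thesis using u_inj[OF r(2)] by (simp add: mult.commute)
  qed
  have "h 1 \<noteq> 0"
  proof
    assume "h 1 = 0"
    then have "v 1 = mat 1" using h[of 1] r by simp
    then have "ginv g ** v 1 ** g = ginv g ** mat 1 ** g" by simp
    then have "u r 1 = u r 0" using g r by (simp add: v_def matrix_mul_assoc)
    then show False using u_inj[OF r(1)] by simp
  qed
  then show ?thesis using h h_scale v_def by metis
qed

lemma conj_cr:
  assumes "acts g \<phi>" "r \<in> D_roots n" "\<phi> r \<in> D_roots n" "x \<noteq> 0"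
  shows "g ** cr r x ** ginv g = cr (\<phi> r) x"
proof -
  have g: "g \<in> N" using assms by (simp add: acts_def)
  have "ginv g ** cr (\<phi> r) x ** g = cr r x"
  proof (rule T_eqI)
    fix i assume i: "i \<in> {1..n}"
    then show "chi i (ginv g ** cr (\<phi> r) x ** g) = chi i (cr r x)"
      using assms by (simp add: acts_def psi_cr)
  qed (use assms g in auto)
  then have "g ** (ginv g ** cr (\<phi> r) x ** g) ** ginv g = g ** cr r x ** ginv g" by simp
  then show ?thesis using g by (simp add: matrix_mul_assoc)
qed

lemma sg_T:
  assumes "r \<in> D_roots n" "t \<in> T"
  shows "ginv (sg r) ** t ** sg r = t ** cr r (inverse (psi r t))"
proof (rule T_eqI)
  fix i assume i: "i \<in> {1..n}"
  then show "chi i (ginv (sg r) ** t ** sg r) = chi i (t ** cr r (inverse (psi r t)))"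
    using assms by (simp add: psi_sg psi_reflection psi_cr power_int_minus power_int_inverse)
qed (use assms in auto)

text \<open>A conjugate of the representative \<open>\<sigma>\<^sub>r\<close> is \<open>u(c) u\<^sub>-(-d) u(c)\<close> with \<open>u = u\<^sub>r\<^sub>'\<close>; with
  \<open>e = c\<^sup>-\<^sup>1 - d\<close> the element \<open>z = u(-c) u\<^sub>-(e) u(c)\<close> centralizes \<open>T\<close>.  Conjugation by \<open>T\<close> then shows
  that \<open>u\<^sub>-(x\<^sup>-\<^sup>1 e)\<close> depends polynomially on \<open>x\<close>, which forces \<open>e = 0\<close>.\<close>

lemma conj_sg:
  assumes act: "acts g \<phi>" and r: "r \<in> D_roots n" and r': "\<phi> r \<in> D_roots n"
  shows "\<exists>c. c \<noteq> 0 \<and> g ** sg r ** ginv g = cr (\<phi> r) c ** sg (\<phi> r)"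
proof -
  let ?r' = "\<phi> r" let ?m = "\<lambda>r k. - r k :: int"
  have g: "g \<in> N" using act by (simp add: acts_def)
  have tr: "psi r (ginv g ** t ** g) = psi ?r' t" if "t \<in> T" for t
    using act r that by (simp add: acts_def)
  obtain c where c: "c \<noteq> 0" "\<And>x. g ** u r x ** ginv g = u ?r' (c * x)"
    using conj_u[OF g r r' tr] by blast
  have "psi (?m r) (ginv g ** t ** g) = psi (?m ?r') t" if "t \<in> T" for t
    using that g r r' tr by (simp add: psi_neg)
  then obtain d where d: "d \<noteq> 0" "\<And>x. g ** u (?m r) x ** ginv g = u (?m ?r') (d * x)"
    using conj_u[OF g, of "?m r" "?m ?r'"] r r' by auto
  define e where "e = inverse c - d"
  define y where "y = g ** sg r ** ginv g"
  define y' where "y' = cr ?r' c ** sg ?r'"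
  define z where "z = ginv y' ** y"
  have N: "y \<in> N" "y' \<in> N" using g r r' c by (simp_all add: y_def y'_def)
  have y: "y = u ?r' c ** u (?m ?r') (- d) ** u ?r' c"
  proof -
    have "y = (g ** u r 1 ** ginv g) ** (g ** u (?m r) (-1) ** ginv g) ** (g ** u r 1 ** ginv g)"
      using g r by (simp add: y_def sigma_def matrix_mul_assoc)
    then show ?thesis by (simp only: c d) simp
  qed
  have y': "y' = u ?r' c ** u (?m ?r') (- inverse c) ** u ?r' c"
    using u_triple[OF r' c(1)] by (simp add: y'_def)
  have z: "z = u ?r' (- c) ** u (?m ?r') e ** u ?r' c"
  proof -
    have "u (?m ?r') e = u (?m ?r') (inverse c) ** u (?m ?r') (- d)"
      using u_add[of "?m ?r'" "inverse c" "- d"] r' by (simp add: e_def)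
    moreover have "z = u ?r' (- c) ** u (?m ?r') (inverse c) ** (u ?r' (- c) ** u ?r' c) **
        u (?m ?r') (- d) ** u ?r' c"
      using r' by (simp add: z_def y y' u_minus matrix_mul_assoc)
    moreover have "u ?r' (- c) ** u ?r' c = mat 1"
      using r' by simp
    ultimately show ?thesis by (simp add: matrix_mul_assoc)
  qed
  \<comment> \<open>Both \<open>y\<close> and \<open>y'\<close> act on \<open>T\<close> as the
    reflection in \<open>\<phi> r\<close>: the former because \<open>g\<close> carries the
    reflection in \<open>r\<close> there, the latter because its factor in \<open>T\<close> acts
    trivially.\<close>
  have same: "ginv y ** t ** y = ginv y' ** t ** y'" if t: "t \<in> T" for t
  proof -
    define \<tau> where "\<tau> = ginv g ** t ** g"
    have \<tau>: "\<tau> \<in> T" "g ** \<tau> ** ginv g = t" "psi r \<tau> = psi ?r' t"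
      using g t tr by (simp_all add: \<tau>_def matrix_mul_assoc)
    have nz: "inverse (psi ?r' t) \<noteq> 0" using t r' by simp
    have "ginv y ** t ** y = g ** (ginv (sg r) ** \<tau> ** sg r) ** ginv g"
      using g r by (simp add: y_def \<tau>_def matrix_mul_assoc)
    also have "\<dots> = (g ** \<tau> ** ginv g) ** (g ** cr r (inverse (psi r \<tau>)) ** ginv g)"
      using sg_T[OF r \<tau>(1)] g by (simp add: matrix_mul_assoc)
    also have "\<dots> = t ** cr ?r' (inverse (psi ?r' t))"
      using conj_cr[OF act r r' nz] \<tau> by simp
    also have "\<dots> = ginv (sg ?r') ** t ** sg ?r'" using sg_T[OF r' t] by simp
    also have "\<dots> = ginv (sg ?r') ** (ginv (cr ?r' c) ** t ** cr ?r' c) ** sg ?r'"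
    proof -
      have "ginv (cr ?r' c) ** t = t ** ginv (cr ?r' c)"
        using t r' c by (intro T_commute) simp_all
      then show ?thesis using r' c by simp
    qed
    also have "\<dots> = ginv y' ** t ** y'"
      using r' c by (simp add: y'_def matrix_mul_assoc)
    finally show ?thesis .
  qed
  have central: "t ** z ** ginv t = z" if t: "t \<in> T" for t
  proof -
    have "ginv y ** (y' ** t ** ginv y') ** y = ginv y' ** (y' ** t ** ginv y') ** y'"
      using N t by (intro same) simp
    also have "\<dots> = t" using N by (simp add: matrix_mul_assoc)
    finally have "(ginv y ** (y' ** t ** ginv y') ** y) ** ginv t = mat 1" using t by simp
    then have "(ginv y' ** y) ** ((ginv y ** (y' ** t ** ginv y') ** y) ** ginv t) = z"
      by (simp add: z_def)
    then show ?thesis using N by (simp add: z_def matrix_mul_assoc)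
  qed
  have "e = 0"
  proof -
    obtain f where f: "f \<in> poly_fun" "\<And>x. f (u (?m ?r') x) = x"
      using u_left_inverse[OF neg_root[OF r']] by blast
    have pc: "poly_curve (\<lambda>x. u ?r' (c * x) ** z ** u ?r' ((- c) * x))"
      by (intro poly_curve_mult poly_curve_const poly_curve_scale u_curve r')
    obtain q where q: "\<And>x. f (u ?r' (c * x) ** z ** u ?r' ((- c) * x)) = poly q x"
      using poly_fun_curve[OF f(1) pc] by blast
    \<comment> \<open>Away from 0 the polynomial \<open>q\<close> takes the values
      \<open>e / x\<close>; clearing the denominator makes the constant \<open>e\<close> a multiple
      of \<open>x\<close>.\<close>
    have "poly [:e:] x = poly (pCons 0 q) x" if x: "x \<noteq> 0" for x
    proof -
      obtain t where t: "t \<in> T" "psi ?r' t = x" using psi_root_surj[OF r' x] by blast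
      have "t ** z ** ginv t = (t ** u ?r' (- c) ** ginv t) ** (t ** u (?m ?r') e ** ginv t) **
          (t ** u ?r' c ** ginv t)"
        using t by (simp add: z matrix_mul_assoc)
      also have "\<dots> = u ?r' (- (c * x)) ** u (?m ?r') (inverse x * e) ** u ?r' (c * x)"
        using t r' by (simp add: u_conj psi_neg mult.commute)
      finally have "u ?r' (c * x) ** z ** u ?r' (- (c * x)) =
          (u ?r' (c * x) ** u ?r' (- (c * x))) ** u (?m ?r') (inverse x * e) ** (u ?r' (c * x) ** u ?r' (- (c * x)))"
        using central[OF t(1)] by (simp add: matrix_mul_assoc)
      also have "u ?r' (c * x) ** u ?r' (- (c * x)) = mat 1"
        using r' by simp
      finally have "inverse x * e = poly q x" using q[of x] f(2) by simp
      then show ?thesis using x by (simp add: field_simps)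
    qed
    then have "[:e:] = pCons 0 q" by (rule poly_eqI_nonzero)
    then show ?thesis by simp
  qed
  then have "y = y'" by (simp add: y y' e_def)
  then show ?thesis using c(1) by (auto simp: y_def y'_def)
qed

section \<open>Tangent vectors of root subgroups and orthogonal roots\<close>

abbreviation "root_vector r \<equiv> curve_coeff (u r) 1"

text \<open>The polynomial left inverse \<open>f\<close> of \<open>u r\<close> has derivative 1
  along \<open>u r\<close>, whereas its differential vanishes on a zero velocity.\<close>

lemma root_vector_nonzero:
  assumes "r \<in> D_roots n"
  shows "root_vector r \<noteq> 0"
proof
  assume zero: "root_vector r = 0"
  obtain f where f: "f \<in> poly_fun" "\<And>x. f (u r x) = x" using u_left_inverse[OF assms] by blast
  obtain D where D: "\<And>X Y. D (X + Y) = D X + D Y"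
    and deriv: "\<And>\<gamma> p. poly_curve \<gamma> \<Longrightarrow> \<gamma> 0 = mat 1 \<Longrightarrow> \<forall>x. poly p x = f (\<gamma> x) \<Longrightarrow> coeff p 1 = D (curve_coeff \<gamma> 1)"
    using poly_fun_derivative[OF f(1)] by blast
  have "D 0 = D 0 + D 0" using D[of 0 0] by simp
  then have "D 0 = 0" by (simp only: add_cancel_right_right)
  moreover have "coeff [:0, 1:] 1 = D (root_vector r)"
    using assms f by (intro deriv u_curve) auto
  ultimately show False using zero by simp
qed

lemma root_vector_conj:
  assumes "r \<in> D_roots n" "\<And>x. g ** u r x ** h = u r (c * x)"
  shows "g ** root_vector r ** h = (\<chi> i j. c * root_vector r $ i $ j)"
proof -
  have "g ** root_vector r ** h = curve_coeff (\<lambda>x. \<chi> i j. 1 * u r (c * x) $ i $ j) 1"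
    using curve_coeff_mult[OF u_curve[OF assms(1)], of g h 1] assms(2) by simp
  then show ?thesis using curve_coeff_scale[OF u_curve[OF assms(1)], of 1 c 1] by simp
qed

text \<open>The coefficients of \<open>x \<mapsto> u\<^sub>b(x) X\<^sub>a u\<^sub>b(-x)\<close> are weight vectors of weights \<open>a + k b\<close>,
  which for \<open>k \<noteq> 0\<close> are too long to be roots.\<close>

lemma orthogonal_fixes_root_vector:
  assumes a: "a \<in> D_roots n" and b: "b \<in> D_roots n" and orth: "pairing n a b = 0"
  shows "u b x ** root_vector a ** u b (- x) = root_vector a"
proof -
  define \<delta> where "\<delta> x = u b x ** root_vector a ** u b (- x)" for x
  have pc: "poly_curve \<delta>"
    unfolding \<delta>_def using poly_curve_scale[OF u_curve[OF b], of "-1"]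
    by (intro poly_curve_mult poly_curve_const u_curve b) simp
  have lie: "curve_coeff \<delta> k \<in> lie_algebra G" for k
  proof (rule curve_derivative_in_lie_algebra[where \<gamma> = "\<lambda>x y. u b x ** u a y ** u b (- x)"])
    show "poly_curve (\<lambda>y. u b x ** u a y ** u b (- x))" for x
      by (intro poly_curve_mult poly_curve_const u_curve a)
    show "u b x ** u a 0 ** u b (- x) = mat 1" for x
      using a b by simp
    show "u b x ** u a y ** u b (- x) \<in> G" for x y
      using a b by simp
    show "curve_coeff (\<lambda>y. u b x ** u a y ** u b (- x)) 1 = \<delta> x" for x
      unfolding \<delta>_def by (rule curve_coeff_mult[OF u_curve[OF a]])
  qed (rule pc)
  have zero: "curve_coeff \<delta> k = 0" if k: "k > 0" for k
  proof (rule ccontr)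
    assume nz: "curve_coeff \<delta> k \<noteq> 0"
    define v where "v = (\<lambda>l. a l + int k * b l)"
    have v: "v \<in> L"
      unfolding v_def using a b by (intro D_lattice_add D_lattice_scale) auto
    have weight: "t ** curve_coeff \<delta> k ** ginv t = (\<chi> i j. psi v t * curve_coeff \<delta> k $ i $ j)"
      if t: "t \<in> T" for t
    proof -
      have X: "t ** root_vector a ** ginv t = (\<chi> i j. psi a t * root_vector a $ i $ j)"
        using t a u_conj by (intro root_vector_conj) auto
      have "t ** \<delta> x ** ginv t = (\<chi> i j. psi a t * \<delta> (psi b t * x) $ i $ j)" for x
      proof -
        have "t ** \<delta> x ** ginv t =
            (t ** u b x ** ginv t) ** (t ** root_vector a ** ginv t) ** (t ** u b (- x) ** ginv t)"
          using t by (simp add: \<delta>_def matrix_mul_assoc)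
        also have "\<dots> = u b (psi b t * x) ** (\<chi> i j. psi a t * root_vector a $ i $ j) ** u b (- (psi b t * x))"
          using t b by (simp only: X u_conj) simp
        also have "\<dots> = (\<chi> i j. psi a t * \<delta> (psi b t * x) $ i $ j)"
          by (simp add: \<delta>_def matrix_matrix_mult_def vec_eq_iff sum_distrib_left mult_ac sum_distrib_right)
        finally show ?thesis .
      qed
      then have "t ** curve_coeff \<delta> k ** ginv t = curve_coeff (\<lambda>x. \<chi> i j. psi a t * \<delta> (psi b t * x) $ i $ j) k"
        using curve_coeff_mult[OF pc, of t "ginv t" k] by simp
      moreover have "psi v t = psi a t * psi b t ^ k"
        using t a b psi_add[of a "\<lambda>l. int k * b l" t] psi_scale[of b t "int k"] D_lattice_scale
        by (simp add: v_def)
      ultimately show ?thesis using curve_coeff_scale[OF pc] by simp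
    qed
    have norm: "pairing n v v = 2 + 2 * int k ^ 2"
    proof -
      have "pairing n v w = pairing n a w + int k * pairing n b w" for w
        by (simp add: v_def pairing_add pairing_scale)
      then show ?thesis
        using a b orth pairing_commute[of n _ v]
        by (simp add: D_roots_norm pairing_commute[of n b a] power2_eq_square)
    qed
    have "psi v \<noteq> \<one>\<^bsub>char_group T\<^esub>"
    proof
      assume "psi v = \<one>\<^bsub>char_group T\<^esub>"
      then have "v = (\<lambda>k. 0)"
        using v D_lattice_zero psi_zero by (intro psi_inj) (auto simp: char_group_def)
      then have "pairing n v v = 0" by (simp add: pairing_def)
      then show False using norm by (smt (verit) zero_le_power2)
    qed
    then have "psi v \<in> roots G T"
      using lie[of k] nz weight psi_character[OF v] unfolding roots_def by blast
    then obtain r where "r \<in> D_roots n" "psi v = psi r"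
      using type_D by (auto simp: type_D_def)
    then have "v \<in> D_roots n"
      using type_D v by (auto simp: type_D_def dest!: inj_onD[of psi "carrier (D_lattice n)" v r])
    then show False using norm k D_roots_norm by fastforce
  qed
  obtain K where K: "\<And>x i j. \<delta> x $ i $ j = (\<Sum>k\<le>K. x ^ k * curve_coeff \<delta> k $ i $ j)"
    using curve_eq_sum[OF pc] by blast
  have "\<delta> x $ i $ j = curve_coeff \<delta> 0 $ i $ j" for x i j
  proof -
    have "\<delta> x $ i $ j = (\<Sum>k\<in>{0}. x ^ k * curve_coeff \<delta> k $ i $ j)"
      unfolding K using zero by (intro sum.mono_neutral_right) auto
    then show ?thesis by simp
  qed
  then have "\<delta> x = \<delta> 0" by (simp add: vec_eq_iff)
  then show ?thesis using b by (simp add: \<delta>_def)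
qed

text \<open>By \<open>conj_u\<close> conjugation by \<open>sg b\<close> scales the parameter by some
  \<open>c\<close>, hence also the root vector of \<open>a\<close>. That vector commutes with the
  root subgroups of \<open>b\<close> and \<open>- b\<close>, so it is fixed, and as it is nonzero,
  \<open>c = 1\<close>.\<close>

lemma orthogonal_sg_u:
  assumes a: "a \<in> D_roots n" and b: "b \<in> D_roots n" and orth: "pairing n a b = 0"
  shows "sg b ** u a x ** ginv (sg b) = u a x"
proof -
  let ?X = "root_vector a"
  have tr: "psi a (ginv (sg b) ** t ** sg b) = psi a t" if "t \<in> T" for t
  proof -
    have "reflection n b a = a" using orth by (simp add: reflection_def)
    then show ?thesis using that a b by (simp add: psi_sg)
  qed
  obtain c where c: "c \<noteq> 0" "\<And>x. sg b ** u a x ** ginv (sg b) = u a (c * x)"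
    using conj_u[OF sg_N[OF b] a a tr] by blast
  have comm: "u b' x ** ?X = ?X ** u b' x" if "b' \<in> D_roots n" "pairing n a b' = 0" for b' x
    using orthogonal_fixes_root_vector[OF a that, of x] that(1)
    by (simp add: mult_right_eq_iff flip: u_minus)
  have orth': "pairing n a (\<lambda>k. - b k) = 0"
    using orth by (simp add: pairing_commute[of n a] pairing_neg)
  have "sg b ** ?X = ?X ** sg b"
    unfolding sigma_def using comm[OF b orth] comm[OF neg_root[OF b] orth']
    by (metis (no_types, lifting) matrix_mul_assoc)
  then have "sg b ** ?X ** ginv (sg b) = ?X" using b by simp
  then have eq: "(\<chi> i j. c * ?X $ i $ j) = ?X"
    using root_vector_conj[OF a c(2)] by simp
  have "c * ?X $ i $ j = ?X $ i $ j" for i j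
    using arg_cong[OF eq, of "\<lambda>M. M $ i $ j"] by simp
  moreover obtain i j where "?X $ i $ j \<noteq> 0"
    using root_vector_nonzero[OF a] unfolding vec_eq_iff by auto
  ultimately have "c = 1" by (metis mult_cancel_right1)
  then show ?thesis using c(2) by simp
qed

lemma orthogonal_sg_commute:
  assumes a: "a \<in> D_roots n" and b: "b \<in> D_roots n" and orth: "pairing n a b = 0"
  shows "sg a ** sg b = sg b ** sg a"
proof -
  have orth': "pairing n (\<lambda>k. - a k) b = 0"
    using orth by (simp add: pairing_neg)
  have "sg b ** sg a ** ginv (sg b) = (sg b ** u a 1 ** ginv (sg b)) **
      (sg b ** u (\<lambda>k. - a k) (-1) ** ginv (sg b)) ** (sg b ** u a 1 ** ginv (sg b))"
    using b by (simp add: sigma_def[of u a] matrix_mul_assoc)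
  also have "\<dots> = sg a"
    using orthogonal_sg_u[OF a b orth] orthogonal_sg_u[OF neg_root[OF a] b orth']
    by (simp add: sigma_def)
  finally show ?thesis using b by (simp add: mult_right_eq_iff)
qed

text \<open>Serves \<open>sg_braid\<close>: the root of such a node is nontrivial on just one of the
  two coroots. At the left end of the chain node 3 takes the place of the missing node 0.\<close>

lemma adjacent_third:
  assumes "i \<in> {1..n}" "j \<in> {1..n}" "adjacent n i j"
  shows "\<exists>k\<in>{1..n}. k \<noteq> i \<and> k \<noteq> j \<and> (adjacent n i k \<and> \<not> adjacent n j k \<or> \<not> adjacent n i k \<and> adjacent n j k)"
proof -
  consider "j = Suc i" "j < n" | "i = Suc j" "i < n" | "i + 2 = n" "j = n" | "j + 2 = n" "i = n"
    using assms(3) by (auto simp: adjacent_def)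
  then show ?thesis
  proof cases
    case 1
    then show ?thesis using assms n6
      by (intro bexI[of _ "if i = 1 then 3 else i - 1"]) (auto simp: adjacent_def)
  next
    case 2
    then show ?thesis using assms n6
      by (intro bexI[of _ "if j = 1 then 3 else j - 1"]) (auto simp: adjacent_def)
  next
    case 3
    then show ?thesis using assms n6 by (intro bexI[of _ "n - 3"]) (auto simp: adjacent_def)
  next
    case 4
    then show ?thesis using assms n6 by (intro bexI[of _ "n - 3"]) (auto simp: adjacent_def)
  qed
qed

lemma adjacent_irrefl [simp]: "\<not> adjacent n i i"
  using n6 by (auto simp: adjacent_def)

text \<open>The product of the reflections in \<open>al i\<close> and \<open>al j\<close> sends
  \<open>al i\<close> to \<open>al j\<close>, so \<open>conj_sg\<close> applies to the conjugate of
  \<open>sg (al i)\<close> by \<open>sg (al i) ** sg (al j)\<close>.\<close>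

lemma sg_braid_up_to_torus:
  assumes "i \<in> {1..n}" "j \<in> {1..n}" "adjacent n i j"
  shows "\<exists>c. c \<noteq> 0 \<and> sg (al i) ** sg (al j) ** sg (al i) =
    cr (al j) c ** (sg (al j) ** sg (al i) ** sg (al j))"
proof -
  let ?\<phi> = "\<lambda>v. reflection n (al i) (reflection n (al j) v)"
  have ij: "i \<noteq> j" using assms by auto
  have p: "pairing n (al i) (al j) = -1" "pairing n (al j) (al i) = -1"
    using assms ij n6 adjacent_sym[of n i j] by (auto simp: pairing_simple_simple)
  have "reflection n (al j) (al i) = (\<lambda>k. al i k + al j k)"
    by (simp add: reflection_def p)
  moreover have "pairing n (\<lambda>k. al i k + al j k) (al i) = 1"
    using assms by (simp add: pairing_add p D_roots_norm)
  ultimately have \<phi>: "?\<phi> (al i) = al j"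
    by (simp add: reflection_def)
  have act: "acts (sg (al i) ** sg (al j)) ?\<phi>"
    using assms by (intro acts_mult acts_sg) auto
  obtain c where c: "c \<noteq> 0"
    "sg (al i) ** sg (al j) ** sg (al i) ** ginv (sg (al i) ** sg (al j)) = cr (al j) c ** sg (al j)"
    using conj_sg[OF act al_root[OF assms(1)]] al_root[OF assms(2)] unfolding \<phi> by blast
  have "invertible (sg (al i) ** sg (al j))" using assms by simp
  then have "sg (al i) ** sg (al j) ** sg (al i) = cr (al j) c ** sg (al j) ** (sg (al i) ** sg (al j))"
    unfolding c(2)[symmetric] by simp
  with c(1) show ?thesis by (auto simp: matrix_mul_assoc)
qed

text \<open>Exchanging \<open>i\<close> and \<open>j\<close> gives a second factor \<open>d\<close>
  with \<open>cr (al j) c ** cr (al i) d = mat 1\<close>. The roots \<open>al i\<close> and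
  \<open>al j\<close> alone yield only \<open>d = c ^ 2\<close> and \<open>c ^ 3 = 1\<close>; the
  root of a node joined to just one of them makes \<open>c\<close> or \<open>d\<close> equal to
  1.\<close>

lemma sg_braid:
  assumes "i \<in> {1..n}" "j \<in> {1..n}" "adjacent n i j"
  shows "sg (al i) ** sg (al j) ** sg (al i) = sg (al j) ** sg (al i) ** sg (al j)"
proof -
  have sym: "adjacent n j i" using assms(3) adjacent_sym by blast
  have ij: "i \<noteq> j" using assms by auto
  obtain c where c: "c \<noteq> 0"
    "sg (al i) ** sg (al j) ** sg (al i) = cr (al j) c ** (sg (al j) ** sg (al i) ** sg (al j))"
    using sg_braid_up_to_torus[OF assms] by blast
  obtain d where d: "d \<noteq> 0"
    "sg (al j) ** sg (al i) ** sg (al j) = cr (al i) d ** (sg (al i) ** sg (al j) ** sg (al i))"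
    using sg_braid_up_to_torus[OF assms(2,1) sym] by blast
  have cd: "cr (al j) c ** cr (al i) d = mat 1"
  proof -
    let ?g = "sg (al i) ** sg (al j) ** sg (al i)"
    have inv: "invertible ?g" using assms by simp
    have "(cr (al j) c ** cr (al i) d) ** ?g = cr (al j) c ** (cr (al i) d ** ?g)"
      by (simp add: matrix_mul_assoc)
    also have "\<dots> = ?g"
      unfolding d(2)[symmetric] c(2)[symmetric] ..
    finally show ?thesis unfolding mult_right_eq_iff[OF inv] using inv by simp
  qed
  have chi_cd: "chi k (cr (al j) c) * chi k (cr (al i) d) = 1" if "k \<in> {1..n}" for k
    using arg_cong[OF cd, of "chi k"] that assms c d by simp
  obtain k where k: "k \<in> {1..n}" "k \<noteq> i" "k \<noteq> j"
    "adjacent n i k \<and> \<not> adjacent n j k \<or> \<not> adjacent n i k \<and> adjacent n j k"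
    using adjacent_third[OF assms] by blast
  have "c = 1"
  proof (cases "adjacent n j k")
    case True
    then show ?thesis using chi_cd[OF k(1)] k assms c d by (auto simp: chi_cr)
  next
    case False
    then have "d = 1" using chi_cd[OF k(1)] k assms c d by (auto simp: chi_cr)
    then show ?thesis using chi_cd[OF assms(1)] assms c d sym ij by (auto simp: chi_cr)
  qed
  then show ?thesis using c assms by (simp add: cr_one)
qed

lemma sg_commute:
  assumes "i \<in> {1..n}" "j \<in> {1..n}" "i \<noteq> j" "\<not> adjacent n i j"
  shows "sg (al i) ** sg (al j) = sg (al j) ** sg (al i)"
  using assms n6 by (intro orthogonal_sg_commute) (auto simp: pairing_simple_simple)

section \<open>Sections and lifts of the simple reflections\<close>

text \<open>The set \<open>{1..n}\<close> is a parameter of the locale instance below and must not be rewritten.\<close>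

declare One_nat_def [simp del]

section \<open>The Weyl group as a reflection system\<close>

abbreviation "sr \<equiv> simple_refl n G T u"

lemma sr_eq: "sr i = pr (sg (al i))"
  by (simp add: simple_refl_def)

lemma sg_square_T: "r \<in> D_roots n \<Longrightarrow> sg r ** sg r \<in> T"
  by (simp add: sg_square)

lemma pr_closed: "g \<in> N \<Longrightarrow> pr g \<in> carrier W"
  by (simp add: carrier_W)

lemma pr_sg_square: "r \<in> D_roots n \<Longrightarrow> pr (sg r) \<otimes>\<^bsub>W\<^esub> pr (sg r) = \<one>\<^bsub>W\<^esub>"
  by (simp add: pr_mult pr_T sg_square_T)

lemma pr_ginv_sg:
  assumes "r \<in> D_roots n"
  shows "pr (ginv (sg r)) = pr (sg r)"
proof -
  have "sg r = (sg r ** sg r) ** ginv (sg r)" using assms by simp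
  then have "\<exists>t\<in>T. sg r = t ** ginv (sg r)" using sg_square_T[OF assms] by blast
  then show ?thesis using assms by (simp add: pr_eq_iff[symmetric])
qed

lemma pr_sg_reflection:
  assumes "i \<in> {1..n}" "r \<in> D_roots n"
  shows "pr (sg (reflection n (al i) r)) = sr i \<otimes>\<^bsub>W\<^esub> pr (sg r) \<otimes>\<^bsub>W\<^esub> sr i"
proof -
  let ?r' = "reflection n (al i) r"
  have r': "?r' \<in> D_roots n" using assms by (intro reflection_D_roots) auto
  obtain c where c: "c \<noteq> 0" "sg (al i) ** sg r ** ginv (sg (al i)) = cr ?r' c ** sg ?r'"
    using conj_sg[OF acts_sg[OF al_root[OF assms(1)]] assms(2) r'] by blast
  have "pr (sg (al i) ** sg r ** ginv (sg (al i))) = pr (sg ?r')"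
    unfolding c(2) using c(1) r' by (subst pr_eq_iff) auto
  then have "pr (sg ?r') = pr (sg (al i)) \<otimes>\<^bsub>W\<^esub> pr (sg r) \<otimes>\<^bsub>W\<^esub> pr (ginv (sg (al i)))"
    using assms by (simp add: pr_mult)
  then show ?thesis using assms by (simp add: pr_ginv_sg sr_eq)
qed

lemma acts_foldr:
  assumes "set is \<subseteq> {1..n}"
  shows "acts (foldr (\<lambda>i g. sg (al i) ** g) is (mat 1)) (foldr (\<lambda>i. reflection n (al i)) is)"
  using assms
proof (induction "is")
  case Nil
  then show ?case using acts_T[of "mat 1"] by (simp add: id_def)
next
  case (Cons i "is")
  then have "acts (sg (al i) ** foldr (\<lambda>i g. sg (al i) ** g) is (mat 1))
      (\<lambda>v. reflection n (al i) (foldr (\<lambda>i. reflection n (al i)) is v))"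
    by (intro acts_mult acts_sg) auto
  then show ?case by (simp add: comp_def)
qed

lemma foldr_lift:
  assumes "set is \<subseteq> {1..n}" "\<And>i. i \<in> {1..n} \<Longrightarrow> f i \<in> N \<and> pr (f i) = sr i"
  shows "foldr (\<lambda>i g. f i ** g) is (mat 1) \<in> N \<and>
    pr (foldr (\<lambda>i g. f i ** g) is (mat 1)) = foldr (\<lambda>i w. sr i \<otimes>\<^bsub>W\<^esub> w) is \<one>\<^bsub>W\<^esub>"
  using assms(1)
proof (induction "is")
  case (Cons i "is")
  then show ?case using assms(2)[of i] pr_mult[of "f i" "foldr (\<lambda>i g. f i ** g) is (mat 1)"] by simp
qed (simp add: pr_one)

text \<open>Words with the same image in \<open>W\<close> act alike on the roots because their
  representatives differ by an element of \<open>T\<close>, which acts trivially on its own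
  characters.\<close>

sublocale C: reflection_system W "{1..n}" "D_roots n" "\<lambda>r. height n r > 0" "\<lambda>r k. - r k" al
  "\<lambda>i. reflection n (al i)" "\<lambda>r. pr (sg r)" sr
proof (intro reflection_system.intro reflection_system_axioms.intro W_group)
  show "inj_on al {1..n}" using D_simple_inj n6 by simp
  show "foldr (\<lambda>i. reflection n (al i)) is r = foldr (\<lambda>i. reflection n (al i)) js r"
    if "set is \<subseteq> {1..n}" "set js \<subseteq> {1..n}"
      "foldr (\<lambda>i w. sr i \<otimes>\<^bsub>W\<^esub> w) is \<one>\<^bsub>W\<^esub> = foldr (\<lambda>i w. sr i \<otimes>\<^bsub>W\<^esub> w) js \<one>\<^bsub>W\<^esub>"
      "r \<in> D_roots n" for "is" js r
  proof -
    let ?g = "\<lambda>is. foldr (\<lambda>i g. sg (al i) ** g) is (mat 1)"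
    have sg: "\<And>i. i \<in> {1..n} \<Longrightarrow> sg (al i) \<in> N \<and> pr (sg (al i)) = sr i" by (simp add: sr_eq)
    have "?g is \<in> N" "?g js \<in> N" "pr (?g is) = pr (?g js)"
      using foldr_lift[OF that(1) sg] foldr_lift[OF that(2) sg] that(3) by auto
    then obtain t where t: "t \<in> T" "?g is = t ** ?g js" using pr_eq_iff by blast
    have "acts (?g is) (\<lambda>v. foldr (\<lambda>i. reflection n (al i)) js v)"
      unfolding t(2) using acts_mult[OF acts_T[OF t(1)] acts_foldr[OF that(2)]] .
    then show ?thesis using acts_unique[OF acts_foldr[OF that(1)]] that(4) by auto
  qed
  show "(height n (\<lambda>k. - r k) > 0) \<longleftrightarrow> \<not> height n r > 0" if "r \<in> D_roots n" for r
    using height_nonzero[OF that] by (auto simp: height_neg)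
qed (use n6 in \<open>auto simp: pr_closed sr_eq pr_sg_reflection height_D_simple reflection_D_roots
    reflection_reflection reflection_neg reflection_self pr_sg_square intro: reflection_positive\<close>)

lemma weyl_word_eq: "weyl_word n G T u is = C.word is"
  by (simp add: weyl_word_def C.word_def)

lemma reduced_eq: "reduced n G T u is = C.red is"
  by (simp add: reduced_def C.red_def weyl_word_eq)

text \<open>Every root arises from a simple one by simple reflections, and
  \<open>pr_sg_reflection\<close> turns each of these into a conjugation by a letter.\<close>

lemma refl_word: "r \<in> D_roots n \<Longrightarrow> \<exists>is. set is \<subseteq> {1..n} \<and> pr (sg r) = C.word is"
proof -
  assume r: "r \<in> D_roots n"
  have "2 \<le> n" using n6 by simp
  from this r show ?thesis
  proof (induction rule: D_roots_induct)
    case (simple i)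
    then have "C.word [i] = sr i" using C.s_closed by simp
    then have eq: "pr (sg (al i)) = C.word [i]" by (simp only: sr_eq)
    have "set [i] \<subseteq> {1..n}" using simple by simp
    with eq show ?case by blast
  next
    case (reflection i r)
    then obtain "is" where "is": "set is \<subseteq> {1..n}" "pr (sg r) = C.word is" by blast
    then have "pr (sg (reflection n (al i) r)) = C.word (i # is @ [i])"
      using reflection C.s_closed[of i]
      by (simp add: pr_sg_reflection C.word_append C.m_assoc)
    then show ?case using "is" reflection by (intro exI[of _ "i # is @ [i]"]) auto
  qed
qed

lemma W_words: "carrier W = C.word ` {is. set is \<subseteq> {1..n}}"
proof (intro subset_antisym subsetI)
  fix w assume "w \<in> carrier W"
  then have "w \<in> generate W ((\<lambda>r. pr (sg r)) ` D_roots n)"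
    using generated by (simp add: generated_by_reflections_def)
  then show "w \<in> C.word ` {is. set is \<subseteq> {1..n}}"
  proof (induction rule: generate.induct)
    case one
    show ?case by (intro image_eqI[of _ _ "[]"]) auto
  next
    case (incl h)
    then show ?case using refl_word by blast
  next
    case (inv h)
    then obtain r where r: "r \<in> D_roots n" "h = pr (sg r)" by blast
    then have "inv\<^bsub>W\<^esub> h = h" using pr_sg_square pr_closed by (intro C.inv_equality) auto
    moreover obtain "is" where "set is \<subseteq> {1..n}" "pr (sg r) = C.word is" using refl_word r by blast
    ultimately show ?case using r by (intro image_eqI[of _ _ "is"]) auto
  next
    case (eng h1 h2)
    then obtain "is" js where "set is \<subseteq> {1..n}" "h1 = C.word is" "set js \<subseteq> {1..n}" "h2 = C.word js" by blast
    then show ?case by (intro image_eqI[of _ _ "is @ js"]) (auto simp: C.word_append)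
  qed
qed auto

lemma W_red_word: "w \<in> carrier W \<Longrightarrow> \<exists>is. C.red is \<and> C.word is = w"
proof -
  assume "w \<in> carrier W"
  then obtain "is" where "set is \<subseteq> {1..n}" "w = C.word is" using W_words by blast
  then show ?thesis using C.red_exists[of "is"] by simp
qed

lemma sr_commute_iff:
  assumes "i \<in> {1..n}" "j \<in> {1..n}" "i \<noteq> j"
  shows "sr i \<otimes>\<^bsub>W\<^esub> sr j = sr j \<otimes>\<^bsub>W\<^esub> sr i \<longleftrightarrow> \<not> adjacent n i j"
proof
  assume "\<not> adjacent n i j"
  then show "sr i \<otimes>\<^bsub>W\<^esub> sr j = sr j \<otimes>\<^bsub>W\<^esub> sr i"
    using assms sg_commute[OF assms] by (simp add: sr_eq pr_mult)
next
  assume comm: "sr i \<otimes>\<^bsub>W\<^esub> sr j = sr j \<otimes>\<^bsub>W\<^esub> sr i"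
  show "\<not> adjacent n i j"
  proof
    assume adj: "adjacent n i j"
    then have p: "pairing n (al i) (al j) = -1"
      using assms n6 by (simp add: pairing_simple_simple)
    have eq: "reflection n (al i) (reflection n (al j) (al i)) = reflection n (al j) (reflection n (al i) (al i))"
      using C.foldr_rho_cong[of "[i, j]" "[j, i]" "al i"] assms comm by simp
    have p': "pairing n (al j) (al i) = -1" "pairing n (al i) (al i) = 2" "pairing n (al j) (al j) = 2"
      using p assms by (simp_all add: pairing_commute[of n "al j" "al i"] D_roots_norm)
    have "2 \<le> n" using n6 by simp
    \<comment> \<open>The two products send \<open>al i\<close> to \<open>al j\<close> and to the
      negative of \<open>al i + al j\<close>.\<close>
    then have "height n (reflection n (al i) (reflection n (al j) (al i))) = 1"
      "height n (reflection n (al j) (reflection n (al i) (al i))) = -2"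
      using assms p p' by (simp_all add: height_reflection height_D_simple pairing_reflection_left)
    with eq show False by simp
  qed
qed

lemma simply_laced: "C.simply_laced"
  unfolding C.simply_laced_def
proof (intro ballI impI)
  fix i j assume ij: "i \<in> {1..n}" "j \<in> {1..n}" "i \<noteq> j"
  show "sr i \<otimes>\<^bsub>W\<^esub> sr j = sr j \<otimes>\<^bsub>W\<^esub> sr i \<or>
      sr i \<otimes>\<^bsub>W\<^esub> (sr j \<otimes>\<^bsub>W\<^esub> sr i) = sr j \<otimes>\<^bsub>W\<^esub> (sr i \<otimes>\<^bsub>W\<^esub> sr j)"
    using sr_commute_iff[OF ij] sg_braid[OF ij(1,2)] ij by (auto simp: sr_eq pr_mult matrix_mul_assoc)
qed

section \<open>Sections and families of lifts\<close>

definition lift :: "(nat \<Rightarrow> 'a^'m^'m) \<Rightarrow> bool" where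
  "lift f \<longleftrightarrow> (\<forall>i\<in>{1..n}. f i \<in> N \<and> pr (f i) = sr i) \<and>
     (\<forall>i\<in>{1..n}. \<forall>j\<in>{1..n}. i \<noteq> j \<longrightarrow> \<not> adjacent n i j \<longrightarrow> f i ** f j = f j ** f i) \<and>
     (\<forall>i\<in>{1..n}. \<forall>j\<in>{1..n}. adjacent n i j \<longrightarrow> f i ** f j ** f i = f j ** f i ** f j)"

text \<open>The two sides of a braid relation are reduced words for the same element of
  \<open>W\<close>, and \<open>S\<close> is multiplicative along each of them.\<close>

lemma section_lift:
  assumes S: "is_section n G T u S"
  shows "lift (\<lambda>i. S (sr i))"
proof -
  have prod: "S (C.word is) = foldr (\<lambda>i g. S (sr i) ** g) is (mat 1)" if "C.red is" for "is"
    using S that by (simp add: is_section_def reduced_eq weyl_word_eq)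
  have mem: "S (sr i) \<in> N \<and> pr (S (sr i)) = sr i" if "i \<in> {1..n}" for i
    using S C.s_closed[OF that] by (auto simp: is_section_def)
  show ?thesis
    unfolding lift_def
  proof (intro conjI ballI impI)
    fix i j assume ij: "i \<in> {1..n}" "j \<in> {1..n}" "i \<noteq> j" "\<not> adjacent n i j"
    then have "C.word [i, j] = C.word [j, i]" using sr_commute_iff by simp
    then have "S (C.word [i, j]) = S (C.word [j, i])" by metis
    then show "S (sr i) ** S (sr j) = S (sr j) ** S (sr i)"
      using prod[OF C.red_pair[OF ij(1,2,3)]] prod[OF C.red_pair[OF ij(2,1)]] ij(3)
      by (simp del: C.word_Cons)
  next
    fix i j assume ij: "i \<in> {1..n}" "j \<in> {1..n}" "adjacent n i j"
    then have ne: "i \<noteq> j" by auto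
    then have nc: "sr i \<otimes>\<^bsub>W\<^esub> sr j \<noteq> sr j \<otimes>\<^bsub>W\<^esub> sr i" using sr_commute_iff ij by simp
    then have "sr i \<otimes>\<^bsub>W\<^esub> (sr j \<otimes>\<^bsub>W\<^esub> sr i) = sr j \<otimes>\<^bsub>W\<^esub> (sr i \<otimes>\<^bsub>W\<^esub> sr j)"
      using simply_laced ij ne unfolding C.simply_laced_def by blast
    then have "C.word [i, j, i] = C.word [j, i, j]" using ij C.s_closed by simp
    then have "S (C.word [i, j, i]) = S (C.word [j, i, j])" by metis
    then show "S (sr i) ** S (sr j) ** S (sr i) = S (sr j) ** S (sr i) ** S (sr j)"
      using prod[OF C.red_triple[OF ij(1,2) ne nc]] prod[OF C.red_triple[OF ij(2,1) ne[symmetric] nc[symmetric]]]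
      by (simp add: matrix_mul_assoc del: C.word_Cons)
  qed (use mem in auto)
qed

text \<open>The value at \<open>w\<close> is read off from an arbitrary reduced word. By
  \<open>C.matsumoto\<close> it does not depend on the choice, which gives multiplicativity along
  every reduced word.\<close>

lemma lift_section:
  assumes f: "lift f"
  shows "\<exists>S. is_section n G T u S \<and> (\<forall>i\<in>{1..n}. S (sr i) = f i)"
proof -
  let ?p = "\<lambda>is. foldr (\<lambda>i g. f i ** g) is (mat 1)"
  have mem: "\<And>i. i \<in> {1..n} \<Longrightarrow> f i \<in> N \<and> pr (f i) = sr i" using f by (simp add: lift_def)
  define rep where "rep w = (SOME is. C.red is \<and> C.word is = w)" for w
  have rep: "C.red (rep w) \<and> C.word (rep w) = w" if "w \<in> carrier W" for w
    unfolding rep_def by (rule someI_ex[OF W_red_word[OF that]])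
  have br: "C.braided GL f"
    unfolding C.braided_def
  proof (intro ballI impI conjI)
    fix i j assume ij: "i \<in> {1..n}" "j \<in> {1..n}" "i \<noteq> j"
    show "f i \<otimes>\<^bsub>GL\<^esub> f j = f j \<otimes>\<^bsub>GL\<^esub> f i" if "sr i \<otimes>\<^bsub>W\<^esub> sr j = sr j \<otimes>\<^bsub>W\<^esub> sr i"
      using f ij that sr_commute_iff[OF ij] unfolding lift_def GL_simps by blast
    show "f i \<otimes>\<^bsub>GL\<^esub> (f j \<otimes>\<^bsub>GL\<^esub> f i) = f j \<otimes>\<^bsub>GL\<^esub> (f i \<otimes>\<^bsub>GL\<^esub> f j)"
      if "sr i \<otimes>\<^bsub>W\<^esub> sr j \<noteq> sr j \<otimes>\<^bsub>W\<^esub> sr i"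
    proof -
      have "f i ** f j ** f i = f j ** f i ** f j"
        using f ij that sr_commute_iff[OF ij] unfolding lift_def by blast
      then show ?thesis by (simp only: GL_simps matrix_mul_assoc)
    qed
  qed
  have closed: "f \<in> {1..n} \<rightarrow> carrier GL" using mem by auto
  have same: "?p is = ?p js" if "C.red is" "C.red js" "C.word is = C.word js" for "is" js
    using C.matsumoto[OF simply_laced GL.monoid_axioms closed br that] by simp
  define S where "S w = ?p (rep w)" for w
  have S: "S (C.word is) = ?p is" if "C.red is" for "is"
  proof -
    have "C.word is \<in> carrier W" using that by (simp add: C.red_def)
    then show ?thesis unfolding S_def using rep that by (intro same) auto
  qed
  have f1: "S (sr i) = f i" if "i \<in> {1..n}" for i
    using S[OF C.red_single[OF that]] C.s_closed[OF that] by simp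
  have pS: "S w \<in> N \<and> pr (S w) = w" if "w \<in> carrier W" for w
    using foldr_lift[OF _ mem, of "rep w"] rep[OF that] by (simp add: S_def C.red_def C.word_def)
  have "S (weyl_word n G T u is) = foldr (\<lambda>i g. S (sr i) ** g) is (mat 1)"
    if "reduced n G T u is" for "is"
  proof -
    have "foldr (\<lambda>i g. S (sr i) ** g) is (mat 1) = ?p is"
      using that f1 by (intro foldr_cong) (auto simp: reduced_def)
    then show ?thesis using S that by (simp add: reduced_eq weyl_word_eq)
  qed
  then have "is_section n G T u S"
    using pS by (auto simp: is_section_def)
  then show ?thesis using f1 by blast
qed

lemma section_homomorphic:
  assumes S: "is_section n G T u S" and square: "\<And>i. i \<in> {1..n} \<Longrightarrow> S (sr i) ** S (sr i) = mat 1"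
  shows "homomorphic G T S"
proof -
  have "group (torus_normalizer G T)"
    using T_normal by (simp add: normal_def)
  then have mon: "monoid (torus_normalizer G T)" by (rule group.is_monoid)
  have mem: "(\<lambda>i. S (sr i)) \<in> {1..n} \<rightarrow> carrier (torus_normalizer G T)"
    using section_lift[OF S] by (auto simp: lift_def)
  have "S \<in> hom W (torus_normalizer G T)"
    using S square
    by (intro C.involutive_lift_hom[OF mon mem W_words])
      (auto simp: is_section_def reduced_eq weyl_word_eq)
  then show ?thesis by (simp add: homomorphic_def)
qed

text \<open>Both sections are products over the same reduced word, and conjugation by
  \<open>t\<close> acts on each factor separately.\<close>

lemma T_conjugate_iff:
  assumes S: "is_section n G T u S" and S': "is_section n G T u S'"
  shows "T_conjugate G T S S' \<longleftrightarrow> (\<exists>t\<in>T. \<forall>i\<in>{1..n}. t ** S (sr i) ** ginv t = S' (sr i))"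
proof
  assume "T_conjugate G T S S'"
  then show "\<exists>t\<in>T. \<forall>i\<in>{1..n}. t ** S (sr i) ** ginv t = S' (sr i)"
    using C.s_closed unfolding T_conjugate_def by blast
next
  assume "\<exists>t\<in>T. \<forall>i\<in>{1..n}. t ** S (sr i) ** ginv t = S' (sr i)"
  then obtain t where t: "t \<in> T" "\<And>i. i \<in> {1..n} \<Longrightarrow> t ** S (sr i) ** ginv t = S' (sr i)" by blast
  have "t ** S w ** ginv t = S' w" if w: "w \<in> carrier W" for w
  proof -
    obtain "is" where "is": "C.red is" "w = C.word is" using W_red_word[OF w] by blast
    have "t ** foldr (\<lambda>i g. S (sr i) ** g) js (mat 1) ** ginv t = foldr (\<lambda>i g. S' (sr i) ** g) js (mat 1)"
      if "set js \<subseteq> {1..n}" for js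
      using that
    proof (induction js)
      case Nil
      then show ?case using t by simp
    next
      case (Cons j js)
      let ?q = "foldr (\<lambda>i g. S (sr i) ** g) js (mat 1)"
      have "t ** (S (sr j) ** ?q) ** ginv t = (t ** S (sr j) ** ginv t) ** (t ** ?q ** ginv t)"
        using t(1) by (simp add: matrix_mul_assoc)
      then show ?case using Cons t(2) by simp
    qed
    then show ?thesis using S S' "is" by (simp add: is_section_def reduced_eq weyl_word_eq C.red_def)
  qed
  then show "T_conjugate G T S S'" using t(1) by (auto simp: T_conjugate_def)
qed

section \<open>The equations satisfied by the coordinates of a section\<close>

text \<open>\<open>sg_T\<close> concerns conjugation by the inverse. As \<open>sg r ** sg r\<close>
  lies in the commutative group \<open>T\<close>, conjugation by \<open>sg r\<close> itself has the
  same effect.\<close>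

lemma sg_mult_T:
  assumes r: "r \<in> D_roots n" and t: "t \<in> T"
  shows "sg r ** t = t ** cr r (inverse (psi r t)) ** sg r"
proof -
  have "sg r ** t ** ginv (sg r) = (sg r ** sg r) ** (ginv (sg r) ** t ** sg r) ** ginv (sg r ** sg r)"
    using r by (simp add: matrix_mul_assoc)
  also have "\<dots> = (ginv (sg r) ** t ** sg r) ** (sg r ** sg r) ** ginv (sg r ** sg r)"
    using T_commute[of "sg r ** sg r" "ginv (sg r) ** t ** sg r"] sg_square_T r t by simp
  also have "\<dots> = ginv (sg r) ** t ** sg r"
    using r by (simp add: matrix_mul_assoc)
  also have "\<dots> = t ** cr r (inverse (psi r t))" by (rule sg_T[OF r t])
  finally show ?thesis using r by (simp add: mult_right_eq_iff)
qed

text \<open>The value of the simple root \<open>\<alpha>\<^sub>k\<close> at \<open>\<alpha>\<^sub>i\<^sup>\<vee>(z)\<close>.\<close>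

definition coroot_coord :: "nat \<Rightarrow> nat \<Rightarrow> 'a \<Rightarrow> 'a" where
  "coroot_coord i k z = (if i = k then z ^ 2 else if adjacent n i k then inverse z else 1)"

text \<open>\<open>x i j\<close> stands for the value of \<open>al j\<close> on the torus part of
  the lift of \<open>sr i\<close>. The last two clauses are the braid relations after the torus
  factors have been moved to the left and the products of the \<open>sg\<close> cancelled.\<close>

definition compatible :: "(nat \<Rightarrow> nat \<Rightarrow> 'a) \<Rightarrow> bool" where
  "compatible x \<longleftrightarrow> (\<forall>i\<in>{1..n}. \<forall>j\<in>{1..n}. x i j \<noteq> 0) \<and>
     (\<forall>i\<in>{1..n}. \<forall>j\<in>{1..n}. i \<noteq> j \<longrightarrow> \<not> adjacent n i j \<longrightarrow>
       (\<forall>k\<in>{1..n}. coroot_coord i k (inverse (x j i)) = coroot_coord j k (inverse (x i j)))) \<and>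
     (\<forall>i\<in>{1..n}. \<forall>j\<in>{1..n}. adjacent n i j \<longrightarrow>
       (\<forall>k\<in>{1..n}. x i k * coroot_coord i k (inverse (x i i * x i j)) =
          x j k * coroot_coord j k (inverse (x j j * x j i))))"

lemma chi_cr': "i \<in> {1..n} \<Longrightarrow> j \<in> {1..n} \<Longrightarrow> z \<noteq> 0 \<Longrightarrow> chi j (cr (al i) z) = coroot_coord i j z"
  by (simp add: chi_cr coroot_coord_def)

lemma mult_sg_eq_iff:
  assumes "s \<in> T" "t \<in> T" "g \<in> N"
  shows "s ** g = t ** g \<longleftrightarrow> (\<forall>k\<in>{1..n}. chi k s = chi k t)"
proof -
  have "s ** g = t ** g \<longleftrightarrow> s = t" using assms by (simp add: mult_right_eq_iff)
  then show ?thesis using T_eqI assms by blast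
qed

lemma commute_iff:
  assumes i: "i \<in> {1..n}" and j: "j \<in> {1..n}" and "i \<noteq> j" "\<not> adjacent n i j"
    and s: "s \<in> T" and t: "t \<in> T"
  shows "(s ** sg (al i)) ** (t ** sg (al j)) = (t ** sg (al j)) ** (s ** sg (al i)) \<longleftrightarrow>
    (\<forall>k\<in>{1..n}. coroot_coord i k (inverse (chi i t)) = coroot_coord j k (inverse (chi j s)))"
proof -
  have "(s ** sg (al i)) ** (t ** sg (al j)) = s ** (sg (al i) ** t) ** sg (al j)"
    by (simp add: matrix_mul_assoc)
  also have "\<dots> = (s ** t ** cr (al i) (inverse (chi i t))) ** (sg (al i) ** sg (al j))"
    using i t by (simp only: sg_mult_T al_root matrix_mul_assoc)
  finally have 1: "(s ** sg (al i)) ** (t ** sg (al j)) =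
    (s ** t ** cr (al i) (inverse (chi i t))) ** (sg (al i) ** sg (al j))" .
  have "(t ** sg (al j)) ** (s ** sg (al i)) = t ** (sg (al j) ** s) ** sg (al i)"
    by (simp add: matrix_mul_assoc)
  also have "\<dots> = (t ** s ** cr (al j) (inverse (chi j s))) ** (sg (al j) ** sg (al i))"
    using j s by (simp only: sg_mult_T al_root matrix_mul_assoc)
  also have "sg (al j) ** sg (al i) = sg (al i) ** sg (al j)"
    using sg_commute assms by metis
  finally have 2: "(t ** sg (al j)) ** (s ** sg (al i)) =
    (t ** s ** cr (al j) (inverse (chi j s))) ** (sg (al i) ** sg (al j))" .
  show ?thesis
    unfolding 1 2 using assms
    by (subst mult_sg_eq_iff) (simp_all add: chi_cr' mult.commute)
qed

lemma braid_expand: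
  assumes i: "i \<in> {1..n}" and j: "j \<in> {1..n}" and adj: "adjacent n i j"
    and s: "s \<in> T" and t: "t \<in> T"
  shows "(s ** sg (al i)) ** (t ** sg (al j)) ** (s ** sg (al i)) =
    (s ** t ** s ** cr (al i) (inverse (chi i t)) ** cr (al j) (inverse (chi j s)) **
      cr (al i) (inverse (chi i s * chi j s))) ** (sg (al i) ** sg (al j) ** sg (al i))"
proof -
  have nz: "chi i t \<noteq> 0" "chi j s \<noteq> 0" "chi i s \<noteq> 0" using i j s t by simp_all
  have adj': "adjacent n j i" using adj adjacent_sym by blast
  have ij: "i \<noteq> j" using adj by auto
  \<comment> \<open>\<open>w ** sg (al j) = sg (al j) ** s\<close>, and \<open>al i\<close> picks up
    the factor \<open>chi j s\<close> on \<open>w\<close> because its pairing with the coroot of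
    \<open>al j\<close> is -1.\<close>
  define w where "w = s ** cr (al j) (inverse (chi j s))"
  have w: "w \<in> T" using j s nz by (simp add: w_def)
  have chi_w: "chi i w = chi i s * chi j s"
    using adj' ij i j s nz by (simp add: w_def chi_cr)
  have "(s ** sg (al i)) ** (t ** sg (al j)) ** (s ** sg (al i)) =
      s ** (sg (al i) ** t) ** (sg (al j) ** s) ** sg (al i)"
    by (simp add: matrix_mul_assoc)
  also have "\<dots> = s ** (t ** cr (al i) (inverse (chi i t))) ** (sg (al i) ** w) ** (sg (al j) ** sg (al i))"
    unfolding sg_mult_T[OF al_root[OF i] t] sg_mult_T[OF al_root[OF j] s] w_def
    by (simp add: matrix_mul_assoc)
  also have "\<dots> = (s ** (t ** cr (al i) (inverse (chi i t))) ** w) ** cr (al i) (inverse (chi i s * chi j s)) **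
      (sg (al i) ** sg (al j) ** sg (al i))"
    unfolding sg_mult_T[OF al_root[OF i] w] chi_w by (simp add: matrix_mul_assoc)
  also have "s ** (t ** cr (al i) (inverse (chi i t))) ** w =
      s ** t ** s ** cr (al i) (inverse (chi i t)) ** cr (al j) (inverse (chi j s))"
  proof -
    have "cr (al i) (inverse (chi i t)) ** s = s ** cr (al i) (inverse (chi i t))"
      using i s nz by (intro T_commute) simp_all
    then have "s ** t ** (cr (al i) (inverse (chi i t)) ** s) ** cr (al j) (inverse (chi j s)) =
        s ** t ** (s ** cr (al i) (inverse (chi i t))) ** cr (al j) (inverse (chi j s))" by simp
    then show ?thesis by (simp add: w_def matrix_mul_assoc)
  qed
  finally show ?thesis .
qed

text \<open>The two expansions share the factors \<open>s ** t\<close>,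
  \<open>cr (al i) (inverse (chi i t))\<close> and \<open>cr (al j) (inverse (chi j s))\<close>;
  after cancelling them each side keeps one torus part and one coroot.\<close>

lemma braid_iff:
  assumes i: "i \<in> {1..n}" and j: "j \<in> {1..n}" and adj: "adjacent n i j"
    and s: "s \<in> T" and t: "t \<in> T"
  shows "(s ** sg (al i)) ** (t ** sg (al j)) ** (s ** sg (al i)) =
      (t ** sg (al j)) ** (s ** sg (al i)) ** (t ** sg (al j)) \<longleftrightarrow>
    (\<forall>k\<in>{1..n}. chi k s * coroot_coord i k (inverse (chi i s * chi j s)) =
      chi k t * coroot_coord j k (inverse (chi j t * chi i t)))"
proof -
  have adj': "adjacent n j i" using adj adjacent_sym by blast
  have nz: "chi k s \<noteq> 0" "chi k t \<noteq> 0" if "k \<in> {1..n}" for k using that s t by simp_all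
  have cz: "coroot_coord i k z \<noteq> 0" if "z \<noteq> 0" for i k z using that by (simp add: coroot_coord_def)
  show ?thesis
    unfolding braid_expand[OF i j adj s t] braid_expand[OF j i adj' t s] sg_braid[OF j i adj']
    by (subst mult_sg_eq_iff) (use i j s t nz cz in \<open>auto simp: chi_cr' simp del: inverse_mult_distrib\<close>)
qed

lemma lift_iff_compatible:
  assumes t: "\<And>i. i \<in> {1..n} \<Longrightarrow> t i \<in> T"
  shows "lift (\<lambda>i. t i ** sg (al i)) \<longleftrightarrow> compatible (\<lambda>i j. chi j (t i))"
proof -
  have mem: "t i ** sg (al i) \<in> N \<and> pr (t i ** sg (al i)) = sr i" if "i \<in> {1..n}" for i
    using that t pr_mult[of "t i" "sg (al i)"] by (simp add: pr_T sr_eq pr_closed)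
  show ?thesis
    unfolding lift_def compatible_def
    by (intro conj_cong ball_cong refl imp_cong)
      (use mem t in \<open>simp_all add: commute_iff braid_iff\<close>)
qed

lemma lift_cong:
  assumes "\<And>i. i \<in> {1..n} \<Longrightarrow> f i = g i"
  shows "lift f \<longleftrightarrow> lift g"
  using assms unfolding lift_def by simp

lemma lift_torus_part:
  assumes "lift f" "i \<in> {1..n}"
  shows "f i ** ginv (sg (al i)) \<in> T"
proof -
  have "f i \<in> N" "pr (f i) = pr (sg (al i))" using assms by (auto simp: lift_def sr_eq)
  then obtain t where "t \<in> T" "f i = t ** sg (al i)" using assms(2) pr_eq_iff by auto
  then show ?thesis using assms(2) by simp
qed

definition lift_coords :: "(nat \<Rightarrow> 'a^'m^'m) \<Rightarrow> nat \<Rightarrow> nat \<Rightarrow> 'a" where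
  "lift_coords f i j = chi j (f i ** ginv (sg (al i)))"

lemma lift_compatible:
  assumes "lift f"
  shows "compatible (lift_coords f)"
proof -
  have "lift (\<lambda>i. (f i ** ginv (sg (al i))) ** sg (al i)) \<longleftrightarrow> lift f"
    by (rule lift_cong) simp
  then show ?thesis
    using assms lift_iff_compatible[of "\<lambda>i. f i ** ginv (sg (al i))"] lift_torus_part[OF assms]
    unfolding lift_coords_def by simp
qed

lemma
  assumes "compatible x"
  shows compatible_nonzero: "i \<in> {1..n} \<Longrightarrow> j \<in> {1..n} \<Longrightarrow> x i j \<noteq> 0"
    and compatible_commute: "i \<in> {1..n} \<Longrightarrow> j \<in> {1..n} \<Longrightarrow> k \<in> {1..n} \<Longrightarrow> i \<noteq> j \<Longrightarrow> \<not> adjacent n i j \<Longrightarrow>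
      coroot_coord i k (inverse (x j i)) = coroot_coord j k (inverse (x i j))"
    and compatible_braid: "i \<in> {1..n} \<Longrightarrow> j \<in> {1..n} \<Longrightarrow> k \<in> {1..n} \<Longrightarrow> adjacent n i j \<Longrightarrow>
      x i k * coroot_coord i k (inverse (x i i * x i j)) = x j k * coroot_coord j k (inverse (x j j * x j i))"
  using assms unfolding compatible_def by blast+

section \<open>Consequences of the coordinate equations\<close>

lemma no_triangle: "adjacent n i j \<Longrightarrow> adjacent n j k \<Longrightarrow> \<not> adjacent n i k"
  using n6 by (auto simp: adjacent_def)

lemma adjacent_exists: "i \<in> {1..n} \<Longrightarrow> \<exists>k\<in>{1..n}. adjacent n i k"
  using n6
  by (intro bexI[of _ "if i = 1 then 2 else if i = n then n - 2 else i - 1"]) (auto simp: adjacent_def)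

text \<open>The excluded pair consists of the two ends of the fork, whose only neighbour
  \<open>n - 2\<close> is common to both.\<close>

lemma separating_neighbour:
  assumes "i \<in> {1..n}" "j \<in> {1..n}" "i \<noteq> j" "\<not> adjacent n i j" "{i, j} \<noteq> {n - 1, n}"
  shows "\<exists>k\<in>{1..n}. adjacent n i k \<and> \<not> adjacent n j k \<or> adjacent n j k \<and> \<not> adjacent n i k"
proof -
  have *: "\<exists>k\<in>{1..n}. adjacent n i k \<and> \<not> adjacent n j k \<or> adjacent n j k \<and> \<not> adjacent n i k"
    if "i \<in> {1..n}" "j \<in> {1..n}" "i < j" "\<not> adjacent n i j" "\<not> (i = n - 1 \<and> j = n)" for i j
  proof -
    have "i = 1 \<or> i \<ge> 2" using that(1) by auto
    then consider "i = 1" "j = 3" | "i = 1" "j \<noteq> 3" | "i \<ge> 2" by blast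
    then show ?thesis
    proof cases
      case 1
      then show ?thesis using n6 by (intro bexI[of _ 4]) (auto simp: adjacent_def)
    next
      case 2
      then have "adjacent n i 2" "\<not> adjacent n j 2" using that n6 by (auto simp: adjacent_def)
      then show ?thesis using n6 by (intro bexI[of _ 2]) auto
    next
      case 3
      have "i - 1 \<in> {1..n}" "i = Suc (i - 1)" "i < n"
        using 3 that(2,3) unfolding atLeastAtMost_iff by linarith+
      moreover from this have "adjacent n i (i - 1)" by (simp add: adjacent_def)
      \<comment> \<open>Since \<open>i < j\<close>, node \<open>i - 1\<close> could meet
        \<open>j\<close> only for \<open>i - 1 = n - 2\<close> and \<open>j = n\<close>, the
        excluded pair.\<close>
      moreover have "\<not> adjacent n j (i - 1)"
        unfolding adjacent_def using that 3 by linarith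
      ultimately show ?thesis by blast
    qed
  qed
  show ?thesis
  proof (cases "i < j")
    case True
    then show ?thesis using *[of i j] assms by blast
  next
    case False
    then have "j < i" using assms(3) by simp
    then show ?thesis using *[of j i] assms adjacent_sym[of n i j] by blast
  qed
qed

lemma compatible_nonadjacent_square:
  assumes "compatible x" "i \<in> {1..n}" "j \<in> {1..n}" "i \<noteq> j" "\<not> adjacent n i j"
  shows "x i j ^ 2 = 1"
  using compatible_commute[OF assms(1-3,3-5)] assms(4,5) by (simp add: coroot_coord_def power_inverse)

text \<open>The commutation equation at a neighbour of just one of the two nodes reads
  \<open>x i j = 1\<close> or \<open>x j i = 1\<close>. In the second case the equation at any
  neighbour of \<open>j\<close> passes this on to \<open>x i j\<close>.\<close>

lemma compatible_nonadjacent: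
  assumes x: "compatible x" and ij: "i \<in> {1..n}" "j \<in> {1..n}" "i \<noteq> j" "\<not> adjacent n i j"
    and exc: "{i, j} \<noteq> {n - 1, n}"
  shows "x i j = 1"
proof -
  obtain k where k: "k \<in> {1..n}"
    "adjacent n i k \<and> \<not> adjacent n j k \<or> adjacent n j k \<and> \<not> adjacent n i k"
    using separating_neighbour[OF ij exc] by blast
  have ne: "k \<noteq> i" "k \<noteq> j" using k ij(4) adjacent_sym[of n i j] by auto
  show ?thesis
  proof (cases "adjacent n j k")
    case True
    then show ?thesis
      using compatible_commute[OF x ij(1,2) k(1) ij(3,4)] k ne by (simp add: coroot_coord_def)
  next
    case False
    then have one: "x j i = 1"
      using compatible_commute[OF x ij(1,2) k(1) ij(3,4)] k ne by (simp add: coroot_coord_def)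
    obtain l where l: "l \<in> {1..n}" "adjacent n j l" using adjacent_exists[OF ij(2)] by blast
    have "l \<noteq> i" "l \<noteq> j" using l ij(4) adjacent_sym[of n i j] by auto
    then show ?thesis
      using compatible_commute[OF x ij(1,2) l(1) ij(3,4)] l one
      by (simp add: coroot_coord_def split: if_splits)
  qed
qed

text \<open>Comes from the braid equation evaluated at \<open>k = i\<close>.\<close>

lemma compatible_edge_inverse:
  assumes x: "compatible x" and ij: "i \<in> {1..n}" "j \<in> {1..n}" "adjacent n i j"
  shows "(x i i * x i j ^ 2) * (x j j * x j i ^ 2) = 1"
proof -
  have ne: "i \<noteq> j" and adj: "adjacent n j i" using ij adjacent_sym by auto
  have nz: "x i i \<noteq> 0" "x i j \<noteq> 0" "x j j \<noteq> 0" "x j i \<noteq> 0" using compatible_nonzero[OF x] ij by auto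
  show ?thesis
    using compatible_braid[OF x ij(1,2,1,3)] ne adj nz
    by (simp add: coroot_coord_def field_simps power2_eq_square)
qed

text \<open>Comes from the braid equation of the edge between \<open>i\<close> and \<open>j\<close>
  at the node \<open>k\<close>: the diagram has no triangle, so the coroot of \<open>i\<close> is
  trivial under the root of \<open>k\<close>.\<close>

lemma compatible_path:
  assumes x: "compatible x" and mem: "i \<in> {1..n}" "j \<in> {1..n}" "k \<in> {1..n}"
    and adj: "adjacent n j i" "adjacent n j k" and ik: "i \<noteq> k"
  shows "x j k * x j j * x j i = x i k"
proof -
  have ij: "adjacent n i j" using adj adjacent_sym by blast
  have "\<not> adjacent n i k" using no_triangle[OF ij adj(2)] .
  then show ?thesis
    using compatible_braid[OF x mem(1,2,3) ij] ik adj by (auto simp: coroot_coord_def mult.assoc)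
qed

lemma compatible_node_inverse:
  assumes x: "compatible x" and mem: "i \<in> {1..n}" "j \<in> {1..n}" "k \<in> {1..n}"
    and adj: "adjacent n j i" "adjacent n j k" and ik: "i \<noteq> k"
  shows "(x j j * x j i ^ 2) * (x j j * x j k ^ 2) = 1"
proof -
  have "\<not> adjacent n i k" using no_triangle adj adjacent_sym by blast
  then have "x i k ^ 2 = 1" using compatible_nonadjacent_square[OF x] mem ik by blast
  then have "(x j k * x j j * x j i) ^ 2 = 1" using compatible_path[OF assms] by simp
  then show ?thesis by (simp add: power2_eq_square mult_ac)
qed

text \<open>The common sign of \<open>compatible_eps\<close>, read off at the edge from 1 to 2,
  where it is the parameter \<open>a 1 1 * a 1 2 ^ 2\<close> of the theorem.\<close>

abbreviation "eps x \<equiv> x 1 1 * x 1 2 ^ 2"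

text \<open>The products \<open>y\<^sub>i\<^sub>j = x\<^sub>i\<^sub>i x\<^sub>i\<^sub>j\<^sup>2\<close> over the oriented edges are propagated along the diagram
  by \<open>y\<^sub>i\<^sub>j y\<^sub>j\<^sub>i = 1\<close> and \<open>y\<^sub>j\<^sub>i y\<^sub>j\<^sub>k = 1\<close>; the three edges at the branch node force \<open>y\<^sup>2 = 1\<close>.\<close>

lemma
  assumes x: "compatible x"
  shows compatible_eps_square: "eps x ^ 2 = 1"
    and compatible_eps: "i \<in> {1..n} \<Longrightarrow> j \<in> {1..n} \<Longrightarrow> adjacent n i j \<Longrightarrow> x i i * x i j ^ 2 = eps x"
proof -
  define y where "y i j = x i i * x i j ^ 2" for i j
  have edge: "y i j * y j i = 1" if "i \<in> {1..n}" "j \<in> {1..n}" "adjacent n i j" for i j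
    unfolding y_def by (rule compatible_edge_inverse[OF x that])
  have node: "y j i * y j k = 1"
    if "i \<in> {1..n}" "j \<in> {1..n}" "k \<in> {1..n}" "adjacent n j i" "adjacent n j k" "i \<noteq> k" for i j k
    unfolding y_def by (rule compatible_node_inverse[OF x that])
  define e where "e = y (n - 2) (n - 3)"
  have branch: "adjacent n (n - 2) (n - 3)" "adjacent n (n - 2) (n - 1)" "adjacent n (n - 2) n"
    and mem: "n - 3 \<in> {1..n}" "n - 2 \<in> {1..n}" "n - 1 \<in> {1..n}" "n \<in> {1..n}"
    using n6 by (auto simp: adjacent_def)
  have ne: "n - 3 \<noteq> n - 1" "n - 3 \<noteq> n" "n - 1 \<noteq> n" using n6 by auto
  have "e * y (n - 2) (n - 1) = 1" "e * y (n - 2) n = 1" "y (n - 2) (n - 1) * y (n - 2) n = 1"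
    unfolding e_def using node mem branch ne by blast+
  then have three: "y (n - 2) (n - 1) = e" "y (n - 2) n = e" "e * e = 1"
    by (metis mult.commute mult_1 mult.assoc)+
  have inv: "b = e" if "e * b = 1" for b
    using that three(3) by (metis mult.assoc mult_1 mult.right_neutral)
  \<comment> \<open>The induction walks from the branch node down the chain to node 1;
    \<open>d\<close> counts the steps from node \<open>n - 3\<close>.\<close>
  have up: "y (n - 3 - d) (n - 3 - d + 1) = e" if "d < n - 3" for d
    using that
  proof (induction d)
    case 0
    have "y (n - 2) (n - 3) * y (n - 3) (n - 2) = 1" using edge mem branch by blast
    moreover have "n - 3 + 1 = n - 2" using n6 by simp
    ultimately show ?case using inv e_def by simp
  next
    case (Suc d)
    define i where "i = n - 3 - d"
    have i: "i \<in> {1..n}" "i - 1 \<in> {1..n}" "i + 1 \<in> {1..n}" "adjacent n i (i - 1)" "adjacent n i (i + 1)"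
      using Suc.prems n6 by (auto simp: i_def adjacent_def)
    have "y i (i + 1) = e" using Suc by (simp add: i_def)
    moreover have "y i (i + 1) * y i (i - 1) = 1" using i by (intro node) auto
    ultimately have "y i (i - 1) = e" using inv by simp
    moreover have "y i (i - 1) * y (i - 1) i = 1" using i by (intro edge) auto
    ultimately have "y (i - 1) i = e" using inv by simp
    moreover have "n - 3 - Suc d = i - 1" "n - 3 - Suc d + 1 = i" using Suc.prems by (auto simp: i_def)
    ultimately show ?case by simp
  qed
  have up': "y i (Suc i) = e" if "1 \<le> i" "i \<le> n - 3" for i
  proof -
    have lt: "n - 3 - i < n - 3" and idx: "n - 3 - (n - 3 - i) = i" using that by auto
    show ?thesis using up[OF lt] unfolding idx Suc_eq_plus1 .
  qed
  have out: "y i j = e" if ij: "i \<in> {1..n}" "j \<in> {1..n}" "j = Suc i \<and> j < n \<or> i + 2 = n \<and> j = n" for i j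
  proof -
    consider "i \<le> n - 3" "j = Suc i" | "i = n - 2" "j = n - 1" | "i = n - 2" "j = n"
      using ij n6 by auto linarith
    then show ?thesis using up'[of i] three ij by cases auto
  qed
  have all: "y i j = e" if ij: "i \<in> {1..n}" "j \<in> {1..n}" "adjacent n i j" for i j
  proof (cases "j = Suc i \<and> j < n \<or> i + 2 = n \<and> j = n")
    case True
    then show ?thesis using out ij by blast
  next
    case False
    then have "y j i = e" using ij by (intro out) (auto simp: adjacent_def)
    moreover have "adjacent n j i" using ij adjacent_sym by blast
    ultimately show ?thesis using edge[of j i] inv ij by simp
  qed
  have e: "eps x = e"
    using all[of 1 2] n6 by (simp add: y_def adjacent_def)
  show "eps x ^ 2 = 1" unfolding e using three by (simp add: power2_eq_square)
  show "x i i * x i j ^ 2 = eps x" if "i \<in> {1..n}" "j \<in> {1..n}" "adjacent n i j"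
    unfolding e using all[OF that] by (simp add: y_def)
qed

text \<open>Commutation gives only that the two entries are one and the same sign. Paths through the
  branch node identify it: those starting at \<open>n - 3\<close> show
  \<open>x (n - 2) (n - 1) = x (n - 2) n\<close>, and the one between the ends of the fork then
  becomes \<open>x (n - 2) (n - 2) * x (n - 2) n ^ 2\<close>.\<close>

lemma compatible_fork:
  assumes x: "compatible x"
  shows "x (n - 1) n = eps x" "x n (n - 1) = eps x"
proof -
  have adj: "adjacent n (n - 2) (n - 3)" "adjacent n (n - 2) (n - 1)" "adjacent n (n - 2) n"
    and mem: "n - 3 \<in> {1..n}" "n - 2 \<in> {1..n}" "n - 1 \<in> {1..n}" "n \<in> {1..n}"
    and nonadj: "\<not> adjacent n (n - 3) (n - 1)" "\<not> adjacent n (n - 3) n"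
    and ne: "n - 3 \<noteq> n - 1" "n - 3 \<noteq> n" "n - 1 \<noteq> n"
    using n6 by (auto simp: adjacent_def)
  have exc: "{n - 3, n - 1} \<noteq> {n - 1, n}" "{n - 3, n} \<noteq> {n - 1, n}" using ne by auto
  have nz: "x (n - 2) (n - 2) \<noteq> 0" "x (n - 2) (n - 3) \<noteq> 0" using compatible_nonzero[OF x] mem by auto
  have "x (n - 2) (n - 1) * x (n - 2) (n - 2) * x (n - 2) (n - 3) = 1"
    using compatible_path[OF x mem(1,2,3) adj(1,2) ne(1)]
      compatible_nonadjacent[OF x mem(1,3) ne(1) nonadj(1) exc(1)] by simp
  moreover have "x (n - 2) n * x (n - 2) (n - 2) * x (n - 2) (n - 3) = 1"
    using compatible_path[OF x mem(1,2,4) adj(1,3) ne(2)]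
      compatible_nonadjacent[OF x mem(1,4) ne(2) nonadj(2) exc(2)] by simp
  ultimately have eq: "x (n - 2) (n - 1) = x (n - 2) n" using nz by (metis mult_right_cancel)
  have e: "x (n - 2) (n - 2) * x (n - 2) n ^ 2 = eps x" using compatible_eps[OF x mem(2,4) adj(3)] .
  show "x (n - 1) n = eps x"
    using compatible_path[OF x mem(3,2,4) adj(2,3) ne(3)] e eq by (simp add: power2_eq_square mult_ac)
  show "x n (n - 1) = eps x"
    using compatible_path[OF x mem(4,2,3) adj(3,2) ne(3)[symmetric]] e eq by (simp add: power2_eq_square mult_ac)
qed

lemma compatible_nonadjacent_eq:
  assumes "compatible x" "compatible x'" "eps x = eps x'"
    and ij: "i \<in> {1..n}" "j \<in> {1..n}" "i \<noteq> j" "\<not> adjacent n i j"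
  shows "x i j = x' i j"
proof (cases "{i, j} = {n - 1, n}")
  case True
  then have "i = n - 1 \<and> j = n \<or> i = n \<and> j = n - 1" by (auto simp: doubleton_eq_iff)
  then show ?thesis using compatible_fork[OF assms(1)] compatible_fork[OF assms(2)] assms(3) by auto
next
  case False
  then show ?thesis using compatible_nonadjacent[OF assms(1) ij] compatible_nonadjacent[OF assms(2) ij] by simp
qed

text \<open>With \<open>t\<close> the torus part, the square is
  \<open>t ** t ** cr (al i) (inverse (?x i i)) ** cr (al i) (- 1)\<close>. Under
  \<open>al k\<close> it takes the value 1 for \<open>k = i\<close>, minus the sign at the
  neighbours by \<open>compatible_eps\<close>, and 1 elsewhere because the coordinates there are
  signs.\<close>

lemma lift_square:
  assumes f: "lift f" and i: "i \<in> {1..n}"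
  shows "f i ** f i = cr (al i) (- eps (lift_coords f))"
proof -
  let ?x = "lift_coords f"
  have x: "compatible ?x" using lift_compatible[OF f] .
  define t where "t = f i ** ginv (sg (al i))"
  have t: "t \<in> T" unfolding t_def using lift_torus_part[OF f i] .
  have ft: "f i = t ** sg (al i)" using i by (simp add: t_def)
  have chi: "chi k t = ?x i k" for k by (simp add: lift_coords_def t_def)
  have nz: "?x i k \<noteq> 0" if "k \<in> {1..n}" for k using compatible_nonzero[OF x i that] .
  have e: "eps ?x ^ 2 = 1" "eps ?x \<noteq> 0" using compatible_eps_square[OF x] by auto
  have einv: "inverse (eps ?x) = eps ?x"
    using e(1) unfolding power2_eq_square[of "eps ?x"] by (rule inverse_unique)
  have "f i ** f i = t ** (sg (al i) ** t) ** sg (al i)" by (simp add: ft matrix_mul_assoc)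
  also have "\<dots> = t ** t ** cr (al i) (inverse (?x i i)) ** (sg (al i) ** sg (al i))"
    unfolding sg_mult_T[OF al_root[OF i] t] chi by (simp add: matrix_mul_assoc)
  also have "\<dots> = t ** t ** cr (al i) (inverse (?x i i)) ** cr (al i) (- 1)"
    using i by (simp add: sg_square)
  also have "\<dots> = cr (al i) (- eps ?x)"
  proof (rule T_eqI)
    fix k assume k: "k \<in> {1..n}"
    have "chi k (t ** t ** cr (al i) (inverse (?x i i)) ** cr (al i) (- 1)) =
        ?x i k * ?x i k * coroot_coord i k (inverse (?x i i)) * coroot_coord i k (- 1)"
      using i k t nz[OF i] by (simp add: chi chi_cr')
    also have "\<dots> = coroot_coord i k (- eps ?x)"
    proof -
      consider "k = i" | "k \<noteq> i" "adjacent n i k" | "k \<noteq> i" "\<not> adjacent n i k" by blast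
      then show ?thesis
      proof cases
        case 1
        have "?x i i * ?x i i * inverse (?x i i) ^ 2 = 1"
          using nz[OF i] by (simp add: power2_eq_square field_simps)
        moreover have "(- eps ?x) ^ 2 = 1" using e(1) by (simp only: power2_minus)
        ultimately show ?thesis using 1 by (simp only: coroot_coord_def if_True) simp
      next
        case 2
        then have "?x i i * ?x i k ^ 2 = eps ?x" using compatible_eps[OF x i k] by simp
        then show ?thesis using 2 einv by (simp add: coroot_coord_def power2_eq_square mult_ac)
      next
        case 3
        then show ?thesis using compatible_nonadjacent_square[OF x i k]
          by (simp add: coroot_coord_def power2_eq_square)
      qed
    qed
    finally show "chi k (t ** t ** cr (al i) (inverse (?x i i)) ** cr (al i) (- 1)) = chi k (cr (al i) (- eps ?x))"
      using i k e by (simp add: chi_cr')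
  qed (use i t nz[OF i] e in auto)
  finally show ?thesis .
qed

text \<open>The root of a neighbouring node takes the value -1 on it, and \<open>char\<close>
  separates -1 from 1.\<close>

lemma cr_minus_one_neq_one:
  assumes "i \<in> {1..n}"
  shows "cr (al i) (- 1) \<noteq> mat 1"
proof
  assume eq: "cr (al i) (- 1) = mat 1"
  obtain k where k: "k \<in> {1..n}" "adjacent n i k" using adjacent_exists[OF assms] by blast
  then have "i \<noteq> k" by auto
  then have "chi k (cr (al i) (- 1)) = - 1" using k assms by (simp add: chi_cr)
  moreover have "chi k (mat 1) = 1" using k by simp
  ultimately have "(2::'a) = 0" using eq by (metis add.right_inverse one_add_one)
  then show False using char by simp
qed

text \<open>Conjugation by \<open>t\<close> divides \<open>?x i k\<close> by \<open>chi i t\<close>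
  at every neighbour \<open>k\<close> of \<open>i\<close> and multiplies \<open>?x i i\<close> by
  its square. So \<open>chi i t\<close> has to be the ratio of the two coordinates at one neighbour
  \<open>nb i\<close>, and the point is that this ratio is the same at all neighbours.\<close>

lemma lifts_conjugate:
  assumes f: "lift f" and f': "lift f'" and eps: "eps (lift_coords f) = eps (lift_coords f')"
  shows "\<exists>t\<in>T. \<forall>i\<in>{1..n}. t ** f i ** ginv t = f' i"
proof -
  let ?x = "lift_coords f" let ?x' = "lift_coords f'"
  have x: "compatible ?x" "compatible ?x'" using lift_compatible f f' by auto
  have nz: "?x i k \<noteq> 0" "?x' i k \<noteq> 0" if "i \<in> {1..n}" "k \<in> {1..n}" for i k
    using compatible_nonzero[OF x(1) that] compatible_nonzero[OF x(2) that] by auto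
  obtain nb where nb: "\<And>i. i \<in> {1..n} \<Longrightarrow> nb i \<in> {1..n} \<and> adjacent n i (nb i)"
    using adjacent_exists by metis
  define z where "z i = ?x i (nb i) / ?x' i (nb i)" for i
  have z0: "z i \<noteq> 0" if "i \<in> {1..n}" for i using nz nb that by (simp add: z_def)
  define t where "t = coords n om z"
  have t: "t \<in> T" and chi_t: "\<And>i. i \<in> {1..n} \<Longrightarrow> chi i t = z i"
    unfolding t_def using z0 by (auto intro!: coords_T chi_coords)
  have "t ** f i ** ginv t = f' i" if i: "i \<in> {1..n}" for i
  proof -
    let ?b = "nb i"
    have b: "?b \<in> {1..n}" "adjacent n i ?b" using nb[OF i] by auto
    have y: "?x i i * ?x i k ^ 2 = ?x' i i * ?x' i k ^ 2" if "k \<in> {1..n}" "adjacent n i k" for k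
      using compatible_eps[OF x(1) i that] compatible_eps[OF x(2) i that] eps by simp
    define s where "s = f i ** ginv (sg (al i))"
    define s' where "s' = f' i ** ginv (sg (al i))"
    have s: "s \<in> T" "s' \<in> T" "f i = s ** sg (al i)" "f' i = s' ** sg (al i)"
      "\<And>k. chi k s = ?x i k" "\<And>k. chi k s' = ?x' i k"
      using lift_torus_part[OF f i] lift_torus_part[OF f' i] i
      by (auto simp: s_def s'_def lift_coords_def)
    have "t ** s = s' ** (t ** cr (al i) (inverse (z i)))"
    proof (rule T_eqI)
      fix k assume k: "k \<in> {1..n}"
      have "?x i k = ?x' i k * coroot_coord i k (inverse (z i))"
      proof -
        consider "k = i" | "k \<noteq> i" "adjacent n i k" | "k \<noteq> i" "\<not> adjacent n i k" by blast
        then show ?thesis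
        proof cases
          case 1
          then show ?thesis using y[OF b] nz[OF i i] nz[OF i b(1)]
            by (simp add: coroot_coord_def z_def field_simps)
        next
          case 2
          have "?x i k * ?x' i ?b = ?x' i k * ?x i ?b"
          proof (cases "k = ?b")
            case False
            have nadj: "\<not> adjacent n ?b k" using no_triangle[of ?b i k] b 2 adjacent_sym by blast
            \<comment> \<open>Each side is the entry between the nonadjacent nodes \<open>?b\<close>
              and \<open>k\<close>, which depends on the sign only. Together with \<open>y\<close>
              this compares the ratios at \<open>k\<close> and at \<open>?b\<close>.\<close>
            have "?x i k * ?x i i * ?x i ?b = ?x' i k * ?x' i i * ?x' i ?b"
              using compatible_path[OF x(1) b(1) i k b(2) 2(2)] compatible_path[OF x(2) b(1) i k b(2) 2(2)]
                compatible_nonadjacent_eq[OF x eps b(1) k _ nadj] False by simp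
            then have "(?x i k * ?x i i * ?x i ?b) * (?x' i i * ?x' i ?b ^ 2) =
                (?x' i k * ?x' i i * ?x' i ?b) * (?x i i * ?x i ?b ^ 2)"
              using y[OF b] by simp
            then have "(?x i i * ?x' i i * ?x i ?b * ?x' i ?b) * (?x i k * ?x' i ?b) =
                (?x i i * ?x' i i * ?x i ?b * ?x' i ?b) * (?x' i k * ?x i ?b)"
              by (simp only: power2_eq_square mult_ac)
            then show ?thesis using nz[OF i i] nz[OF i b(1)] by simp
          qed simp
          then show ?thesis using 2 nz[OF i b(1)] by (simp add: coroot_coord_def z_def field_simps)
        next
          case 3
          then show ?thesis using compatible_nonadjacent_eq[OF x eps i k] by (simp add: coroot_coord_def)
        qed
      qed
      then show "chi k (t ** s) = chi k (s' ** (t ** cr (al i) (inverse (z i))))"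
        using k i t s z0[OF i] by (simp add: chi_cr')
    qed (use t s i z0[OF i] in auto)
    then have "t ** f i = s' ** (t ** cr (al i) (inverse (chi i t)) ** sg (al i))"
      unfolding s(3) by (simp add: chi_t[OF i] matrix_mul_assoc)
    also have "\<dots> = f' i ** t"
      unfolding sg_mult_T[OF al_root[OF i] t, symmetric] s(4) by (simp add: matrix_mul_assoc)
    finally show ?thesis using t by simp
  qed
  then show ?thesis using t by blast
qed

text \<open>The square is the coroot at 1 or at -1, of order 1 or 2 respectively; the lift itself is
  nontrivial because its image in \<open>W\<close> is.\<close>

lemma elt_order_lift:
  assumes f: "lift f" and i: "i \<in> {1..n}"
  shows "elt_order (f i) = (if eps (lift_coords f) = - 1 then 2 else 4)"
proof -
  have x: "compatible (lift_coords f)" using lift_compatible[OF f] .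
  have g: "f i \<in> N" "pr (f i) = sr i" using f i by (auto simp: lift_def)
  then have car: "f i \<in> carrier GL" by simp
  have "f i \<noteq> mat 1" using g(2) pr_one C.s_neq_one[OF i] by metis
  then have ord1: "GL.ord (f i) \<noteq> 1" using GL.ord_eq_1[OF car] by simp
  have pow2: "f i [^]\<^bsub>GL\<^esub> (2::nat) = f i ** f i"
    by (simp add: numeral_2_eq_2)
  have sq: "f i ** f i = cr (al i) (- eps (lift_coords f))" by (rule lift_square[OF f i])
  show ?thesis
  proof (cases "eps (lift_coords f) = - 1")
    case True
    then have "f i ** f i = mat 1" using sq i by (simp add: cr_one)
    then have dvd: "GL.ord (f i) dvd 2" using GL.pow_eq_id[OF car] pow2 by simp
    then have "GL.ord (f i) \<noteq> 0" by (metis dvd_0_left_iff zero_neq_numeral)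
    moreover have "GL.ord (f i) \<le> 2" using dvd by (rule dvd_imp_le) simp
    ultimately have "GL.ord (f i) = 2" using ord1 by linarith
    then show ?thesis using True by (simp add: elt_order_def numeral_eq_enat)
  next
    case False
    have "eps (lift_coords f) = 1"
      using compatible_eps_square[OF x] False by (metis power2_eq_1_iff)
    then have sq': "f i ** f i = cr (al i) (- 1)" using sq by simp
    then have "\<not> GL.ord (f i) dvd 2"
      using GL.pow_eq_id[OF car, of 2] pow2 cr_minus_one_neq_one[OF i] by simp
    moreover have "GL.ord (f i) dvd 4"
    proof -
      have "f i [^]\<^bsub>GL\<^esub> (4::nat) = f i [^]\<^bsub>GL\<^esub> (2::nat) \<otimes>\<^bsub>GL\<^esub> f i [^]\<^bsub>GL\<^esub> (2::nat)"
        using GL.nat_pow_mult[OF car, of 2 2] by simp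
      also have "\<dots> = mat 1"
        using cr_mult[of "al i" "- 1" "- 1"] i by (simp add: pow2 sq' cr_one)
      finally show ?thesis using GL.pow_eq_id[OF car] by simp
    qed
    ultimately have "GL.ord (f i) = 4"
    proof -
      assume *: "\<not> GL.ord (f i) dvd 2" "GL.ord (f i) dvd 4"
      have "GL.ord (f i) \<noteq> 0" using *(2) by (metis dvd_0_left_iff zero_neq_numeral)
      moreover have "GL.ord (f i) \<le> 4" using *(2) by (rule dvd_imp_le) simp
      ultimately consider "GL.ord (f i) = 1" | "GL.ord (f i) = 2" | "GL.ord (f i) = 3" | "GL.ord (f i) = 4"
        by linarith
      then show ?thesis using * by cases auto
    qed
    then show ?thesis using False by (simp add: elt_order_def numeral_eq_enat)
  qed
qed

section \<open>The sign of a section and its order profile\<close>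

definition section_eps :: "(('a^'m^'m) set \<Rightarrow> 'a^'m^'m) \<Rightarrow> 'a" where
  "section_eps S = eps (lift_coords (\<lambda>i. S (sr i)))"

lemma section_eps_cases:
  assumes "is_section n G T u S"
  obtains "section_eps S = 1" | "section_eps S = - 1"
  using compatible_eps_square[OF lift_compatible[OF section_lift[OF assms]]]
  unfolding section_eps_def by (metis power2_eq_1_iff)

lemma section_square:
  "is_section n G T u S \<Longrightarrow> i \<in> {1..n} \<Longrightarrow> S (sr i) ** S (sr i) = cr (al i) (- section_eps S)"
  unfolding section_eps_def by (rule lift_square[OF section_lift])

definition profile2 :: "nat \<Rightarrow> enat" where "profile2 = (\<lambda>i\<in>{1..n}. 2)"
definition profile4 :: "nat \<Rightarrow> enat" where "profile4 = (\<lambda>i\<in>{1..n}. 4)"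

lemma profile_neq: "profile2 \<noteq> profile4"
proof
  assume "profile2 = profile4"
  then have "profile2 1 = profile4 1" by simp
  then show False using n6 by (simp add: profile2_def profile4_def)
qed

lemma profile_eq:
  assumes "is_section n G T u S"
  shows "profile n G T u S = (if section_eps S = - 1 then profile2 else profile4)"
  using elt_order_lift[OF section_lift[OF assms]]
  unfolding profile_def profile2_def profile4_def section_eps_def
  by (auto intro!: restrict_ext)

lemma one_neq_minus_one: "(1::'a) \<noteq> - 1"
  using char by (metis add.right_inverse one_add_one)

text \<open>The square of the lift of a simple reflection lies in \<open>T\<close>, so conjugation
  by \<open>T\<close> preserves it, and it recovers the sign. The other direction is
  \<open>lifts_conjugate\<close>.\<close>

lemma T_conjugate_iff_eps:
  assumes S: "is_section n G T u S" and S': "is_section n G T u S'"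
  shows "T_conjugate G T S S' \<longleftrightarrow> section_eps S = section_eps S'"
proof
  assume "section_eps S = section_eps S'"
  then show "T_conjugate G T S S'"
    using lifts_conjugate[OF section_lift[OF S] section_lift[OF S']]
    by (simp add: T_conjugate_iff[OF S S'] section_eps_def)
next
  assume "T_conjugate G T S S'"
  then obtain t where t: "t \<in> T" "t ** S (sr 1) ** ginv t = S' (sr 1)"
    using T_conjugate_iff[OF S S'] n6 by auto
  have 1: "1 \<in> {1..n}" using n6 by simp
  have nz: "- section_eps S \<noteq> 0" by (cases rule: section_eps_cases[OF S]) simp_all
  have "S' (sr 1) ** S' (sr 1) = t ** (S (sr 1) ** S (sr 1)) ** ginv t"
    using t(1) by (simp add: matrix_mul_assoc flip: t(2))
  also have "\<dots> = cr (al 1) (- section_eps S) ** t ** ginv t"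
    unfolding section_square[OF S 1] using t(1) 1 nz T_commute[of t] by simp
  also have "\<dots> = cr (al 1) (- section_eps S)" using t(1) by simp
  finally have *: "cr (al 1) (- section_eps S') = cr (al 1) (- section_eps S)"
    using section_square[OF S' 1] by simp
  have ne: "cr (al 1) (- 1) \<noteq> cr (al 1) (- (- 1))"
    using cr_minus_one_neq_one[OF 1] 1 by (simp add: cr_one)
  show "section_eps S = section_eps S'"
    by (cases rule: section_eps_cases[OF S]; cases rule: section_eps_cases[OF S'])
      (use * ne in auto)
qed

section \<open>The Tits section and a homomorphic section\<close>

lemma lift_coords_coords:
  assumes "\<And>j. j \<in> {1..n} \<Longrightarrow> x j \<noteq> 0" "f i = coords n om x ** sg (al i)" "i \<in> {1..n}" "j \<in> {1..n}"
  shows "lift_coords f i j = x j"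
  using assms chi_coords[of x j] by (simp add: lift_coords_def)

lemma tits_lift: "lift (\<lambda>i. sg (al i))"
  unfolding lift_def
proof (intro conjI ballI impI)
  show "sg (al i) ** sg (al j) = sg (al j) ** sg (al i)"
    if "i \<in> {1..n}" "j \<in> {1..n}" "i \<noteq> j" "\<not> adjacent n i j" for i j
    by (rule sg_commute[OF that])
  show "sg (al i) ** sg (al j) ** sg (al i) = sg (al j) ** sg (al i) ** sg (al j)"
    if "i \<in> {1..n}" "j \<in> {1..n}" "adjacent n i j" for i j
    by (rule sg_braid[OF that])
  show "sg (al i) \<in> N" "pr (sg (al i)) = sr i" if "i \<in> {1..n}" for i
    using that by (simp_all add: sr_eq)
qed

lemma tits_eps:
  assumes "is_tits_section n G T u S"
  shows "section_eps S = 1"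
  using assms n6 by (simp add: is_tits_section_def section_eps_def lift_coords_def)

lemma tits_exists: "\<exists>S. is_tits_section n G T u S"
  using lift_section[OF tits_lift] by (auto simp: is_tits_section_def)

text \<open>The parameters \<open>a\<^sub>i\<^sub>i = -1\<close> and \<open>a\<^sub>i\<^sub>j = 1\<close> for \<open>i \<noteq> j\<close>.\<close>

definition hom_coord :: "nat \<Rightarrow> nat \<Rightarrow> 'a" where
  "hom_coord i j = (if j = i \<or> (Suc j = i \<and> i < n - 1) \<or> (Suc i = n \<and> j = n) \<or> (i = n \<and> Suc j = n)
     then - 1 else 1)"

text \<open>All entries are signs, so each is its own inverse and \<open>coroot_coord i k z\<close>
  is \<open>z\<close> at neighbours and 1 elsewhere. The equations become comparisons of signs, with
  few positions of \<open>k\<close> relative to the edge.\<close>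

lemma hom_coord_compatible: "compatible hom_coord"
proof -
  have sq: "hom_coord i j ^ 2 = 1" and inv: "inverse (hom_coord i j) = hom_coord i j"
    and nz: "hom_coord i j \<noteq> 0" for i j
    by (simp_all add: hom_coord_def)
  have diag: "hom_coord i i = - 1" for i by (simp add: hom_coord_def)
  have one: "hom_coord i j = 1" if ij: "i \<noteq> j" "\<not> adjacent n i j" "{i, j} \<noteq> {n - 1, n}" for i j
  proof (rule ccontr)
    assume "hom_coord i j \<noteq> 1"
    then consider "j = i" | "Suc j = i" "i < n - 1" | "Suc i = n" "j = n" | "i = n" "Suc j = n"
      unfolding hom_coord_def by presburger
    then show False
    proof cases
      case 2
      then have "i = Suc j \<and> i < n" by linarith
      then show False using ij(2) by (simp add: adjacent_def)
    next
      case 3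
      then have "i = n - 1" by linarith
      then show False using ij(3) 3 by blast
    next
      case 4
      then have "j = n - 1" by linarith
      then show False using ij(3) 4 by blast
    qed (use ij(1) in simp)
  qed
  have fork: "adjacent n (n - 1) k \<longleftrightarrow> adjacent n n k" "hom_coord n (n - 1) = - 1" "hom_coord (n - 1) n = - 1"
    if "k \<in> {1..n}" for k
    using that n6 by (auto simp: adjacent_def hom_coord_def)
  have co: "coroot_coord i k z = (if adjacent n i k then z else 1)" if "z ^ 2 = 1" "inverse z = z" for i k z
    using that by (auto simp: coroot_coord_def)
  have comm: "coroot_coord i k (inverse (hom_coord j i)) = coroot_coord j k (inverse (hom_coord i j))"
    if "i \<in> {1..n}" "j \<in> {1..n}" "k \<in> {1..n}" "i \<noteq> j" "\<not> adjacent n i j" for i j k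
  proof (cases "{i, j} = {n - 1, n}")
    case True
    then have "i = n - 1 \<and> j = n \<or> i = n \<and> j = n - 1" by (auto simp: doubleton_eq_iff)
    then show ?thesis using fork[OF that(3)] by (auto simp: inv co sq)
  next
    case False
    then show ?thesis using one[of i j] one[of j i] that adjacent_sym[of n i j]
      by (auto simp: coroot_coord_def insert_commute)
  qed
  \<comment> \<open>The equation is symmetric in \<open>i\<close> and \<open>j\<close>, so one
    orientation of each edge is enough.\<close>
  have braid: "hom_coord i k * coroot_coord i k (inverse (hom_coord i i * hom_coord i j)) =
      hom_coord j k * coroot_coord j k (inverse (hom_coord j j * hom_coord j i))"
    if "i \<in> {1..n}" "j \<in> {1..n}" and k: "k \<in> {1..n}" and ij: "j = Suc i \<and> j < n \<or> i + 2 = n \<and> j = n"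
    for i j k
  proof -
    have e: "inverse (hom_coord i i * hom_coord i j) = - hom_coord i j" for i j
      by (simp add: diag inv inverse_minus_eq)
    have "hom_coord i k * (if adjacent n i k then - hom_coord i j else 1) =
        hom_coord j k * (if adjacent n j k then - hom_coord j i else 1)"
    proof -
      \<comment> \<open>Writing \<open>n = m + 6\<close> removes the truncated subtractions from the
        case analysis.\<close>
      obtain m where m: "n = m + 6" using n6 by (metis add.commute le_Suc_ex)
      consider "j = Suc i" "i \<le> m + 3" | "i = m + 4" "j = m + 5" | "i = m + 4" "j = m + 6"
        using ij m by linarith
      then show ?thesis
      proof cases
        case 1
        consider "k = i" | "k = Suc i" | "Suc k = i" | "k = Suc (Suc i)"
          | "k < i - 1" | "k > Suc (Suc i)" by linarith
        then show ?thesis using 1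
          by cases (unfold hom_coord_def adjacent_def, simp_all add: m)
      next
        case 2
        consider "k < m + 3" | "k = m + 3" | "k = m + 4" | "k = m + 5" | "k = m + 6"
          using k m by force
        then show ?thesis using 2
          by cases (unfold hom_coord_def adjacent_def, simp_all add: m)
      next
        case 3
        consider "k < m + 3" | "k = m + 3" | "k = m + 4" | "k = m + 5" | "k = m + 6"
          using k m by force
        then show ?thesis using 3
          by cases (unfold hom_coord_def adjacent_def, simp_all add: m)
      qed
    qed
    then show ?thesis unfolding e by (simp add: co sq inv inverse_minus_eq)
  qed
  show ?thesis
    unfolding compatible_def
  proof (intro conjI ballI impI)
    fix i j k assume ij: "i \<in> {1..n}" "j \<in> {1..n}" "adjacent n i j" "k \<in> {1..n}"
    show "hom_coord i k * coroot_coord i k (inverse (hom_coord i i * hom_coord i j)) =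
      hom_coord j k * coroot_coord j k (inverse (hom_coord j j * hom_coord j i))"
    proof (cases "j = Suc i \<and> j < n \<or> i + 2 = n \<and> j = n")
      case True
      then show ?thesis using braid ij by blast
    next
      case False
      then have "i = Suc j \<and> i < n \<or> j + 2 = n \<and> i = n" using ij by (auto simp: adjacent_def)
      then show ?thesis using braid[of j i k] ij by metis
    qed
  next
    show "coroot_coord i k (inverse (hom_coord j i)) = coroot_coord j k (inverse (hom_coord i j))"
      if "i \<in> {1..n}" "j \<in> {1..n}" "i \<noteq> j" "\<not> adjacent n i j" "k \<in> {1..n}" for i j k
      by (rule comm[OF that(1,2,5,3,4)])
  qed (rule nz)
qed

lemma compatible_cong:
  assumes "\<And>i j. i \<in> {1..n} \<Longrightarrow> j \<in> {1..n} \<Longrightarrow> x i j = y i j"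
  shows "compatible x \<longleftrightarrow> compatible y"
  unfolding compatible_def
  by (intro arg_cong2[where f = "(\<and>)"] ball_cong refl imp_cong) (simp_all only: assms)

text \<open>Shows that the sign -1 occurs; otherwise the Tits profile could be the only one and
  hence maximal.\<close>

lemma homomorphic_exists: "\<exists>S. is_section n G T u S \<and> section_eps S = - 1"
proof -
  define f where "f i = coords n om (hom_coord i) ** sg (al i)" for i
  have nz: "hom_coord i j \<noteq> 0" for i j by (simp add: hom_coord_def)
  have T: "coords n om (hom_coord i) \<in> T" for i using nz by (rule coords_T)
  have chi: "chi j (coords n om (hom_coord i)) = hom_coord i j" if "j \<in> {1..n}" for i j
    using chi_coords[of "hom_coord i" j] nz that by blast
  have "compatible (\<lambda>i j. chi j (coords n om (hom_coord i))) \<longleftrightarrow> compatible hom_coord"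
    by (rule compatible_cong) (rule chi)
  moreover note hom_coord_compatible
  ultimately have "lift f"
    unfolding f_def using lift_iff_compatible[of "\<lambda>i. coords n om (hom_coord i)"] T by simp
  then obtain S where S: "is_section n G T u S" "\<forall>i\<in>{1..n}. S (sr i) = f i"
    using lift_section by blast
  have "lift_coords (\<lambda>i. S (sr i)) 1 j = hom_coord 1 j" if "j \<in> {1..n}" for j
    using S n6 nz that by (intro lift_coords_coords) (auto simp: f_def)
  then have "section_eps S = hom_coord 1 1 * hom_coord 1 2 ^ 2"
    using n6 by (simp add: section_eps_def)
  also have "\<dots> = - 1" using n6 by (simp add: hom_coord_def)
  finally show ?thesis using S by blast
qed

section \<open>The two order profiles and optimality\<close>

lemma profile_mem: "is_section n G T u S \<Longrightarrow> profile n G T u S \<in> profiles n G T u"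
  by (auto simp: profiles_def)

lemma profiles_eq: "profiles n G T u = {profile2, profile4}"
proof -
  obtain S where S: "is_section n G T u S" "section_eps S = - 1" using homomorphic_exists by blast
  obtain S' where S': "is_tits_section n G T u S'" using tits_exists by blast
  then have "is_section n G T u S'" by (simp add: is_tits_section_def)
  then have "profile n G T u S' = profile4" using tits_eps[OF S'] one_neq_minus_one by (simp add: profile_eq)
  moreover have "profile n G T u S = profile2" using S by (simp add: profile_eq)
  ultimately have mem: "profile2 \<in> profiles n G T u" "profile4 \<in> profiles n G T u"
    using profile_mem[OF S(1)] profile_mem[OF \<open>is_section n G T u S'\<close>] by simp_all
  have "p = profile2 \<or> p = profile4" if p: "p \<in> profiles n G T u" for p
  proof -
    obtain S where "is_section n G T u S" "p = profile n G T u S" using p unfolding profiles_def by blast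
    then show ?thesis by (simp add: profile_eq)
  qed
  with mem show ?thesis by blast
qed

lemma optimal_iff:
  assumes "is_section n G T u S"
  shows "optimal n G T u S \<longleftrightarrow> section_eps S = - 1"
proof -
  have 1: "1 \<in> {1..n}" using n6 by simp
  have less: "profile_less n profile4 profile2" "\<not> profile_less n profile2 profile2"
    "\<not> profile_less n profile2 profile4"
    using 1 unfolding profile_less_def profile2_def profile4_def by auto
  then have "{p \<in> profiles n G T u. \<not> (\<exists>q\<in>profiles n G T u. profile_less n p q)} = {profile2}"
    unfolding profiles_eq by auto
  then show ?thesis
    using assms profile_neq unfolding optimal_def by (auto simp: profile_eq)
qed

text \<open>The sign is read off at the edge from 1 to 2, hence from the first two coordinates of
  the torus part at node 1.\<close>

lemma section_with_eps:
  assumes "section_with n G T u om a S"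
  shows "section_eps S = a 1 1 * a 1 2 ^ 2"
proof -
  have a: "a 1 1 \<noteq> 0" "a 1 2 \<noteq> 0"
    using assms n6 by (auto simp: section_with_def admissible_def)
  then have nz: "t_coord n a 1 j \<noteq> 0" for j by (simp add: t_coord_def)
  have S1: "S (sr 1) = coords n om (t_coord n a 1) ** sg (al 1)"
    using assms n6 by (simp add: section_with_def)
  have "lift_coords (\<lambda>i. S (sr i)) 1 j = t_coord n a 1 j" if "j \<in> {1..n}" for j
    using lift_coords_coords[of "t_coord n a 1" "\<lambda>i. S (sr i)" 1 j] nz S1 that n6 by simp
  then have "section_eps S = t_coord n a 1 1 * t_coord n a 1 2 ^ 2"
    using n6 by (simp add: section_eps_def)
  then show ?thesis by (simp add: t_coord_def)
qed

end

theorem proposition3p15: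
  fixes n :: nat
    and G T :: "('a::alg_closed_field^'m^'m) set"
    and psi :: "(nat \<Rightarrow> int) \<Rightarrow> 'a^'m^'m \<Rightarrow> 'a"
    and cr u :: "(nat \<Rightarrow> int) \<Rightarrow> 'a \<Rightarrow> 'a^'m^'m"
    and om :: "nat \<Rightarrow> 'a \<Rightarrow> 'a^'m^'m"
  assumes "n \<ge> 6" and "(2::'a) \<noteq> 0"
    and "connected_reductive G" and "almost_simple G" and "maximal_torus G T"
    and "adjoint_group G T" and "type_D n G T psi"
    and "coroots n T psi cr" and "fundamental_coweights n T psi om"
    and "realization n G T psi cr u" and "generated_by_reflections n G T u"
  shows
    "(\<forall>a S. section_with n G T u om a S \<and>
        (\<forall>i\<in>{1..n-2}. a i i * a i (i + 1) ^ 2 = -1) \<and>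
        a (n - 1) (n - 1) * a (n - 1) (n - 2) ^ 2 = -1 \<and> a n n * a n (n - 2) ^ 2 = -1
        \<longrightarrow> optimal n G T u S \<and> homomorphic G T S) \<and>
     (\<forall>N\<^sub>0. is_tits_section n G T u N\<^sub>0 \<longrightarrow> \<not> optimal n G T u N\<^sub>0 \<and>
        (\<forall>i\<in>{1..n}. N\<^sub>0 (simple_refl n G T u i) ** N\<^sub>0 (simple_refl n G T u i) \<noteq> mat 1)) \<and>
     (\<exists>S N\<^sub>0. optimal n G T u S \<and> is_tits_section n G T u N\<^sub>0 \<and>
        profiles n G T u = {profile n G T u S, profile n G T u N\<^sub>0} \<and>
        profile n G T u S \<noteq> profile n G T u N\<^sub>0) \<and>
     (\<forall>a a' S S'. section_with n G T u om a S \<and> section_with n G T u om a' S'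
        \<longrightarrow> (T_conjugate G T S S' \<longleftrightarrow> a 1 1 * a 1 2 ^ 2 = a' 1 1 * a' 1 2 ^ 2)) \<and>
     (\<forall>S S'. is_section n G T u S \<and> is_section n G T u S'
        \<longrightarrow> (T_conjugate G T S S' \<longleftrightarrow> profile n G T u S = profile n G T u S'))"
proof -
  interpret adjoint_type_D n G T psi cr u om
    using assms by unfold_locales (auto simp: connected_reductive_def maximal_torus_def)
  have sec: "is_section n G T u S" if "is_tits_section n G T u S" for S
    using that by (simp add: is_tits_section_def)
  have sec': "is_section n G T u S" if "section_with n G T u om a S" for a S
    using that by (simp add: section_with_def)
  show ?thesis
  proof (intro conjI allI impI)
    fix a S
    assume *: "section_with n G T u om a S \<and>
        (\<forall>i\<in>{1..n-2}. a i i * a i (i + 1) ^ 2 = -1) \<and>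
        a (n - 1) (n - 1) * a (n - 1) (n - 2) ^ 2 = -1 \<and> a n n * a n (n - 2) ^ 2 = -1"
    then have S: "is_section n G T u S" using sec' by blast
    have "1 \<in> {1..n-2}" using n6 by simp
    then have "a 1 1 * a 1 (1 + 1) ^ 2 = -1" using * by blast
    moreover have "section_with n G T u om a S" using * by blast
    ultimately have eps: "section_eps S = -1"
      using section_with_eps by (metis one_add_one)
    then show "optimal n G T u S" using optimal_iff[OF S] by simp
    show "homomorphic G T S"
      using section_square[OF S] eps by (intro section_homomorphic[OF S]) (simp add: cr_one)
  next
    fix N\<^sub>0 assume N: "is_tits_section n G T u N\<^sub>0"
    show "\<not> optimal n G T u N\<^sub>0"
      using optimal_iff[OF sec[OF N]] tits_eps[OF N] one_neq_minus_one by simp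
    show "\<forall>i\<in>{1..n}. N\<^sub>0 (sr i) ** N\<^sub>0 (sr i) \<noteq> mat 1"
      using section_square[OF sec[OF N]] tits_eps[OF N] cr_minus_one_neq_one by simp
  next
    obtain S where S: "is_section n G T u S" "section_eps S = - 1" using homomorphic_exists by blast
    obtain N\<^sub>0 where N: "is_tits_section n G T u N\<^sub>0" using tits_exists by blast
    have "profile n G T u N\<^sub>0 = profile4" "profile n G T u S = profile2"
      using profile_eq[OF sec[OF N]] tits_eps[OF N] one_neq_minus_one profile_eq[OF S(1)] S(2) by auto
    then show "\<exists>S N\<^sub>0. optimal n G T u S \<and> is_tits_section n G T u N\<^sub>0 \<and>
        profiles n G T u = {profile n G T u S, profile n G T u N\<^sub>0} \<and>
        profile n G T u S \<noteq> profile n G T u N\<^sub>0"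
      using S N optimal_iff[OF S(1)] profiles_eq profile_neq
      by (intro exI[of _ S] exI[of _ N\<^sub>0]) simp
  next
    fix a a' S S'
    assume *: "section_with n G T u om a S \<and> section_with n G T u om a' S'"
    then show "T_conjugate G T S S' \<longleftrightarrow> a 1 1 * a 1 2 ^ 2 = a' 1 1 * a' 1 2 ^ 2"
      using T_conjugate_iff_eps[of S S'] sec' section_with_eps by metis
  next
    fix S S'
    assume "is_section n G T u S \<and> is_section n G T u S'"
    then have S: "is_section n G T u S" "is_section n G T u S'" by auto
    show "T_conjugate G T S S' \<longleftrightarrow> profile n G T u S = profile n G T u S'"
      unfolding T_conjugate_iff_eps[OF S] profile_eq[OF S(1)] profile_eq[OF S(2)]
      by (cases rule: section_eps_cases[OF S(1)]; cases rule: section_eps_cases[OF S(2)])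
        (use profile_neq one_neq_minus_one in auto)
  qed
qed

end
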